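(* Let $\mathbb{B}$ be a small category, let $\mathbb{G} = Set^{\mathbb{B}}$, let $\mathbb{I}$ be a directed multigraph and let $\mathcal{D}:\mathbb{I}\to\mathbb{G}$ be a diagram. Let $\kappa:\mathcal{D}\Rightarrow\Delta S$ be a colimiting cocone. Then $\kappa$ is a Van Kampen cocone if and only if for all $X\in\mathbb{B}$, all $i,j\in\mathbb{I}_0$, and all $z\in\mathcal{D}_i(X)$, $z'\in\mathcal{D}_j(X)$, there are no two different proper mapping paths (of sort $X$) in $\mathcal{D}$ connecting $z$ and $z'$.
   Context: $Set^{\mathbb{B}}$ is the category of covariant functors $\mathbb{B}\to Set$ and natural transformations. $\mathbb{I}_0$ and $\mathbb{I}_1$ are the sets of vertices and edges of $\mathbb{I}$; an edge $d:i\to j$ has source $s(d)=i$ and target $t(d)=j$. A diagram $\mathcal{D}:\mathbb{I}\to\mathbb{G}$ is a graph morphism from $\mathbb{I}$ to the underlying graph of $\mathbb{G}$, written $i\mapsto\mathcal{D}_i$, $d\mapsto(\mathcal{D}_d:\mathcal{D}_{s(d)}\to\mathcal{D}_{t(d)})$ (no commutativity is imposed). A natural transformation $\tau:\mathcal{E}\Rightarrow\mathcal{D}$ of diagrams is a family $(\tau_i:\mathcal{E}_i\to\mathcal{D}_i)_{i\in\mathbb{I}_0}$ with $\tau_j\circ\mathcal{E}_d=\mathcal{D}_d\circ\tau_i$ for every edge $d:i\to j$; $\mathbb{G}^{\mathbb{I}}$ is the resulting category. $\Delta S$ is the constant diagram at $S$ (all edges sent to $id_S$). A commutative cocone is a natural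 transformation $\kappa:\mathcal{D}\Rightarrow\Delta S$; it is colimiting if it is universal. Van Kampen property: $\tau:\mathcal{E}\Rightarrow\mathcal{D}$ is cartesian if all its naturality squares (one for each edge of $\mathbb{I}$) are pullbacks. $\mathbb{G}^{\mathbb{I}}\Downarrow\mathcal{D}$ is the full subcategory of the comma (slice) category $\mathbb{G}^{\mathbb{I}}\downarrow\mathcal{D}$ on the cartesian natural transformations. With chosen pullbacks, a commutative cocone $\kappa:\mathcal{D}\Rightarrow\Delta S$ induces a functor $\kappa^\ast:\mathbb{G}\downarrow S\to\mathbb{G}^{\mathbb{I}}\Downarrow\mathcal{D}$ sending $\sigma:K\to S$ to the family $(\kappa_i^\ast(\sigma):\mathcal{E}_i\to\mathcal{D}_i)_{i\in\mathbb{I}_0}$ of pullbacks of $\sigma$ along $\kappa_i$, where $\mathcal{E}_d:\mathcal{E}_i\to\mathcal{E}_j$ is the unique arrow into the pullback $\mathcal{E}_j$ compatible with $\mathcal{D}_d\circ\kappa_i^\ast(\sigma)$ and the projection $\mathcal{E}_i\to K$; on morphisms it acts by universal arrows into pullbacks. $\kappa$ is a Van Kampen cocone (has the Van Kampen property) if $\kappa^\ast$ is an equivalence of categories. Convention: for each $X\in\mathbb{B}$ the sets $\mathcal{D}_i(X)$, $i\in\mathbb{I}_0$, are assumed pairwise disjoint. For $y\in\mathcal{D}_i(X)$ write $\mathcal{D}_d(y)$ for $(\mathcal{D}_d)_X(y)$. Mapping paths: let $\mathbb{I}_1^{op}=\{d^{op}\mid d\in\mathbb{I}_1\}$ be formal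 opposites, $(d^{op})^{op}:=d$. A path segment of sort $X$ is a triple $(y,\delta,y')$ with $\delta\in\mathbb{I}_1\cup\mathbb{I}_1^{op}$ such that: if $\delta=d\in\mathbb{I}_1$ then $y\in\mathcal{D}_{s(d)}(X)$ and $y'=\mathcal{D}_d(y)\in\mathcal{D}_{t(d)}(X)$; if $\delta=d^{op}\in\mathbb{I}_1^{op}$ then $y'\in\mathcal{D}_{s(d)}(X)$ and $y=\mathcal{D}_d(y')\in\mathcal{D}_{t(d)}(X)$. Segments are equal if all three components are equal. Two segments $(y_1,\delta_1,y_1')$, $(y_2,\delta_2,y_2')$ are weakly equal if they are equal or $(y_1,\delta_1,y_1')=(y_2',\delta_2^{op},y_2)$. A non-empty mapping path of sort $X$ in $\mathcal{D}$ is a sequence $[(y_0,\delta_0,y_1),(y_1,\delta_1,y_2),\ldots,(y_{n-1},\delta_{n-1},y_n)]$, $n\ge1$, of path segments of sort $X$; it connects $y_0$ with $y_n$. For each $y\in\mathcal{D}_i(X)$, the empty mapping path $[\,]$ of sort $X$ connects $y$ with itself. Two paths are equal if they have the same length and are segmentwise equal. A mapping path is proper if no two distinct path segments of it (i.e. segments at different positions) are weakly equal. *)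

theory Defs
  imports "HOL-Library.FuncSet" "HOL-Library.Equipollence" "Graph_Theory.Digraph"
begin

section \<open>Categories, diagrams and functors\<close>

record ('o, 'a) category =
  Obj :: "'o set"
  Arr :: "'a set"
  Dom :: "'a \<Rightarrow> 'o"
  Cod :: "'a \<Rightarrow> 'o"
  Ident :: "'o \<Rightarrow> 'a"
  Comp :: "'a \<Rightarrow> 'a \<Rightarrow> 'a"  (infixr "\<odot>\<index>" 75)

definition hom_set :: "('o, 'a) category \<Rightarrow> 'o \<Rightarrow> 'o \<Rightarrow> 'a set" where
  "hom_set C x y = {f \<in> Arr C. Dom C f = x \<and> Cod C f = y}"

locale category =
  fixes C :: "('o, 'a) category" (structure)
  assumes Dom_Obj: "f \<in> Arr C \<Longrightarrow> Dom C f \<in> Obj C"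
    and Cod_Obj: "f \<in> Arr C \<Longrightarrow> Cod C f \<in> Obj C"
    and Ident_hom: "x \<in> Obj C \<Longrightarrow> Ident C x \<in> hom_set C x x"
    and Comp_hom: "f \<in> hom_set C x y \<Longrightarrow> g \<in> hom_set C y z \<Longrightarrow> g \<odot> f \<in> hom_set C x z"
    and Comp_Ident_right: "f \<in> hom_set C x y \<Longrightarrow> f \<odot> Ident C x = f"
    and Comp_Ident_left: "f \<in> hom_set C x y \<Longrightarrow> Ident C y \<odot> f = f"
    and Comp_assoc: "f \<in> hom_set C w x \<Longrightarrow> g \<in> hom_set C x y \<Longrightarrow> h \<in> hom_set C y z \<Longrightarrow>
      (h \<odot> g) \<odot> f = h \<odot> (g \<odot> f)"

definition isomorphic_in :: "('o, 'a) category \<Rightarrow> 'o \<Rightarrow> 'o \<Rightarrow> bool" where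
  "isomorphic_in C x y \<longleftrightarrow> (\<exists>f \<in> hom_set C x y. \<exists>g \<in> hom_set C y x.
     g \<odot>\<^bsub>C\<^esub> f = Ident C x \<and> f \<odot>\<^bsub>C\<^esub> g = Ident C y)"

definition full_subcategory :: "('o, 'a) category \<Rightarrow> ('o \<Rightarrow> bool) \<Rightarrow> ('o, 'a) category" where
  "full_subcategory C P = C\<lparr>
     Obj := {x \<in> Obj C. P x},
     Arr := {f \<in> Arr C. P (Dom C f) \<and> P (Cod C f)}\<rparr>"

definition underlying_graph :: "('o, 'a) category \<Rightarrow> ('o, 'a) pre_digraph" where
  "underlying_graph C = \<lparr>verts = Obj C, arcs = Arr C, tail = Dom C, head = Cod C\<rparr>"

text \<open>
  Maps of graphs, in particular diagrams and functors, are taken to be extensional (undefined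
  outside the vertices and arcs of the source), so that HOL equality is equality of graph
  morphisms. The same normalisation is used for functions between sets and for natural
  transformations.
\<close>

record ('v, 'e, 'w, 'f) graph_map =
  on_verts :: "'v \<Rightarrow> 'w"
  on_arcs :: "'e \<Rightarrow> 'f"

definition graph_morphism ::
  "('v, 'e) pre_digraph \<Rightarrow> ('w, 'f) pre_digraph \<Rightarrow> ('v, 'e, 'w, 'f) graph_map \<Rightarrow> bool" where
  "graph_morphism I H F \<longleftrightarrow>
     on_verts F \<in> verts I \<rightarrow>\<^sub>E verts H \<and>
     on_arcs F \<in> arcs I \<rightarrow>\<^sub>E arcs H \<and>
     (\<forall>d \<in> arcs I. tail H (on_arcs F d) = on_verts F (tail I d) \<and>
                   head H (on_arcs F d) = on_verts F (head I d))"

abbreviation diagram ::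
  "('v, 'e) pre_digraph \<Rightarrow> ('o, 'a) category \<Rightarrow> ('v, 'e, 'o, 'a) graph_map \<Rightarrow> bool" where
  "diagram I G D \<equiv> graph_morphism I (underlying_graph G) D"

text \<open>Arrows of the concrete categories below: some data together with its source and target.\<close>

datatype ('o, 'x) arrow = Arrow (src: 'o) (val: 'x) (trg: 'o)

definition nat_trans ::
  "('v, 'e) pre_digraph \<Rightarrow> ('o, 'a) category \<Rightarrow> ('v, 'e, 'o, 'a) graph_map \<Rightarrow>
   ('v, 'e, 'o, 'a) graph_map \<Rightarrow> ('v \<Rightarrow> 'a) \<Rightarrow> bool" where
  "nat_trans I G E D \<tau> \<longleftrightarrow>
     \<tau> \<in> (\<Pi>\<^sub>E i \<in> verts I. hom_set G (on_verts E i) (on_verts D i)) \<and>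
     (\<forall>d \<in> arcs I. \<tau> (head I d) \<odot>\<^bsub>G\<^esub> on_arcs E d = on_arcs D d \<odot>\<^bsub>G\<^esub> \<tau> (tail I d))"

text \<open>The category \<open>G\<^sup>I\<close> of diagrams of shape \<open>I\<close> in \<open>G\<close>.\<close>

definition diagram_category ::
  "('v, 'e) pre_digraph \<Rightarrow> ('o, 'a) category \<Rightarrow>
   (('v, 'e, 'o, 'a) graph_map, (('v, 'e, 'o, 'a) graph_map, 'v \<Rightarrow> 'a) arrow) category" where
  "diagram_category I G = \<lparr>
     Obj = {D. diagram I G D},
     Arr = {Arrow E \<tau> D | E \<tau> D. diagram I G E \<and> diagram I G D \<and> nat_trans I G E D \<tau>},
     Dom = src,
     Cod = trg,
     Ident = (\<lambda>D. Arrow D (\<lambda>i \<in> verts I. Ident G (on_verts D i)) D),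
     Comp = (\<lambda>\<beta> \<alpha>. Arrow (src \<alpha>) (\<lambda>i \<in> verts I. val \<beta> i \<odot>\<^bsub>G\<^esub> val \<alpha> i) (trg \<beta>))\<rparr>"

definition is_functor ::
  "('o, 'a) category \<Rightarrow> ('p, 'b) category \<Rightarrow> ('o, 'a, 'p, 'b) graph_map \<Rightarrow> bool" where
  "is_functor C D F \<longleftrightarrow>
     graph_morphism (underlying_graph C) (underlying_graph D) F \<and>
     (\<forall>x \<in> Obj C. on_arcs F (Ident C x) = Ident D (on_verts F x)) \<and>
     (\<forall>f \<in> Arr C. \<forall>g \<in> Arr C. Cod C f = Dom C g \<longrightarrow>
        on_arcs F (g \<odot>\<^bsub>C\<^esub> f) = on_arcs F g \<odot>\<^bsub>D\<^esub> on_arcs F f)"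

text \<open>
  A natural transformation of functors is one of the underlying diagrams, so functors form a full
  subcategory of the diagrams of shape \<open>C\<close>.
\<close>

definition functor_category ::
  "('o, 'a) category \<Rightarrow> ('p, 'b) category \<Rightarrow>
   (('o, 'a, 'p, 'b) graph_map, (('o, 'a, 'p, 'b) graph_map, 'o \<Rightarrow> 'b) arrow) category" where
  "functor_category C D =
     full_subcategory (diagram_category (underlying_graph C) D) (is_functor C D)"

definition id_functor :: "('o, 'a) category \<Rightarrow> ('o, 'a, 'o, 'a) graph_map" where
  "id_functor C = \<lparr>on_verts = (\<lambda>x \<in> Obj C. x), on_arcs = (\<lambda>f \<in> Arr C. f)\<rparr>"

definition comp_functor ::
  "('o, 'a) category \<Rightarrow> ('p, 'b, 'q, 'c) graph_map \<Rightarrow> ('o, 'a, 'p, 'b) graph_map \<Rightarrow>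
   ('o, 'a, 'q, 'c) graph_map" where
  "comp_functor C G F =
     \<lparr>on_verts = compose (Obj C) (on_verts G) (on_verts F),
      on_arcs = compose (Arr C) (on_arcs G) (on_arcs F)\<rparr>"

definition equivalence_functor ::
  "('o, 'a) category \<Rightarrow> ('p, 'b) category \<Rightarrow> ('o, 'a, 'p, 'b) graph_map \<Rightarrow> bool" where
  "equivalence_functor C D F \<longleftrightarrow>
     is_functor C D F \<and>
     (\<exists>G. is_functor D C G \<and>
        isomorphic_in (functor_category C C) (id_functor C) (comp_functor C G F) \<and>
        isomorphic_in (functor_category D D) (comp_functor D F G) (id_functor D))"

text \<open>The slice category of arrows into \<open>S\<close>.\<close>

definition slice :: "('o, 'a) category \<Rightarrow> 'o \<Rightarrow> ('a, ('a, 'a) arrow) category" where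
  "slice G S = \<lparr>
     Obj = {\<sigma> \<in> Arr G. Cod G \<sigma> = S},
     Arr = {Arrow \<sigma> f \<sigma>' | \<sigma> f \<sigma>'. \<sigma> \<in> Arr G \<and> Cod G \<sigma> = S \<and> \<sigma>' \<in> Arr G \<and> Cod G \<sigma>' = S \<and>
              f \<in> hom_set G (Dom G \<sigma>) (Dom G \<sigma>') \<and> \<sigma>' \<odot>\<^bsub>G\<^esub> f = \<sigma>},
     Dom = src,
     Cod = trg,
     Ident = (\<lambda>\<sigma>. Arrow \<sigma> (Ident G (Dom G \<sigma>)) \<sigma>),
     Comp = (\<lambda>\<beta> \<alpha>. Arrow (src \<alpha>) (val \<beta> \<odot>\<^bsub>G\<^esub> val \<alpha>) (trg \<beta>))\<rparr>"


section \<open>Pullbacks, cocones and the Van Kampen property\<close>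

text \<open>The arrows \<open>p\<close>, \<open>q\<close> are the projections to the domains of \<open>f\<close> and \<open>g\<close>, respectively.\<close>

definition is_pullback :: "('o, 'a) category \<Rightarrow> 'a \<Rightarrow> 'a \<Rightarrow> 'a \<Rightarrow> 'a \<Rightarrow> bool" where
  "is_pullback G f g p q \<longleftrightarrow>
     f \<in> Arr G \<and> g \<in> Arr G \<and> Cod G f = Cod G g \<and>
     p \<in> Arr G \<and> q \<in> Arr G \<and> Dom G p = Dom G q \<and> Cod G p = Dom G f \<and> Cod G q = Dom G g \<and>
     f \<odot>\<^bsub>G\<^esub> p = g \<odot>\<^bsub>G\<^esub> q \<and>
     (\<forall>x \<in> Obj G. \<forall>h \<in> hom_set G x (Dom G f). \<forall>k \<in> hom_set G x (Dom G g).
        f \<odot>\<^bsub>G\<^esub> h = g \<odot>\<^bsub>G\<^esub> k \<longrightarrow>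
        (\<exists>!u. u \<in> hom_set G x (Dom G p) \<and> p \<odot>\<^bsub>G\<^esub> u = h \<and> q \<odot>\<^bsub>G\<^esub> u = k))"

text \<open>
  A choice of pullbacks maps \<open>f\<close> and \<open>g\<close> with common codomain to the two projections
  of a pullback of \<open>f\<close> and \<open>g\<close>.
\<close>

definition chosen_pullbacks :: "('o, 'a) category \<Rightarrow> ('a \<Rightarrow> 'a \<Rightarrow> 'a \<times> 'a) \<Rightarrow> bool" where
  "chosen_pullbacks G pb \<longleftrightarrow>
     (\<forall>f \<in> Arr G. \<forall>g \<in> Arr G. Cod G f = Cod G g \<longrightarrow>
        is_pullback G f g (fst (pb f g)) (snd (pb f g)))"

text \<open>The unique arrow, induced by \<open>h\<close> and \<open>k\<close>, into the pullback with projections \<open>p\<close>, \<open>q\<close>.\<close>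

definition into_pullback :: "('o, 'a) category \<Rightarrow> 'a \<Rightarrow> 'a \<Rightarrow> 'a \<Rightarrow> 'a \<Rightarrow> 'a" where
  "into_pullback G p q h k =
     (THE u. u \<in> hom_set G (Dom G h) (Dom G p) \<and> p \<odot>\<^bsub>G\<^esub> u = h \<and> q \<odot>\<^bsub>G\<^esub> u = k)"

definition constant_diagram ::
  "('v, 'e) pre_digraph \<Rightarrow> ('o, 'a) category \<Rightarrow> 'o \<Rightarrow> ('v, 'e, 'o, 'a) graph_map" where
  "constant_diagram I G S = \<lparr>on_verts = (\<lambda>i \<in> verts I. S), on_arcs = (\<lambda>d \<in> arcs I. Ident G S)\<rparr>"

definition cocone ::
  "('v, 'e) pre_digraph \<Rightarrow> ('o, 'a) category \<Rightarrow> ('v, 'e, 'o, 'a) graph_map \<Rightarrow> 'o \<Rightarrow>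
   ('v \<Rightarrow> 'a) \<Rightarrow> bool" where
  "cocone I G D S \<kappa> \<longleftrightarrow>
     diagram I G D \<and> S \<in> Obj G \<and> nat_trans I G D (constant_diagram I G S) \<kappa>"

definition colimiting_cocone ::
  "('v, 'e) pre_digraph \<Rightarrow> ('o, 'a) category \<Rightarrow> ('v, 'e, 'o, 'a) graph_map \<Rightarrow> 'o \<Rightarrow>
   ('v \<Rightarrow> 'a) \<Rightarrow> bool" where
  "colimiting_cocone I G D S \<kappa> \<longleftrightarrow>
     cocone I G D S \<kappa> \<and>
     (\<forall>T \<rho>. cocone I G D T \<rho> \<longrightarrow>
        (\<exists>!u. u \<in> hom_set G S T \<and> (\<forall>i \<in> verts I. u \<odot>\<^bsub>G\<^esub> \<kappa> i = \<rho> i)))"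

definition cartesian ::
  "('v, 'e) pre_digraph \<Rightarrow> ('o, 'a) category \<Rightarrow>
   (('v, 'e, 'o, 'a) graph_map, 'v \<Rightarrow> 'a) arrow \<Rightarrow> bool" where
  "cartesian I G \<tau> \<longleftrightarrow>
     (\<forall>d \<in> arcs I. is_pullback G (on_arcs (trg \<tau>) d) (val \<tau> (head I d))
                                 (val \<tau> (tail I d)) (on_arcs (src \<tau>) d))"

definition cartesian_slice ::
  "('v, 'e) pre_digraph \<Rightarrow> ('o, 'a) category \<Rightarrow> ('v, 'e, 'o, 'a) graph_map \<Rightarrow>
   ((('v, 'e, 'o, 'a) graph_map, 'v \<Rightarrow> 'a) arrow,
    ((('v, 'e, 'o, 'a) graph_map, 'v \<Rightarrow> 'a) arrow, (('v, 'e, 'o, 'a) graph_map, 'v \<Rightarrow> 'a) arrow) arrow)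
   category" where
  "cartesian_slice I G D = full_subcategory (slice (diagram_category I G) D) (cartesian I G)"

text \<open>
  The functor \<open>\<kappa>\<^sup>*\<close>. For \<open>\<sigma> : K \<rightarrow> S\<close>, the pair \<open>pb (\<kappa> i) \<sigma>\<close> consists of the
  pullback \<open>E\<^sub>i \<rightarrow> D\<^sub>i\<close> of \<open>\<sigma>\<close> along \<open>\<kappa> i\<close> and the projection \<open>E\<^sub>i \<rightarrow> K\<close>.
\<close>

definition pullback_family ::
  "('v, 'e) pre_digraph \<Rightarrow> ('o, 'a) category \<Rightarrow> ('a \<Rightarrow> 'a \<Rightarrow> 'a \<times> 'a) \<Rightarrow>
   ('v, 'e, 'o, 'a) graph_map \<Rightarrow> ('v \<Rightarrow> 'a) \<Rightarrow> 'a \<Rightarrow>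
   (('v, 'e, 'o, 'a) graph_map, 'v \<Rightarrow> 'a) arrow" where
  "pullback_family I G pb D \<kappa> \<sigma> =
     (let p = (\<lambda>i. fst (pb (\<kappa> i) \<sigma>)); q = (\<lambda>i. snd (pb (\<kappa> i) \<sigma>)) in
      Arrow
        \<lparr>on_verts = (\<lambda>i \<in> verts I. Dom G (p i)),
         on_arcs = (\<lambda>d \<in> arcs I. into_pullback G (p (head I d)) (q (head I d))
                                    (on_arcs D d \<odot>\<^bsub>G\<^esub> p (tail I d)) (q (tail I d)))\<rparr>
        (\<lambda>i \<in> verts I. p i)
        D)"

definition pullback_functor ::
  "('v, 'e) pre_digraph \<Rightarrow> ('o, 'a) category \<Rightarrow> ('a \<Rightarrow> 'a \<Rightarrow> 'a \<times> 'a) \<Rightarrow>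
   ('v, 'e, 'o, 'a) graph_map \<Rightarrow> 'o \<Rightarrow> ('v \<Rightarrow> 'a) \<Rightarrow>
   ('a, ('a, 'a) arrow, (('v, 'e, 'o, 'a) graph_map, 'v \<Rightarrow> 'a) arrow,
    ((('v, 'e, 'o, 'a) graph_map, 'v \<Rightarrow> 'a) arrow, (('v, 'e, 'o, 'a) graph_map, 'v \<Rightarrow> 'a) arrow) arrow)
   graph_map" where
  "pullback_functor I G pb D S \<kappa> =
     (let F = pullback_family I G pb D \<kappa> in
      \<lparr>on_verts = (\<lambda>\<sigma> \<in> Obj (slice G S). F \<sigma>),
       on_arcs = (\<lambda>\<phi> \<in> Arr (slice G S).
         Arrow (F (src \<phi>))
           (Arrow (src (F (src \<phi>)))
              (\<lambda>i \<in> verts I. into_pullback G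
                 (fst (pb (\<kappa> i) (trg \<phi>))) (snd (pb (\<kappa> i) (trg \<phi>)))
                 (fst (pb (\<kappa> i) (src \<phi>))) (val \<phi> \<odot>\<^bsub>G\<^esub> snd (pb (\<kappa> i) (src \<phi>))))
              (src (F (trg \<phi>))))
           (F (trg \<phi>)))\<rparr>)"

definition van_kampen_cocone ::
  "('v, 'e) pre_digraph \<Rightarrow> ('o, 'a) category \<Rightarrow> ('a \<Rightarrow> 'a \<Rightarrow> 'a \<times> 'a) \<Rightarrow>
   ('v, 'e, 'o, 'a) graph_map \<Rightarrow> 'o \<Rightarrow> ('v \<Rightarrow> 'a) \<Rightarrow> bool" where
  "van_kampen_cocone I G pb D S \<kappa> \<longleftrightarrow>
     cocone I G D S \<kappa> \<and>
     equivalence_functor (slice G S) (cartesian_slice I G D) (pullback_functor I G pb D S \<kappa>)"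


section \<open>Sets and set-valued functors\<close>

text \<open>
  HOL has no category of all sets. A universe is a collection of sets over one type \<open>'u\<close>,
  containing an infinite set and closed under passage to sets of at most the same size and under
  unions indexed by its members; its members are the sets of \<open>Set\<close>. A Grothendieck universe
  containing an infinite set is an example, with \<open>'u\<close> the type of its elements; closure under
  power sets is not demanded, so that the collection of all sets over an arbitrary infinite type
  is another one.
\<close>

definition set_universe :: "'u set set \<Rightarrow> bool" where
  "set_universe U \<longleftrightarrow>
     (\<exists>A \<in> U. infinite A) \<and>
     (\<forall>A \<in> U. \<forall>B. B \<lesssim> A \<longrightarrow> B \<in> U) \<and>
     (\<forall>A \<in> U. \<forall>F. (\<forall>a \<in> A. F a \<in> U) \<longrightarrow> (\<Union>a \<in> A. F a) \<in> U)"

lemma set_universe_UNIV: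
  assumes "infinite (UNIV :: 'u set)"
  shows "set_universe (UNIV :: 'u set set)"
  using assms unfolding set_universe_def by blast

definition small :: "'u set set \<Rightarrow> 'b set \<Rightarrow> bool" where
  "small U A \<longleftrightarrow> (\<exists>B \<in> U. A \<approx> B)"

definition set_category :: "'u set set \<Rightarrow> ('u set, ('u set, 'u \<Rightarrow> 'u) arrow) category" where
  "set_category U = \<lparr>
     Obj = U,
     Arr = {Arrow A f B | A f B. A \<in> U \<and> B \<in> U \<and> f \<in> A \<rightarrow>\<^sub>E B},
     Dom = src,
     Cod = trg,
     Ident = (\<lambda>A. Arrow A (\<lambda>x \<in> A. x) A),
     Comp = (\<lambda>g f. Arrow (src f) (compose (src f) (val g) (val f)) (trg g))\<rparr>"

type_synonym ('o, 'a, 'u) presheaf = "('o, 'a, 'u set, ('u set, 'u \<Rightarrow> 'u) arrow) graph_map"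

type_synonym ('o, 'a, 'u) presheaf_arrow =
  "(('o, 'a, 'u) presheaf, 'o \<Rightarrow> ('u set, 'u \<Rightarrow> 'u) arrow) arrow"

text \<open>The category \<open>Set\<^sup>B\<close> of covariant functors from \<open>B\<close> to \<open>Set\<close>.\<close>

abbreviation presheaves ::
  "'u set set \<Rightarrow> ('o, 'a) category \<Rightarrow> (('o, 'a, 'u) presheaf, ('o, 'a, 'u) presheaf_arrow) category" where
  "presheaves U B \<equiv> functor_category B (set_category U)"

type_synonym ('v, 'e, 'o, 'a, 'u) presheaf_diagram =
  "('v, 'e, ('o, 'a, 'u) presheaf, ('o, 'a, 'u) presheaf_arrow) graph_map"

text \<open>The set \<open>D\<^sub>i(X)\<close> and the map \<open>(D\<^sub>d)\<^sub>X\<close>.\<close>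

definition set_at :: "('v, 'e, 'o, 'a, 'u) presheaf_diagram \<Rightarrow> 'v \<Rightarrow> 'o \<Rightarrow> 'u set" where
  "set_at D i X = on_verts (on_verts D i) X"

definition map_at :: "('v, 'e, 'o, 'a, 'u) presheaf_diagram \<Rightarrow> 'e \<Rightarrow> 'o \<Rightarrow> 'u \<Rightarrow> 'u" where
  "map_at D d X = val (val (on_arcs D d) X)"


section \<open>Mapping paths\<close>

datatype 'e dir_arc = Fwd 'e | Opp 'e

fun opposite :: "'e dir_arc \<Rightarrow> 'e dir_arc" where
  "opposite (Fwd d) = Opp d"
| "opposite (Opp d) = Fwd d"

type_synonym ('e, 'u) segment = "'u \<times> 'e dir_arc \<times> 'u"

fun path_segment ::
  "('v, 'e) pre_digraph \<Rightarrow> ('v, 'e, 'o, 'a, 'u) presheaf_diagram \<Rightarrow> 'o \<Rightarrow> ('e, 'u) segment \<Rightarrow> bool"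
where
  "path_segment I D X (y, Fwd d, y') \<longleftrightarrow>
     d \<in> arcs I \<and> y \<in> set_at D (tail I d) X \<and> y' \<in> set_at D (head I d) X \<and> y' = map_at D d X y"
| "path_segment I D X (y, Opp d, y') \<longleftrightarrow>
     d \<in> arcs I \<and> y' \<in> set_at D (tail I d) X \<and> y \<in> set_at D (head I d) X \<and> y = map_at D d X y'"

fun weakly_equal :: "('e, 'u) segment \<Rightarrow> ('e, 'u) segment \<Rightarrow> bool" where
  "weakly_equal (y1, \<delta>1, y1') (y2, \<delta>2, y2') \<longleftrightarrow>
     (y1, \<delta>1, y1') = (y2, \<delta>2, y2') \<or> (y1, \<delta>1, y1') = (y2', opposite \<delta>2, y2)"

text \<open>
  \<open>mapping_path I D X z p z'\<close>: the list \<open>p\<close> is a mapping path of sort \<open>X\<close> connecting \<open>z\<close> with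
  \<open>z'\<close>.
\<close>

inductive mapping_path ::
  "('v, 'e) pre_digraph \<Rightarrow> ('v, 'e, 'o, 'a, 'u) presheaf_diagram \<Rightarrow> 'o \<Rightarrow>
   'u \<Rightarrow> ('e, 'u) segment list \<Rightarrow> 'u \<Rightarrow> bool"
  for I D X where
  empty: "i \<in> verts I \<Longrightarrow> y \<in> set_at D i X \<Longrightarrow> mapping_path I D X y [] y"
| step: "path_segment I D X (y, \<delta>, y') \<Longrightarrow> mapping_path I D X y' p y'' \<Longrightarrow>
    mapping_path I D X y ((y, \<delta>, y') # p) y''"

definition proper_path :: "('e, 'u) segment list \<Rightarrow> bool" where
  "proper_path p \<longleftrightarrow>
     (\<forall>m < length p. \<forall>n < length p. m \<noteq> n \<longrightarrow> \<not> weakly_equal (p ! m) (p ! n))"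

end

theory Submission
  imports Defs "HOL-Algebra.Free_Abelian_Groups"
begin

text \<open>
  For each object \<open>X\<close> of \<open>B\<close>, the elements of the sets \<open>D\<^sub>i(X)\<close> are the vertices of a multigraph
  with an edge from \<open>y\<close> to \<open>D\<^sub>d(y)\<close> for every arc \<open>d\<close>. Mapping paths are the walks in this graph,
  proper ones the walks that use no edge twice, and the set \<open>S(X)\<close> is the set of its connected
  components (\<open>colimiting_imp_elementwise\<close>). The path condition of the theorem says that these
  graphs are forests. A cartesian transformation from \<open>E\<close> to \<open>D\<close> is a covering of the graphs: as
  pullbacks are computed elementwise (\<open>is_pullback_PSh_iff\<close>), each edge of \<open>D\<close> induces a bijection
  between the fibres over its ends. The transformations in the image of the pullback functor are
  those without monodromy, that is, those in which transport around a closed walk is the identity.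

  Colimits of presheaves are stable under pullback (\<open>elementwise_colimit_stable\<close>), and stability
  makes the pullback functor fully faithful (\<open>pullback_fully_faithful\<close>). Hence the cocone is Van
  Kampen exactly if the functor is essentially surjective, that is, if no covering has monodromy.

  Over a forest a closed walk can be contracted by removing repeated edges, so monodromy is
  trivial (\<open>lift_over_forest\<close>); then \<open>E\<close> is the pullback of its own colimit
  (\<open>cartesian_over_forest\<close>). For the converse one needs a single covering that detects every cycle
  at every \<open>X\<close> and is natural in \<open>X\<close>. In the twisted covering (\<open>twisted_covering_exists\<close>) the fibres
  are the groups of integral chains on the edges, and an arc adds the edge that it traverses.
  Transport along a path adds its chain, so under the Van Kampen property two paths with the same
  ends have the same chain (\<open>van_kampen_path_chain\<close>). A nonempty path without repeated edges has a
  nonzero chain, so it is not closed, and this forces proper paths to be unique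
  (\<open>proper_path_unique\<close>).
\<close>

section \<open>Categories of diagrams, functors and slices\<close>

lemma hom_set_iff: "f \<in> hom_set C x y \<longleftrightarrow> f \<in> Arr C \<and> Dom C f = x \<and> Cod C f = y"
  by (simp add: hom_set_def)

lemma hom_set_full_subcategory:
  "hom_set (full_subcategory C P) x y = (if P x \<and> P y then hom_set C x y else {})"
  by (auto simp: hom_set_def full_subcategory_def)

lemma full_subcategory_simps [simp]:
  "Obj (full_subcategory C P) = {x \<in> Obj C. P x}"
  "Arr (full_subcategory C P) = {f \<in> Arr C. P (Dom C f) \<and> P (Cod C f)}"
  "Dom (full_subcategory C P) = Dom C"
  "Cod (full_subcategory C P) = Cod C"
  "Ident (full_subcategory C P) = Ident C"
  "Comp (full_subcategory C P) = Comp C"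
  by (simp_all add: full_subcategory_def)

lemma category_full_subcategory:
  assumes "category C" shows "category (full_subcategory C P)"
proof -
  interpret category C by fact
  show ?thesis
    by unfold_locales
      (auto simp: hom_set_full_subcategory Dom_Obj Cod_Obj intro: Ident_hom Comp_hom
        Comp_Ident_right Comp_Ident_left Comp_assoc split: if_splits)
qed

lemma underlying_graph_simps [simp]:
  "verts (underlying_graph C) = Obj C"
  "arcs (underlying_graph C) = Arr C"
  "tail (underlying_graph C) = Dom C"
  "head (underlying_graph C) = Cod C"
  by (simp_all add: underlying_graph_def)

lemma (in category) wf_digraph_underlying_graph: "wf_digraph (underlying_graph C)"
  by unfold_locales (auto intro: Dom_Obj Cod_Obj)

lemma (in category) hom_set_Obj:
  assumes "f \<in> hom_set C x y" shows "x \<in> Obj C" "y \<in> Obj C"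
  using assms Dom_Obj Cod_Obj by (auto simp: hom_set_iff)

lemma diagram_category_simps [simp]:
  "Obj (diagram_category I G) = {D. diagram I G D}"
  "Dom (diagram_category I G) = src"
  "Cod (diagram_category I G) = trg"
  "Ident (diagram_category I G) = (\<lambda>D. Arrow D (\<lambda>i \<in> verts I. Ident G (on_verts D i)) D)"
  "Comp (diagram_category I G) =
     (\<lambda>\<beta> \<alpha>. Arrow (src \<alpha>) (\<lambda>i \<in> verts I. val \<beta> i \<odot>\<^bsub>G\<^esub> val \<alpha> i) (trg \<beta>))"
  by (simp_all add: diagram_category_def)

lemma hom_set_diagram_category:
  "\<alpha> \<in> hom_set (diagram_category I G) E D \<longleftrightarrow>
     (\<exists>\<tau>. \<alpha> = Arrow E \<tau> D \<and> diagram I G E \<and> diagram I G D \<and> nat_trans I G E D \<tau>)"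
  by (auto simp: hom_set_def diagram_category_def)

lemma diagram_vert: "diagram I G D \<Longrightarrow> i \<in> verts I \<Longrightarrow> on_verts D i \<in> Obj G"
  by (auto simp: graph_morphism_def)

lemma diagram_arc:
  "diagram I G D \<Longrightarrow> d \<in> arcs I \<Longrightarrow>
   on_arcs D d \<in> hom_set G (on_verts D (tail I d)) (on_verts D (head I d))"
  by (auto simp: graph_morphism_def hom_set_iff)

lemma nat_trans_hom:
  "nat_trans I G E D \<tau> \<Longrightarrow> i \<in> verts I \<Longrightarrow> \<tau> i \<in> hom_set G (on_verts E i) (on_verts D i)"
  by (auto simp: nat_trans_def)

lemma nat_trans_natural:
  "nat_trans I G E D \<tau> \<Longrightarrow> d \<in> arcs I \<Longrightarrow>
   \<tau> (head I d) \<odot>\<^bsub>G\<^esub> on_arcs E d = on_arcs D d \<odot>\<^bsub>G\<^esub> \<tau> (tail I d)"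
  by (auto simp: nat_trans_def)

lemma nat_transI:
  assumes "\<tau> \<in> extensional (verts I)"
    and "\<And>i. i \<in> verts I \<Longrightarrow> \<tau> i \<in> hom_set G (on_verts E i) (on_verts D i)"
    and "\<And>d. d \<in> arcs I \<Longrightarrow>
      \<tau> (head I d) \<odot>\<^bsub>G\<^esub> on_arcs E d = on_arcs D d \<odot>\<^bsub>G\<^esub> \<tau> (tail I d)"
  shows "nat_trans I G E D \<tau>"
  using assms by (auto simp: nat_trans_def PiE_def)

lemma nat_trans_ext:
  assumes "nat_trans I G E D \<tau>" "nat_trans I G E' D' \<tau>'"
    and "\<And>i. i \<in> verts I \<Longrightarrow> \<tau> i = \<tau>' i"
  shows "\<tau> = \<tau>'"
  using assms by (auto simp: nat_trans_def intro: PiE_ext)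

lemma nat_trans_Ident:
  assumes "category G" "wf_digraph I" "diagram I G D"
  shows "nat_trans I G D D (\<lambda>i \<in> verts I. Ident G (on_verts D i))"
proof -
  interpret category G by fact
  interpret wf_digraph I by fact
  show ?thesis
  proof (rule nat_transI)
    fix d assume d: "d \<in> arcs I"
    show "(\<lambda>i\<in>verts I. Ident G (on_verts D i)) (head I d) \<odot>\<^bsub>G\<^esub> on_arcs D d =
         on_arcs D d \<odot>\<^bsub>G\<^esub> (\<lambda>i\<in>verts I. Ident G (on_verts D i)) (tail I d)"
      using Comp_Ident_left[OF diagram_arc[OF assms(3) d]]
        Comp_Ident_right[OF diagram_arc[OF assms(3) d]] d by simp
  qed (auto intro: Ident_hom diagram_vert[OF assms(3)])
qed

lemma nat_trans_Comp:
  assumes "category G" "wf_digraph I" "diagram I G E" "diagram I G D" "diagram I G D'"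
    and "nat_trans I G E D \<tau>" "nat_trans I G D D' \<rho>"
  shows "nat_trans I G E D' (\<lambda>i \<in> verts I. \<rho> i \<odot>\<^bsub>G\<^esub> \<tau> i)"
proof -
  interpret category G by fact
  interpret wf_digraph I by fact
  show ?thesis
  proof (rule nat_transI)
    fix d assume d: "d \<in> arcs I"
    let ?s = "tail I d" and ?t = "head I d"
    have v: "?s \<in> verts I" "?t \<in> verts I" using d by auto
    note h = nat_trans_hom[OF assms(6) v(1)] nat_trans_hom[OF assms(6) v(2)]
      nat_trans_hom[OF assms(7) v(1)] nat_trans_hom[OF assms(7) v(2)]
      diagram_arc[OF assms(3) d] diagram_arc[OF assms(4) d] diagram_arc[OF assms(5) d]
    have "(\<rho> ?t \<odot>\<^bsub>G\<^esub> \<tau> ?t) \<odot>\<^bsub>G\<^esub> on_arcs E d = \<rho> ?t \<odot>\<^bsub>G\<^esub> (on_arcs D d \<odot>\<^bsub>G\<^esub> \<tau> ?s)"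
      using Comp_assoc[OF h(5) h(2) h(4)] nat_trans_natural[OF assms(6) d] by simp
    also have "\<dots> = on_arcs D' d \<odot>\<^bsub>G\<^esub> (\<rho> ?s \<odot>\<^bsub>G\<^esub> \<tau> ?s)"
      using Comp_assoc[OF h(1) h(6) h(4)] Comp_assoc[OF h(1) h(3) h(7)]
        nat_trans_natural[OF assms(7) d] by simp
    finally show "(\<lambda>i\<in>verts I. \<rho> i \<odot>\<^bsub>G\<^esub> \<tau> i) ?t \<odot>\<^bsub>G\<^esub> on_arcs E d =
         on_arcs D' d \<odot>\<^bsub>G\<^esub> (\<lambda>i\<in>verts I. \<rho> i \<odot>\<^bsub>G\<^esub> \<tau> i) ?s"
      using v by simp
  qed (auto intro: Comp_hom nat_trans_hom[OF assms(6)] nat_trans_hom[OF assms(7)])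
qed

lemma category_diagram_category:
  assumes "category G" "wf_digraph I"
  shows "category (diagram_category I G)"
proof -
  interpret category G by fact
  show ?thesis
  proof
    fix f assume "f \<in> Arr (diagram_category I G)"
    then show "Dom (diagram_category I G) f \<in> Obj (diagram_category I G)"
      and "Cod (diagram_category I G) f \<in> Obj (diagram_category I G)"
      by (auto simp: diagram_category_def)
  next
    fix x assume "x \<in> Obj (diagram_category I G)"
    then show "Ident (diagram_category I G) x \<in> hom_set (diagram_category I G) x x"
      using nat_trans_Ident[OF assms] by (auto simp: hom_set_diagram_category)
  next
    fix f x y g z
    assume "f \<in> hom_set (diagram_category I G) x y" "g \<in> hom_set (diagram_category I G) y z"
    then show "g \<odot>\<^bsub>diagram_category I G\<^esub> f \<in> hom_set (diagram_category I G) x z"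
      using nat_trans_Comp[OF assms] by (auto simp: hom_set_diagram_category)
  next
    fix f x y
    assume "f \<in> hom_set (diagram_category I G) x y"
    then obtain \<tau> where f: "f = Arrow x \<tau> y" and \<tau>: "nat_trans I G x y \<tau>"
      and d: "diagram I G x" "diagram I G y"
      by (auto simp: hom_set_diagram_category)
    have "(\<lambda>i\<in>verts I. \<tau> i \<odot>\<^bsub>G\<^esub> (\<lambda>i\<in>verts I. Ident G (on_verts x i)) i) = \<tau>"
      using \<tau> Comp_Ident_right[OF nat_trans_hom[OF \<tau>]]
      by (intro nat_trans_ext[OF nat_trans_Comp[OF assms d(1) d(1) d(2) nat_trans_Ident[OF assms d(1)] \<tau>] \<tau>])
        simp
    then show "f \<odot>\<^bsub>diagram_category I G\<^esub> Ident (diagram_category I G) x = f"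
      by (simp add: f)
    have "(\<lambda>i\<in>verts I. (\<lambda>i\<in>verts I. Ident G (on_verts y i)) i \<odot>\<^bsub>G\<^esub> \<tau> i) = \<tau>"
      using \<tau> Comp_Ident_left[OF nat_trans_hom[OF \<tau>]]
      by (intro nat_trans_ext[OF nat_trans_Comp[OF assms d(1) d(2) d(2) \<tau> nat_trans_Ident[OF assms d(2)]] \<tau>])
        simp
    then show "Ident (diagram_category I G) y \<odot>\<^bsub>diagram_category I G\<^esub> f = f"
      by (simp add: f)
  next
    fix f w x g y h z
    assume a: "f \<in> hom_set (diagram_category I G) w x" "g \<in> hom_set (diagram_category I G) x y"
      "h \<in> hom_set (diagram_category I G) y z"
    obtain \<tau> \<rho> \<pi> where *: "f = Arrow w \<tau> x" "g = Arrow x \<rho> y" "h = Arrow y \<pi> z"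
      and n: "nat_trans I G w x \<tau>" "nat_trans I G x y \<rho>" "nat_trans I G y z \<pi>"
      using a by (auto simp: hom_set_diagram_category)
    show "(h \<odot>\<^bsub>diagram_category I G\<^esub> g) \<odot>\<^bsub>diagram_category I G\<^esub> f =
       h \<odot>\<^bsub>diagram_category I G\<^esub> g \<odot>\<^bsub>diagram_category I G\<^esub> f"
      using Comp_assoc[OF nat_trans_hom[OF n(1)] nat_trans_hom[OF n(2)] nat_trans_hom[OF n(3)]]
      by (auto simp: * intro!: restrict_ext)
  qed
qed

text \<open>
  Componentwise inverses of a natural transformation are again natural, since they conjugate each
  naturality square into the opposite one.
\<close>

lemma nat_trans_inverse:
  assumes "category G" "wf_digraph I" and D: "diagram I G D" "diagram I G E"
    and \<tau>: "nat_trans I G E D \<tau>" and "\<rho> \<in> extensional (verts I)"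
    and \<rho>: "\<And>i. i \<in> verts I \<Longrightarrow> \<rho> i \<in> hom_set G (on_verts D i) (on_verts E i)"
    and inv: "\<And>i. i \<in> verts I \<Longrightarrow> \<rho> i \<odot>\<^bsub>G\<^esub> \<tau> i = Ident G (on_verts E i)"
      "\<And>i. i \<in> verts I \<Longrightarrow> \<tau> i \<odot>\<^bsub>G\<^esub> \<rho> i = Ident G (on_verts D i)"
  shows "nat_trans I G D E \<rho>"
proof (rule nat_transI)
  interpret category G by fact
  interpret wf_digraph I by fact
  fix d assume d: "d \<in> arcs I"
  let ?s = "tail I d" and ?t = "head I d"
  have v: "?s \<in> verts I" "?t \<in> verts I" using d by auto
  note h = diagram_arc[OF D(2) d] diagram_arc[OF D(1) d]
  note t = nat_trans_hom[OF \<tau> v(1)] nat_trans_hom[OF \<tau> v(2)] and r = \<rho>[OF v(1)] \<rho>[OF v(2)]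
  have "\<rho> ?t \<odot>\<^bsub>G\<^esub> on_arcs D d = \<rho> ?t \<odot>\<^bsub>G\<^esub> (on_arcs D d \<odot>\<^bsub>G\<^esub> (\<tau> ?s \<odot>\<^bsub>G\<^esub> \<rho> ?s))"
    using inv(2)[OF v(1)] Comp_Ident_right[OF h(2)] by simp
  also have "\<dots> = \<rho> ?t \<odot>\<^bsub>G\<^esub> ((\<tau> ?t \<odot>\<^bsub>G\<^esub> on_arcs E d) \<odot>\<^bsub>G\<^esub> \<rho> ?s)"
    using Comp_assoc[OF r(1) t(1) h(2)] nat_trans_natural[OF \<tau> d] by simp
  also have "\<dots> = (\<rho> ?t \<odot>\<^bsub>G\<^esub> \<tau> ?t) \<odot>\<^bsub>G\<^esub> (on_arcs E d \<odot>\<^bsub>G\<^esub> \<rho> ?s)"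
    using Comp_assoc[OF r(1) h(1) t(2)] Comp_assoc[OF Comp_hom[OF r(1) h(1)] t(2) r(2)] by simp
  also have "\<dots> = on_arcs E d \<odot>\<^bsub>G\<^esub> \<rho> ?s"
    using inv(1)[OF v(2)] Comp_Ident_left[OF Comp_hom[OF r(1) h(1)]] by simp
  finally show "\<rho> ?t \<odot>\<^bsub>G\<^esub> on_arcs D d = on_arcs E d \<odot>\<^bsub>G\<^esub> \<rho> ?s" .
qed (use assms in auto)

lemma slice_simps [simp]:
  "Obj (slice G S) = {\<sigma> \<in> Arr G. Cod G \<sigma> = S}"
  "Dom (slice G S) = src"
  "Cod (slice G S) = trg"
  "Ident (slice G S) = (\<lambda>\<sigma>. Arrow \<sigma> (Ident G (Dom G \<sigma>)) \<sigma>)"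
  "Comp (slice G S) = (\<lambda>\<beta> \<alpha>. Arrow (src \<alpha>) (val \<beta> \<odot>\<^bsub>G\<^esub> val \<alpha>) (trg \<beta>))"
  by (simp_all add: slice_def)

lemma hom_set_slice:
  "\<phi> \<in> hom_set (slice G S) \<sigma> \<sigma>' \<longleftrightarrow>
     (\<exists>f. \<phi> = Arrow \<sigma> f \<sigma>' \<and> \<sigma> \<in> Arr G \<and> Cod G \<sigma> = S \<and> \<sigma>' \<in> Arr G \<and> Cod G \<sigma>' = S \<and>
       f \<in> hom_set G (Dom G \<sigma>) (Dom G \<sigma>') \<and> \<sigma>' \<odot>\<^bsub>G\<^esub> f = \<sigma>)"
  by (auto simp: hom_set_def slice_def)

lemma category_slice:
  assumes "category G"
  shows "category (slice G S)"
proof -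
  interpret category G by fact
  show ?thesis
  proof
    fix f assume "f \<in> Arr (slice G S)"
    then show "Dom (slice G S) f \<in> Obj (slice G S)" and "Cod (slice G S) f \<in> Obj (slice G S)"
      by (auto simp: slice_def)
  next
    fix x assume "x \<in> Obj (slice G S)"
    then show "Ident (slice G S) x \<in> hom_set (slice G S) x x"
      using Ident_hom[OF Dom_Obj] Comp_Ident_right
      by (auto simp: hom_set_slice hom_set_iff[of x])
  next
    fix f x y g z
    assume a: "f \<in> hom_set (slice G S) x y" "g \<in> hom_set (slice G S) y z"
    then obtain f' g' where *: "f = Arrow x f' y" "g = Arrow y g' z"
      and x: "x \<in> Arr G" "Cod G x = S" "y \<in> Arr G" "Cod G y = S" "z \<in> Arr G" "Cod G z = S"
      and h: "f' \<in> hom_set G (Dom G x) (Dom G y)" "g' \<in> hom_set G (Dom G y) (Dom G z)"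
      and e: "y \<odot>\<^bsub>G\<^esub> f' = x" "z \<odot>\<^bsub>G\<^esub> g' = y"
      by (auto simp: hom_set_slice)
    have "z \<in> hom_set G (Dom G z) S" using x by (simp add: hom_set_iff)
    then have "z \<odot>\<^bsub>G\<^esub> (g' \<odot>\<^bsub>G\<^esub> f') = x"
      using Comp_assoc[OF h] e by metis
    then show "g \<odot>\<^bsub>slice G S\<^esub> f \<in> hom_set (slice G S) x z"
      using x Comp_hom[OF h] by (auto simp: hom_set_slice *)
  qed (auto simp: hom_set_slice intro: Comp_Ident_left Comp_Ident_right Comp_assoc)
qed

lemma functor_category_simps [simp]:
  "Obj (functor_category C D) = {F. is_functor C D F}"
  "Dom (functor_category C D) = src"
  "Cod (functor_category C D) = trg"
  "Ident (functor_category C D) = (\<lambda>F. Arrow F (\<lambda>i \<in> Obj C. Ident D (on_verts F i)) F)"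
  by (auto simp add: functor_category_def is_functor_def)

lemma functor_category_Comp:
  "Comp (functor_category C D) =
     (\<lambda>\<beta> \<alpha>. Arrow (src \<alpha>) (\<lambda>i \<in> Obj C. val \<beta> i \<odot>\<^bsub>D\<^esub> val \<alpha> i) (trg \<beta>))"
  by (simp add: functor_category_def)

lemma hom_set_functor_category:
  "\<alpha> \<in> hom_set (functor_category C D) F F' \<longleftrightarrow>
     (\<exists>\<tau>. \<alpha> = Arrow F \<tau> F' \<and> is_functor C D F \<and> is_functor C D F' \<and>
       nat_trans (underlying_graph C) D F F' \<tau>)"
  by (auto simp: functor_category_def hom_set_full_subcategory hom_set_diagram_category
      is_functor_def)

lemma category_functor_category:
  assumes "category C" "category D"
  shows "category (functor_category C D)"
  unfolding functor_category_def
  using category.wf_digraph_underlying_graph assms category_diagram_category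
    category_full_subcategory by blast

lemma category_cartesian_slice:
  assumes "category G" "wf_digraph I"
  shows "category (cartesian_slice I G D)"
  unfolding cartesian_slice_def
  by (intro category_full_subcategory category_slice category_diagram_category assms)

lemma is_functor_Obj: "is_functor C D F \<Longrightarrow> x \<in> Obj C \<Longrightarrow> on_verts F x \<in> Obj D"
  by (auto simp: is_functor_def graph_morphism_def)

lemma is_functor_hom:
  "is_functor C D F \<Longrightarrow> f \<in> hom_set C x y \<Longrightarrow>
   on_arcs F f \<in> hom_set D (on_verts F x) (on_verts F y)"
  by (auto simp: is_functor_def graph_morphism_def hom_set_iff)

lemma is_functor_Ident:
  "is_functor C D F \<Longrightarrow> x \<in> Obj C \<Longrightarrow> on_arcs F (Ident C x) = Ident D (on_verts F x)"
  by (simp add: is_functor_def)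

lemma is_functor_Comp:
  "is_functor C D F \<Longrightarrow> f \<in> hom_set C x y \<Longrightarrow> g \<in> hom_set C y z \<Longrightarrow>
   on_arcs F (g \<odot>\<^bsub>C\<^esub> f) = on_arcs F g \<odot>\<^bsub>D\<^esub> on_arcs F f"
  by (simp add: is_functor_def hom_set_iff)

lemma is_functorI:
  assumes "on_verts F \<in> extensional (Obj C)" "on_arcs F \<in> extensional (Arr C)"
    and "\<And>x. x \<in> Obj C \<Longrightarrow> on_verts F x \<in> Obj D"
    and "\<And>f x y. f \<in> hom_set C x y \<Longrightarrow> on_arcs F f \<in> hom_set D (on_verts F x) (on_verts F y)"
    and "\<And>x. x \<in> Obj C \<Longrightarrow> on_arcs F (Ident C x) = Ident D (on_verts F x)"
    and "\<And>f g x y z. f \<in> hom_set C x y \<Longrightarrow> g \<in> hom_set C y z \<Longrightarrow>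
      on_arcs F (g \<odot>\<^bsub>C\<^esub> f) = on_arcs F g \<odot>\<^bsub>D\<^esub> on_arcs F f"
  shows "is_functor C D F"
  using assms by (auto simp: is_functor_def graph_morphism_def hom_set_iff PiE_def)

lemma is_functor_id: "category C \<Longrightarrow> is_functor C C (id_functor C)"
proof (rule is_functorI, goal_cases)
  case (5 x)
  then show ?case using category.Ident_hom[OF 5] by (auto simp: id_functor_def hom_set_iff)
next
  case (6 f g x y z)
  then show ?case using category.Comp_hom[OF 6] by (auto simp: id_functor_def hom_set_iff)
next
  case (4 f x y)
  then show ?case using category.hom_set_Obj[OF 4] by (auto simp: id_functor_def hom_set_iff)
qed (auto simp: id_functor_def)

lemma is_functor_comp:
  assumes "category C" "is_functor C D F" "is_functor D E G"
  shows "is_functor C E (comp_functor C G F)"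
proof -
  interpret category C by fact
  have *: "on_arcs (comp_functor C G F) f = on_arcs G (on_arcs F f)" if "f \<in> hom_set C x y" for f x y
    using that by (simp add: comp_functor_def compose_def hom_set_iff)
  have **: "on_verts (comp_functor C G F) x = on_verts G (on_verts F x)" if "x \<in> Obj C" for x
    using that by (simp add: comp_functor_def compose_def)
  show ?thesis
  proof (rule is_functorI)
    fix f x y assume f: "f \<in> hom_set C x y"
    then show "on_arcs (comp_functor C G F) f
      \<in> hom_set E (on_verts (comp_functor C G F) x) (on_verts (comp_functor C G F) y)"
      using assms hom_set_Obj[OF f] by (simp add: * ** is_functor_hom)
  next
    fix x assume x: "x \<in> Obj C"
    then show "on_arcs (comp_functor C G F) (Ident C x) = Ident E (on_verts (comp_functor C G F) x)"
      using assms by (simp add: *[OF Ident_hom] ** is_functor_Ident is_functor_Obj)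
  next
    fix f g x y z assume f: "f \<in> hom_set C x y" and g: "g \<in> hom_set C y z"
    then show "on_arcs (comp_functor C G F) (g \<odot>\<^bsub>C\<^esub> f) =
      on_arcs (comp_functor C G F) g \<odot>\<^bsub>E\<^esub> on_arcs (comp_functor C G F) f"
      using is_functor_Comp[OF assms(2) f g]
        is_functor_Comp[OF assms(3) is_functor_hom[OF assms(2) f] is_functor_hom[OF assms(2) g]]
      by (simp add: *[OF Comp_hom[OF f g]] *[OF f] *[OF g])
  qed (use assms in \<open>auto simp: comp_functor_def compose_def is_functor_Obj\<close>)
qed

lemma isomorphic_in_functor_categoryI:
  assumes "category D" "is_functor C D F" "is_functor C D F'"
    and "\<And>x. x \<in> Obj C \<Longrightarrow> \<tau> x \<in> hom_set D (on_verts F x) (on_verts F' x)"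
    and "\<And>x. x \<in> Obj C \<Longrightarrow> \<rho> x \<in> hom_set D (on_verts F' x) (on_verts F x)"
    and "\<And>x. x \<in> Obj C \<Longrightarrow> \<rho> x \<odot>\<^bsub>D\<^esub> \<tau> x = Ident D (on_verts F x)"
    and "\<And>x. x \<in> Obj C \<Longrightarrow> \<tau> x \<odot>\<^bsub>D\<^esub> \<rho> x = Ident D (on_verts F' x)"
    and nat: "\<And>f x y. f \<in> hom_set C x y \<Longrightarrow> x \<in> Obj C \<Longrightarrow> y \<in> Obj C \<Longrightarrow>
      \<tau> y \<odot>\<^bsub>D\<^esub> on_arcs F f = on_arcs F' f \<odot>\<^bsub>D\<^esub> \<tau> x"
    and "category C"
  shows "isomorphic_in (functor_category C D) F F'"
proof -
  have nt: "nat_trans (underlying_graph C) D F F' (restrict \<tau> (Obj C))"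
    using assms(4) nat category.Dom_Obj[OF assms(9)] category.Cod_Obj[OF assms(9)]
    by (intro nat_transI) (auto simp: hom_set_iff)
  have "nat_trans (underlying_graph C) D F' F (restrict \<rho> (Obj C))"
    using assms(2,3,5-7)
    by (intro nat_trans_inverse[OF assms(1) category.wf_digraph_underlying_graph[OF assms(9)] _ _ nt])
      (auto simp: is_functor_def)
  then show ?thesis
    unfolding isomorphic_in_def
    using nt assms(2,3,6,7)
    by (intro bexI[of _ "Arrow F (restrict \<tau> (Obj C)) F'"]
        bexI[of _ "Arrow F' (restrict \<rho> (Obj C)) F"])
      (auto simp: hom_set_functor_category functor_category_Comp intro: restrict_ext)
qed

section \<open>Equivalences of categories\<close>

lemma equivalence_functor_essentially_surjective:
  assumes "equivalence_functor C D F" "category D" "y \<in> Obj D"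
  shows "\<exists>x \<in> Obj C. isomorphic_in D (on_verts F x) y"
proof -
  obtain G where G: "is_functor D C G"
    and iso: "isomorphic_in (functor_category D D) (comp_functor D F G) (id_functor D)"
    using assms(1) by (auto simp: equivalence_functor_def)
  obtain \<tau> \<rho> where nt: "nat_trans (underlying_graph D) D (comp_functor D F G) (id_functor D) \<tau>"
      "nat_trans (underlying_graph D) D (id_functor D) (comp_functor D F G) \<rho>"
    and eq: "(\<lambda>i \<in> Obj D. \<rho> i \<odot>\<^bsub>D\<^esub> \<tau> i) = (\<lambda>i \<in> Obj D. Ident D (on_verts (comp_functor D F G) i))"
      "(\<lambda>i \<in> Obj D. \<tau> i \<odot>\<^bsub>D\<^esub> \<rho> i) = (\<lambda>i \<in> Obj D. Ident D (on_verts (id_functor D) i))"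
    using iso by (auto simp: isomorphic_in_def hom_set_functor_category functor_category_Comp)
  have [simp]: "on_verts (comp_functor D F G) y = on_verts F (on_verts G y)"
      "on_verts (id_functor D) y = y"
    using assms(3) by (auto simp: comp_functor_def compose_def id_functor_def)
  have "isomorphic_in D (on_verts F (on_verts G y)) y"
    unfolding isomorphic_in_def
    using nat_trans_hom[OF nt(1), of y] nat_trans_hom[OF nt(2), of y] assms(3)
      fun_cong[OF eq(1), of y] fun_cong[OF eq(2), of y]
    by (intro bexI[of _ "\<tau> y"] bexI[of _ "\<rho> y"]) auto
  then show ?thesis
    using is_functor_Obj[OF G assms(3)] by blast
qed

text \<open>
  The quasi-inverse picks for \<open>y\<close> an object \<open>g y\<close> together with an isomorphism \<open>\<epsilon> y\<close> from its image
  to \<open>y\<close>. Arrows are conjugated with these isomorphisms and then lifted along the fully faithful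
  functor; equations between lifted arrows are checked on their images. The second natural
  isomorphism \<open>\<eta>\<close> is the lift of the inverse of \<open>\<epsilon>\<close>.
\<close>

lemma equivalence_functorI:
  assumes "category C" "category D" "is_functor C D F"
    and ff: "\<And>x y. x \<in> Obj C \<Longrightarrow> y \<in> Obj C \<Longrightarrow>
      bij_betw (on_arcs F) (hom_set C x y) (hom_set D (on_verts F x) (on_verts F y))"
    and es: "\<And>y. y \<in> Obj D \<Longrightarrow> \<exists>x \<in> Obj C. isomorphic_in D (on_verts F x) y"
  shows "equivalence_functor C D F"
proof -
  interpret C: category C by fact
  interpret D: category D by fact
  obtain g \<epsilon> \<epsilon>' where g: "\<And>y. y \<in> Obj D \<Longrightarrow> g y \<in> Obj C"
    and e: "\<And>y. y \<in> Obj D \<Longrightarrow> \<epsilon> y \<in> hom_set D (on_verts F (g y)) y"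
      "\<And>y. y \<in> Obj D \<Longrightarrow> \<epsilon>' y \<in> hom_set D y (on_verts F (g y))"
      "\<And>y. y \<in> Obj D \<Longrightarrow> \<epsilon>' y \<odot>\<^bsub>D\<^esub> \<epsilon> y = Ident D (on_verts F (g y))"
      "\<And>y. y \<in> Obj D \<Longrightarrow> \<epsilon> y \<odot>\<^bsub>D\<^esub> \<epsilon>' y = Ident D y"
    using es unfolding isomorphic_in_def by metis
  define lift where "lift x y h = the_inv_into (hom_set C x y) (on_arcs F) h" for x y h
  have lift: "lift x y h \<in> hom_set C x y" "on_arcs F (lift x y h) = h"
    if "x \<in> Obj C" "y \<in> Obj C" "h \<in> hom_set D (on_verts F x) (on_verts F y)" for x y h
    using ff[OF that(1,2)] that(3) unfolding lift_def bij_betw_def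
    by (auto intro: the_inv_into_into f_the_inv_into_f)
  have eq: "h = h'" if "h \<in> hom_set C x y" "h' \<in> hom_set C x y" "on_arcs F h = on_arcs F h'" for x y h h'
    using ff[OF C.hom_set_Obj[OF that(1)]] that by (auto simp: bij_betw_def dest: inj_onD)
  define conj where "conj h = \<epsilon>' (Cod D h) \<odot>\<^bsub>D\<^esub> (h \<odot>\<^bsub>D\<^esub> \<epsilon> (Dom D h))" for h
  have conj: "conj h \<in> hom_set D (on_verts F (g x)) (on_verts F (g y))" "\<epsilon> y \<odot>\<^bsub>D\<^esub> conj h = h \<odot>\<^bsub>D\<^esub> \<epsilon> x"
    if h: "h \<in> hom_set D x y" for h x y
  proof -
    have o: "x \<in> Obj D" "y \<in> Obj D" using D.hom_set_Obj h by auto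
    have c: "conj h = \<epsilon>' y \<odot>\<^bsub>D\<^esub> (h \<odot>\<^bsub>D\<^esub> \<epsilon> x)" using h by (simp add: conj_def hom_set_iff)
    note he = D.Comp_hom[OF e(1)[OF o(1)] h]
    show "conj h \<in> hom_set D (on_verts F (g x)) (on_verts F (g y))"
      unfolding c by (intro D.Comp_hom[OF he e(2)[OF o(2)]])
    show "\<epsilon> y \<odot>\<^bsub>D\<^esub> conj h = h \<odot>\<^bsub>D\<^esub> \<epsilon> x"
      unfolding c using D.Comp_assoc[OF he e(2)[OF o(2)] e(1)[OF o(2)]] e(4)[OF o(2)]
        D.Comp_Ident_left[OF he] by simp
  qed
  have cancel: "h = h'" if "h \<in> hom_set D x (on_verts F (g y))" "h' \<in> hom_set D x (on_verts F (g y))"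
    "\<epsilon> y \<odot>\<^bsub>D\<^esub> h = \<epsilon> y \<odot>\<^bsub>D\<^esub> h'" "y \<in> Obj D" for h h' x y
  proof -
    have "\<epsilon>' y \<odot>\<^bsub>D\<^esub> (\<epsilon> y \<odot>\<^bsub>D\<^esub> h) = \<epsilon>' y \<odot>\<^bsub>D\<^esub> (\<epsilon> y \<odot>\<^bsub>D\<^esub> h')" using that by simp
    then show ?thesis
      using D.Comp_assoc[OF that(1) e(1,2)[OF that(4)]] D.Comp_assoc[OF that(2) e(1,2)[OF that(4)]]
        e(3)[OF that(4)] D.Comp_Ident_left[OF that(1)] D.Comp_Ident_left[OF that(2)] by simp
  qed
  define G where "G = \<lparr>on_verts = (\<lambda>y \<in> Obj D. g y),
    on_arcs = (\<lambda>h \<in> Arr D. lift (g (Dom D h)) (g (Cod D h)) (conj h))\<rparr>"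
  have Gv: "on_verts G y = g y" if "y \<in> Obj D" for y using that by (simp add: G_def)
  have Ga: "on_arcs G h \<in> hom_set C (g x) (g y)" "on_arcs F (on_arcs G h) = conj h"
    if "h \<in> hom_set D x y" for h x y
    using lift[OF g g conj(1)[OF that]] D.hom_set_Obj[OF that] that by (auto simp: G_def hom_set_iff)
  have G: "is_functor D C G"
  proof (rule is_functorI)
    fix h x y assume h: "h \<in> hom_set D x y"
    then show "on_arcs G h \<in> hom_set C (on_verts G x) (on_verts G y)"
      using Ga(1)[OF h] D.hom_set_Obj[OF h] by (simp add: Gv)
  next
    fix x assume x: "x \<in> Obj D"
    have "conj (Ident D x) = Ident D (on_verts F (g x))"
      using conj[OF D.Ident_hom[OF x]] D.Comp_Ident_left[OF e(1)[OF x]] D.Comp_Ident_right[OF e(1)[OF x]]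
      by (intro cancel[OF _ D.Ident_hom _ x]) (auto intro: is_functor_Obj[OF assms(3)] g x)
    then show "on_arcs G (Ident D x) = Ident C (on_verts G x)"
      using Ga[OF D.Ident_hom[OF x]] C.Ident_hom[OF g[OF x]] is_functor_Ident[OF assms(3) g[OF x]] Gv[OF x]
      by (intro eq[of _ "g x" "g x"]) auto
  next
    fix h k x y z assume h: "h \<in> hom_set D x y" and k: "k \<in> hom_set D y z"
    have o: "x \<in> Obj D" "y \<in> Obj D" "z \<in> Obj D" using D.hom_set_Obj h k by auto
    note c = conj[OF h] conj[OF k] conj[OF D.Comp_hom[OF h k]]
    have "conj (k \<odot>\<^bsub>D\<^esub> h) = conj k \<odot>\<^bsub>D\<^esub> conj h"
    proof (rule cancel[OF c(5) D.Comp_hom[OF c(1) c(3)] _ o(3)])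
      show "\<epsilon> z \<odot>\<^bsub>D\<^esub> conj (k \<odot>\<^bsub>D\<^esub> h) = \<epsilon> z \<odot>\<^bsub>D\<^esub> (conj k \<odot>\<^bsub>D\<^esub> conj h)"
        using c(2,4,6) D.Comp_assoc[OF c(1,3) e(1)[OF o(3)]] D.Comp_assoc[OF c(1) e(1)[OF o(2)] k]
          D.Comp_assoc[OF e(1)[OF o(1)] h k] by simp
    qed
    then show "on_arcs G (k \<odot>\<^bsub>D\<^esub> h) = on_arcs G k \<odot>\<^bsub>C\<^esub> on_arcs G h"
      using Ga[OF h] Ga[OF k] Ga[OF D.Comp_hom[OF h k]] is_functor_Comp[OF assms(3) Ga(1)[OF h] Ga(1)[OF k]]
      by (intro eq[OF Ga(1)[OF D.Comp_hom[OF h k]] C.Comp_hom[OF Ga(1)[OF h] Ga(1)[OF k]]]) simp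
  qed (auto simp: G_def g)
  have FGv: "on_verts (comp_functor D F G) y = on_verts F (g y)" if "y \<in> Obj D" for y
    using that by (simp add: comp_functor_def compose_def Gv)
  have FGa: "on_arcs (comp_functor D F G) h = conj h" if "h \<in> hom_set D x y" for h x y
    using that Ga(2)[OF that] by (simp add: comp_functor_def compose_def hom_set_iff)
  have idv: "on_verts (id_functor X) y = y" if "y \<in> Obj X" for X :: "('x, 'y) category" and y
    using that by (simp add: id_functor_def)
  have ida: "on_arcs (id_functor X) h = h" if "h \<in> hom_set X x y" for X :: "('x, 'y) category" and x y h
    using that by (simp add: id_functor_def hom_set_iff)
  have FG: "isomorphic_in (functor_category D D) (comp_functor D F G) (id_functor D)"
    by (rule isomorphic_in_functor_categoryI[where \<tau> = \<epsilon> and \<rho> = \<epsilon>'])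
      (use assms(2,3) G e in \<open>auto simp: FGv FGa idv ida conj(2) intro!: is_functor_comp is_functor_id\<close>)
  have GFv: "on_verts (comp_functor C G F) x = g (on_verts F x)" if "x \<in> Obj C" for x
    using that is_functor_Obj[OF assms(3) that] by (simp add: comp_functor_def compose_def Gv)
  have GFa: "on_arcs (comp_functor C G F) f = on_arcs G (on_arcs F f)" if "f \<in> hom_set C x y" for f x y
    using that by (simp add: comp_functor_def compose_def hom_set_iff)
  define \<eta> where "\<eta> x = lift x (g (on_verts F x)) (\<epsilon>' (on_verts F x))" for x
  define \<eta>' where "\<eta>' x = lift (g (on_verts F x)) x (\<epsilon> (on_verts F x))" for x
  have n: "\<eta> x \<in> hom_set C x (g (on_verts F x))" "on_arcs F (\<eta> x) = \<epsilon>' (on_verts F x)"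
    "\<eta>' x \<in> hom_set C (g (on_verts F x)) x" "on_arcs F (\<eta>' x) = \<epsilon> (on_verts F x)" if x: "x \<in> Obj C" for x
  proof -
    note o = is_functor_Obj[OF assms(3) x]
    show "\<eta> x \<in> hom_set C x (g (on_verts F x))" "on_arcs F (\<eta> x) = \<epsilon>' (on_verts F x)"
      "\<eta>' x \<in> hom_set C (g (on_verts F x)) x" "on_arcs F (\<eta>' x) = \<epsilon> (on_verts F x)"
      using lift[OF x g[OF o] e(2)[OF o]] lift[OF g[OF o] x e(1)[OF o]] by (auto simp: \<eta>_def \<eta>'_def)
  qed
  have "isomorphic_in (functor_category C C) (id_functor C) (comp_functor C G F)"
  proof (rule isomorphic_in_functor_categoryI[where \<tau> = \<eta> and \<rho> = \<eta>'])
    fix x assume x: "x \<in> Obj C"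
    note o = is_functor_Obj[OF assms(3) x]
    show "\<eta> x \<in> hom_set C (on_verts (id_functor C) x) (on_verts (comp_functor C G F) x)"
      "\<eta>' x \<in> hom_set C (on_verts (comp_functor C G F) x) (on_verts (id_functor C) x)"
      using n[OF x] x by (auto simp: idv GFv)
    have "\<eta>' x \<odot>\<^bsub>C\<^esub> \<eta> x = Ident C x"
      using is_functor_Comp[OF assms(3) n(1,3)[OF x]] n(2,4)[OF x] e(4)[OF o] is_functor_Ident[OF assms(3) x]
      by (intro eq[OF C.Comp_hom[OF n(1,3)[OF x]] C.Ident_hom[OF x]]) simp
    then show "\<eta>' x \<odot>\<^bsub>C\<^esub> \<eta> x = Ident C (on_verts (id_functor C) x)"
      using x by (simp add: idv)
    have "\<eta> x \<odot>\<^bsub>C\<^esub> \<eta>' x = Ident C (g (on_verts F x))"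
      using is_functor_Comp[OF assms(3) n(3,1)[OF x]] n(2,4)[OF x] e(3)[OF o] is_functor_Ident[OF assms(3) g[OF o]]
      by (intro eq[OF C.Comp_hom[OF n(3,1)[OF x]] C.Ident_hom[OF g[OF o]]]) simp
    then show "\<eta> x \<odot>\<^bsub>C\<^esub> \<eta>' x = Ident C (on_verts (comp_functor C G F) x)"
      using x by (simp add: GFv)
  next
    fix f x y assume f: "f \<in> hom_set C x y" and o: "x \<in> Obj C" "y \<in> Obj C"
    note o' = is_functor_Obj[OF assms(3) o(1)] is_functor_Obj[OF assms(3) o(2)]
    note Ff = is_functor_hom[OF assms(3) f]
    note F1 = is_functor_Comp[OF assms(3) f n(1)[OF o(2)]] is_functor_Comp[OF assms(3) n(1)[OF o(1)] Ga(1)[OF Ff]]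
    have "\<eta> y \<odot>\<^bsub>C\<^esub> f = on_arcs G (on_arcs F f) \<odot>\<^bsub>C\<^esub> \<eta> x"
    proof (rule eq[OF C.Comp_hom[OF f n(1)[OF o(2)]] C.Comp_hom[OF n(1)[OF o(1)] Ga(1)[OF Ff]]])
      have "\<epsilon>' (on_verts F y) \<odot>\<^bsub>D\<^esub> on_arcs F f = conj (on_arcs F f) \<odot>\<^bsub>D\<^esub> \<epsilon>' (on_verts F x)"
        using D.Comp_assoc[OF Ff e(2)[OF o'(2)] e(1)[OF o'(2)]]
          D.Comp_assoc[OF e(2)[OF o'(1)] conj(1)[OF Ff] e(1)[OF o'(2)]] conj(2)[OF Ff]
          D.Comp_assoc[OF e(2,1)[OF o'(1)] Ff] e(4)[OF o'(1)] e(4)[OF o'(2)]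
          D.Comp_Ident_left[OF Ff] D.Comp_Ident_right[OF Ff]
        by (intro cancel[OF D.Comp_hom[OF Ff e(2)[OF o'(2)]] D.Comp_hom[OF e(2)[OF o'(1)] conj(1)[OF Ff]] _ o'(2)])
          simp
      then show "on_arcs F (\<eta> y \<odot>\<^bsub>C\<^esub> f) = on_arcs F (on_arcs G (on_arcs F f) \<odot>\<^bsub>C\<^esub> \<eta> x)"
        using F1 n(2)[OF o(1)] n(2)[OF o(2)] Ga(2)[OF Ff] by simp
    qed
    then show "\<eta> y \<odot>\<^bsub>C\<^esub> on_arcs (id_functor C) f = on_arcs (comp_functor C G F) f \<odot>\<^bsub>C\<^esub> \<eta> x"
      using f o by (simp add: GFa ida)
  qed (use assms(1,3) G in \<open>auto intro!: is_functor_comp is_functor_id\<close>)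
  then show ?thesis
    unfolding equivalence_functor_def using assms(3) G FG by blast
qed

section \<open>Pullback along a cocone\<close>

lemma is_pullbackI:
  assumes f: "f \<in> hom_set G x z" and g: "g \<in> hom_set G y z"
    and p: "p \<in> hom_set G w x" and q: "q \<in> hom_set G w y" and "f \<odot>\<^bsub>G\<^esub> p = g \<odot>\<^bsub>G\<^esub> q"
    and "\<And>v h k. h \<in> hom_set G v x \<Longrightarrow> k \<in> hom_set G v y \<Longrightarrow> f \<odot>\<^bsub>G\<^esub> h = g \<odot>\<^bsub>G\<^esub> k \<Longrightarrow>
      \<exists>!u. u \<in> hom_set G v w \<and> p \<odot>\<^bsub>G\<^esub> u = h \<and> q \<odot>\<^bsub>G\<^esub> u = k"
  shows "is_pullback G f g p q"
proof -
  have "Dom G f = x" "Dom G g = y" "Dom G p = w" using f g p by (auto simp: hom_set_iff)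
  then show ?thesis
    unfolding is_pullback_def using assms(5,6) f g p q by (simp add: hom_set_iff[of f]
        hom_set_iff[of g] hom_set_iff[of p] hom_set_iff[of q])
qed

context
  fixes G :: "('o, 'a) category" and f g p q
  assumes pullback: "is_pullback G f g p q"
begin

lemma pullback_hom:
  "f \<in> hom_set G (Dom G f) (Cod G f)" "g \<in> hom_set G (Dom G g) (Cod G f)"
  "p \<in> hom_set G (Dom G p) (Dom G f)" "q \<in> hom_set G (Dom G p) (Dom G g)"
  "f \<odot>\<^bsub>G\<^esub> p = g \<odot>\<^bsub>G\<^esub> q"
  using pullback by (auto simp: is_pullback_def hom_set_iff)

lemma pullback_ex1:
  assumes "category G" "h \<in> hom_set G x (Dom G f)" "k \<in> hom_set G x (Dom G g)"
    and "f \<odot>\<^bsub>G\<^esub> h = g \<odot>\<^bsub>G\<^esub> k"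
  shows "\<exists>!u. u \<in> hom_set G x (Dom G p) \<and> p \<odot>\<^bsub>G\<^esub> u = h \<and> q \<odot>\<^bsub>G\<^esub> u = k"
  using pullback assms category.hom_set_Obj[OF assms(1,2)] unfolding is_pullback_def by blast

lemma into_pullback:
  assumes "category G" "h \<in> hom_set G x (Dom G f)" "k \<in> hom_set G x (Dom G g)"
    and "f \<odot>\<^bsub>G\<^esub> h = g \<odot>\<^bsub>G\<^esub> k"
  shows "into_pullback G p q h k \<in> hom_set G x (Dom G p)"
    and "p \<odot>\<^bsub>G\<^esub> into_pullback G p q h k = h"
    and "q \<odot>\<^bsub>G\<^esub> into_pullback G p q h k = k"
proof -
  have "Dom G h = x" using assms(2) by (simp add: hom_set_iff)
  then show "into_pullback G p q h k \<in> hom_set G x (Dom G p)"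
    and "p \<odot>\<^bsub>G\<^esub> into_pullback G p q h k = h"
    and "q \<odot>\<^bsub>G\<^esub> into_pullback G p q h k = k"
    using theI'[OF pullback_ex1[OF assms]] unfolding into_pullback_def by auto
qed

lemma pullback_jointly_monic:
  assumes "category G" "u \<in> hom_set G x (Dom G p)" "v \<in> hom_set G x (Dom G p)"
    and "p \<odot>\<^bsub>G\<^esub> u = p \<odot>\<^bsub>G\<^esub> v" "q \<odot>\<^bsub>G\<^esub> u = q \<odot>\<^bsub>G\<^esub> v"
  shows "u = v"
proof -
  note h = pullback_hom
  have "f \<odot>\<^bsub>G\<^esub> (p \<odot>\<^bsub>G\<^esub> u) = g \<odot>\<^bsub>G\<^esub> (q \<odot>\<^bsub>G\<^esub> u)"
    using category.Comp_assoc[OF assms(1) assms(2) h(3) h(1)]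
      category.Comp_assoc[OF assms(1) assms(2) h(4) h(2)] h(5) by simp
  then show ?thesis
    using pullback_ex1[OF assms(1) category.Comp_hom[OF assms(1,2) h(3)]
        category.Comp_hom[OF assms(1,2) h(4)]] assms(2-) by auto
qed

end

text \<open>
  The squares of a pullback family over the diagram are left halves of rectangles whose right
  halves are chosen pullbacks along the cocone; this is why the family is cartesian. The universal
  arrow comes from the outer rectangle, and the jointly monic projections of the right square show
  that it is compatible with the inner arrow.
\<close>

lemma pullback_left_square:
  assumes "category G" and right: "is_pullback G f g p q"
    and d: "d \<in> hom_set G x (Dom G f)"
    and outer: "is_pullback G (f \<odot>\<^bsub>G\<^esub> d) g p' (q \<odot>\<^bsub>G\<^esub> e)"
    and e: "e \<in> hom_set G (Dom G p') (Dom G p)"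
    and comm: "d \<odot>\<^bsub>G\<^esub> p' = p \<odot>\<^bsub>G\<^esub> e"
  shows "is_pullback G d p p' e"
proof -
  interpret category G by fact
  note r = pullback_hom[OF right] and o = pullback_hom[OF outer]
  have "Dom G (f \<odot>\<^bsub>G\<^esub> d) = x" using Comp_hom[OF d r(1)] by (simp add: hom_set_iff)
  then have p': "p' \<in> hom_set G (Dom G p') x" using o(3) by simp
  have "\<exists>!u. u \<in> hom_set G z (Dom G p') \<and> p' \<odot>\<^bsub>G\<^esub> u = h \<and> e \<odot>\<^bsub>G\<^esub> u = k"
    if h: "h \<in> hom_set G z x" and k: "k \<in> hom_set G z (Dom G p)" and hk: "d \<odot>\<^bsub>G\<^esub> h = p \<odot>\<^bsub>G\<^esub> k"
    for z h k
  proof -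
    have k': "q \<odot>\<^bsub>G\<^esub> k \<in> hom_set G z (Dom G g)" using Comp_hom[OF k r(4)] .
    have "(f \<odot>\<^bsub>G\<^esub> d) \<odot>\<^bsub>G\<^esub> h = g \<odot>\<^bsub>G\<^esub> (q \<odot>\<^bsub>G\<^esub> k)"
      using Comp_assoc[OF h d r(1)] hk Comp_assoc[OF k r(3) r(1)] Comp_assoc[OF k r(4) r(2)] r(5)
      by simp
    then obtain u where u: "u \<in> hom_set G z (Dom G p')" "p' \<odot>\<^bsub>G\<^esub> u = h" "(q \<odot>\<^bsub>G\<^esub> e) \<odot>\<^bsub>G\<^esub> u = q \<odot>\<^bsub>G\<^esub> k"
      using pullback_ex1[OF outer assms(1) _ k', of h] h \<open>Dom G (f \<odot>\<^bsub>G\<^esub> d) = x\<close> by auto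
    have "e \<odot>\<^bsub>G\<^esub> u = k"
    proof (rule pullback_jointly_monic[OF right assms(1) Comp_hom[OF u(1) e] k])
      show "p \<odot>\<^bsub>G\<^esub> (e \<odot>\<^bsub>G\<^esub> u) = p \<odot>\<^bsub>G\<^esub> k"
        using Comp_assoc[OF u(1) e r(3)] comm Comp_assoc[OF u(1) p' d] u(2) hk by simp
      show "q \<odot>\<^bsub>G\<^esub> (e \<odot>\<^bsub>G\<^esub> u) = q \<odot>\<^bsub>G\<^esub> k"
        using Comp_assoc[OF u(1) e r(4)] u(3) by simp
    qed
    moreover have "v = u" if "v \<in> hom_set G z (Dom G p')" "p' \<odot>\<^bsub>G\<^esub> v = h" "e \<odot>\<^bsub>G\<^esub> v = k" for v
      using Comp_assoc[OF that(1) e r(4)] Comp_assoc[OF u(1) e r(4)] calculation that(2,3) u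
      by (intro pullback_jointly_monic[OF outer assms(1) that(1) u(1)]) auto
    ultimately show ?thesis using u by blast
  qed
  then show ?thesis by (rule is_pullbackI[OF d r(3) p' e comm])
qed

lemma Obj_cartesian_slice:
  "\<alpha> \<in> Obj (cartesian_slice I G D) \<longleftrightarrow>
    (\<exists>E \<tau>. \<alpha> = Arrow E \<tau> D \<and> diagram I G E \<and> diagram I G D \<and> nat_trans I G E D \<tau> \<and>
      (\<forall>d \<in> arcs I. is_pullback G (on_arcs D d) (\<tau> (head I d)) (\<tau> (tail I d)) (on_arcs E d)))"
  by (auto simp: cartesian_slice_def cartesian_def diagram_category_def)

lemma Arr_diagram_category:
  "Arrow E \<tau> D \<in> Arr (diagram_category I G) \<longleftrightarrow>
    diagram I G E \<and> diagram I G D \<and> nat_trans I G E D \<tau>"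
  by (simp add: diagram_category_def)

lemma hom_set_cartesian_slice:
  assumes "category G" "wf_digraph I"
  shows "\<phi> \<in> hom_set (cartesian_slice I G D) \<alpha> \<alpha>' \<longleftrightarrow>
    (\<exists>h. \<phi> = Arrow \<alpha> (Arrow (src \<alpha>) h (src \<alpha>')) \<alpha>' \<and>
      \<alpha> \<in> Obj (cartesian_slice I G D) \<and> \<alpha>' \<in> Obj (cartesian_slice I G D) \<and>
      nat_trans I G (src \<alpha>) (src \<alpha>') h \<and>
      (\<forall>i \<in> verts I. val \<alpha>' i \<odot>\<^bsub>G\<^esub> h i = val \<alpha> i))" (is "?l \<longleftrightarrow> ?r")
proof
  assume ?l
  then obtain f where f: "\<phi> = Arrow \<alpha> f \<alpha>'" "\<alpha> \<in> Obj (cartesian_slice I G D)"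
     "\<alpha>' \<in> Obj (cartesian_slice I G D)" "f \<in> hom_set (diagram_category I G) (src \<alpha>) (src \<alpha>')"
     "\<alpha>' \<odot>\<^bsub>diagram_category I G\<^esub> f = \<alpha>"
    by (auto simp: cartesian_slice_def hom_set_full_subcategory hom_set_slice split: if_splits)
  then obtain h where h: "f = Arrow (src \<alpha>) h (src \<alpha>')" "nat_trans I G (src \<alpha>) (src \<alpha>') h"
    by (auto simp: hom_set_diagram_category)
  have "val \<alpha>' i \<odot>\<^bsub>G\<^esub> h i = val \<alpha> i" if "i \<in> verts I" for i
    using arg_cong[OF f(5), of val, THEN fun_cong, of i] that by (simp add: h(1))
  then show ?r using f h by auto
next
  assume ?r
  then obtain h where h: "\<phi> = Arrow \<alpha> (Arrow (src \<alpha>) h (src \<alpha>')) \<alpha>'"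
    and o: "\<alpha> \<in> Obj (cartesian_slice I G D)" "\<alpha>' \<in> Obj (cartesian_slice I G D)"
    and n: "nat_trans I G (src \<alpha>) (src \<alpha>') h"
    and e: "\<forall>i \<in> verts I. val \<alpha>' i \<odot>\<^bsub>G\<^esub> h i = val \<alpha> i" by auto
  obtain E \<tau> where a: "\<alpha> = Arrow E \<tau> D" "diagram I G E" "diagram I G D" "nat_trans I G E D \<tau>"
    using o(1) by (auto simp: Obj_cartesian_slice)
  obtain E' \<tau>' where a': "\<alpha>' = Arrow E' \<tau>' D" "diagram I G E'" "nat_trans I G E' D \<tau>'"
    using o(2) by (auto simp: Obj_cartesian_slice)
  have "(\<lambda>i\<in>verts I. \<tau>' i \<odot>\<^bsub>G\<^esub> h i) = \<tau>"
    using nat_trans_Comp[OF assms a(2) a'(2) a(3) _ a'(3)] n a(1) a'(1) e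
    by (intro nat_trans_ext[OF _ a(4)]) auto
  then have "\<alpha>' \<odot>\<^bsub>diagram_category I G\<^esub> Arrow E h E' = \<alpha>"
    by (simp add: a(1) a'(1))
  moreover have "Arrow E h E' \<in> hom_set (diagram_category I G) E E'"
    "\<alpha> \<in> Arr (diagram_category I G)" "\<alpha>' \<in> Arr (diagram_category I G)"
    using n a a' by (auto simp: hom_set_diagram_category Arr_diagram_category)
  moreover have "cartesian I G \<alpha>" "cartesian I G \<alpha>'"
    using o by (simp_all add: cartesian_slice_def)
  ultimately show ?l
    unfolding h cartesian_slice_def hom_set_full_subcategory
    by (simp add: a(1) a'(1) hom_set_slice)
qed

lemma cocone_hom: "cocone I G E T \<rho> \<Longrightarrow> i \<in> verts I \<Longrightarrow> \<rho> i \<in> hom_set G (on_verts E i) T"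
  using nat_trans_hom[of I G E "constant_diagram I G T" \<rho> i]
  by (simp add: cocone_def constant_diagram_def)

lemma cocone_natural:
  assumes "category G" "wf_digraph I" "cocone I G E T \<rho>" "d \<in> arcs I"
  shows "\<rho> (head I d) \<odot>\<^bsub>G\<^esub> on_arcs E d = \<rho> (tail I d)"
  using nat_trans_natural[of I G E "constant_diagram I G T" \<rho> d] assms(3,4)
    category.Comp_Ident_left[OF assms(1) cocone_hom[OF assms(3) wf_digraph.tail_in_verts[OF assms(2,4)]]]
  by (simp add: cocone_def constant_diagram_def)

lemma coconeI:
  assumes "category G" "wf_digraph I" "diagram I G E" "T \<in> Obj G" "\<rho> \<in> extensional (verts I)"
    and \<rho>: "\<And>i. i \<in> verts I \<Longrightarrow> \<rho> i \<in> hom_set G (on_verts E i) T"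
    and "\<And>d. d \<in> arcs I \<Longrightarrow> \<rho> (head I d) \<odot>\<^bsub>G\<^esub> on_arcs E d = \<rho> (tail I d)"
  shows "cocone I G E T \<rho>"
  unfolding cocone_def
proof (intro conjI assms(3,4) nat_transI[OF assms(5)])
  fix d assume d: "d \<in> arcs I"
  then show "\<rho> (head I d) \<odot>\<^bsub>G\<^esub> on_arcs E d = on_arcs (constant_diagram I G T) d \<odot>\<^bsub>G\<^esub> \<rho> (tail I d)"
    using assms(7)[OF d]
      category.Comp_Ident_left[OF assms(1) \<rho>[OF wf_digraph.tail_in_verts[OF assms(2) d]]]
    by (simp add: constant_diagram_def)
qed (simp add: \<rho> constant_diagram_def)

lemma cocone_nat_trans:
  assumes G: "category G" and I: "wf_digraph I" and E: "diagram I G E" and h: "nat_trans I G E E' h"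
    and c: "cocone I G E' T \<rho>"
  shows "cocone I G E T (\<lambda>i \<in> verts I. \<rho> i \<odot>\<^bsub>G\<^esub> h i)"
proof -
  interpret G: category G by fact
  interpret I: wf_digraph I by fact
  have E': "diagram I G E'" and T: "T \<in> Obj G" using c by (auto simp: cocone_def)
  show ?thesis
  proof (rule coconeI[OF G I E T restrict_extensional])
    fix d assume d: "d \<in> arcs I"
    let ?s = "tail I d" and ?t = "head I d"
    have v: "?s \<in> verts I" "?t \<in> verts I" using d by auto
    show "(\<lambda>i \<in> verts I. \<rho> i \<odot>\<^bsub>G\<^esub> h i) ?t \<odot>\<^bsub>G\<^esub> on_arcs E d = (\<lambda>i \<in> verts I. \<rho> i \<odot>\<^bsub>G\<^esub> h i) ?s"
      using v G.Comp_assoc[OF diagram_arc[OF E d] nat_trans_hom[OF h v(2)] cocone_hom[OF c v(2)]]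
        G.Comp_assoc[OF nat_trans_hom[OF h v(1)] diagram_arc[OF E' d] cocone_hom[OF c v(2)]]
        nat_trans_natural[OF h d] cocone_natural[OF G I c d] by simp
  qed (use G.Comp_hom[OF nat_trans_hom[OF h] cocone_hom[OF c]] in simp)
qed

lemma cocone_Comp:
  assumes G: "category G" and I: "wf_digraph I" and c: "cocone I G E K \<rho>" and u: "u \<in> hom_set G K T"
  shows "cocone I G E T (\<lambda>i \<in> verts I. u \<odot>\<^bsub>G\<^esub> \<rho> i)"
proof -
  interpret G: category G by fact
  interpret I: wf_digraph I by fact
  have E: "diagram I G E" using c by (simp add: cocone_def)
  show ?thesis
  proof (rule coconeI[OF G I E G.hom_set_Obj(2)[OF u] restrict_extensional])
    fix d assume d: "d \<in> arcs I"
    have v: "tail I d \<in> verts I" "head I d \<in> verts I" using d by auto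
    show "(\<lambda>i \<in> verts I. u \<odot>\<^bsub>G\<^esub> \<rho> i) (head I d) \<odot>\<^bsub>G\<^esub> on_arcs E d = (\<lambda>i \<in> verts I. u \<odot>\<^bsub>G\<^esub> \<rho> i) (tail I d)"
      using v G.Comp_assoc[OF diagram_arc[OF E d] cocone_hom[OF c v(2)] u] cocone_natural[OF G I c d]
      by simp
  qed (use G.Comp_hom[OF cocone_hom[OF c] u] in simp)
qed

lemma colimiting_factor:
  assumes "colimiting_cocone I G E K \<rho>" "cocone I G E T \<pi>"
  obtains u where "u \<in> hom_set G K T" "\<And>i. i \<in> verts I \<Longrightarrow> u \<odot>\<^bsub>G\<^esub> \<rho> i = \<pi> i"
  using assms unfolding colimiting_cocone_def by blast

lemma colimiting_eqI:
  assumes "category G" "wf_digraph I" and c: "colimiting_cocone I G E K \<rho>"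
    and u: "u \<in> hom_set G K T" and v: "v \<in> hom_set G K T"
    and eq: "\<And>i. i \<in> verts I \<Longrightarrow> u \<odot>\<^bsub>G\<^esub> \<rho> i = v \<odot>\<^bsub>G\<^esub> \<rho> i"
  shows "u = v"
proof -
  let ?\<pi> = "\<lambda>i \<in> verts I. u \<odot>\<^bsub>G\<^esub> \<rho> i"
  have "cocone I G E T ?\<pi>"
    using c by (intro cocone_Comp[OF assms(1,2) _ u]) (simp add: colimiting_cocone_def)
  then have "\<exists>!w. w \<in> hom_set G K T \<and> (\<forall>i \<in> verts I. w \<odot>\<^bsub>G\<^esub> \<rho> i = ?\<pi> i)"
    using c unfolding colimiting_cocone_def by blast
  then obtain w where w: "\<And>w'. w' \<in> hom_set G K T \<Longrightarrow> \<forall>i \<in> verts I. w' \<odot>\<^bsub>G\<^esub> \<rho> i = ?\<pi> i \<Longrightarrow> w' = w"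
    by blast
  have "u = w" by (rule w[OF u]) simp
  moreover have "v = w" by (rule w[OF v]) (simp add: eq)
  ultimately show ?thesis by simp
qed

locale cocone_pullback = G: category G + I: wf_digraph I
  for G :: "('o, 'a) category" (structure) and I :: "('v, 'e) pre_digraph" +
  fixes pb :: "'a \<Rightarrow> 'a \<Rightarrow> 'a \<times> 'a" and D S \<kappa>
  assumes chosen: "chosen_pullbacks G pb"
    and cocone: "cocone I G D S \<kappa>"
begin

abbreviation proj where "proj \<sigma> i \<equiv> fst (pb (\<kappa> i) \<sigma>)"
abbreviation leg where "leg \<sigma> i \<equiv> snd (pb (\<kappa> i) \<sigma>)"
abbreviation family where "family \<equiv> pullback_family I G pb D \<kappa>"

lemma category: "category G" and wf: "wf_digraph I"
  by (rule G.category_axioms I.wf_digraph_axioms)+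

lemma diagram: "diagram I G D"
  and S: "S \<in> Obj G"
  using cocone by (auto simp: cocone_def)

lemma kappa_hom: "i \<in> verts I \<Longrightarrow> \<kappa> i \<in> hom_set G (on_verts D i) S"
  using cocone_hom[OF cocone] .

lemma kappa_natural: "d \<in> arcs I \<Longrightarrow> \<kappa> (head I d) \<odot> on_arcs D d = \<kappa> (tail I d)"
  using cocone_natural[OF category wf cocone] .

context
  fixes \<sigma> assumes \<sigma>: "\<sigma> \<in> Arr G" "Cod G \<sigma> = S"
begin

lemma pullback_square: "i \<in> verts I \<Longrightarrow> is_pullback G (\<kappa> i) \<sigma> (proj \<sigma> i) (leg \<sigma> i)"
  using chosen \<sigma> kappa_hom[of i] by (simp add: chosen_pullbacks_def hom_set_iff)

lemma proj_hom: "i \<in> verts I \<Longrightarrow> proj \<sigma> i \<in> hom_set G (Dom G (proj \<sigma> i)) (on_verts D i)"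
  using pullback_hom(3)[OF pullback_square] kappa_hom[of i] by (simp add: hom_set_iff)

lemma leg_hom: "i \<in> verts I \<Longrightarrow> leg \<sigma> i \<in> hom_set G (Dom G (proj \<sigma> i)) (Dom G \<sigma>)"
  using pullback_hom(4)[OF pullback_square] .

lemma square_commutes: "i \<in> verts I \<Longrightarrow> \<kappa> i \<odot> proj \<sigma> i = \<sigma> \<odot> leg \<sigma> i"
  using pullback_hom(5)[OF pullback_square] .

lemma \<sigma>_hom: "\<sigma> \<in> hom_set G (Dom G \<sigma>) S"
  using \<sigma> by (simp add: hom_set_iff)

lemma family_simps:
  "trg (family \<sigma>) = D"
  "i \<in> verts I \<Longrightarrow> val (family \<sigma>) i = proj \<sigma> i"
  "i \<in> verts I \<Longrightarrow> on_verts (src (family \<sigma>)) i = Dom G (proj \<sigma> i)"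
  by (simp_all add: pullback_family_def Let_def)

lemma family_arc:
  assumes d: "d \<in> arcs I"
  shows "on_arcs (src (family \<sigma>)) d \<in> hom_set G (Dom G (proj \<sigma> (tail I d))) (Dom G (proj \<sigma> (head I d)))"
    and "proj \<sigma> (head I d) \<odot> on_arcs (src (family \<sigma>)) d = on_arcs D d \<odot> proj \<sigma> (tail I d)"
    and "leg \<sigma> (head I d) \<odot> on_arcs (src (family \<sigma>)) d = leg \<sigma> (tail I d)"
proof -
  have v: "tail I d \<in> verts I" "head I d \<in> verts I" using d by auto
  have c: "\<kappa> (head I d) \<odot> (on_arcs D d \<odot> proj \<sigma> (tail I d)) = \<sigma> \<odot> leg \<sigma> (tail I d)"
    using G.Comp_assoc[OF proj_hom[OF v(1)] diagram_arc[OF diagram d] kappa_hom[OF v(2)]]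
      kappa_natural[OF d] square_commutes[OF v(1)] by simp
  have k: "Dom G (\<kappa> (head I d)) = on_verts D (head I d)"
    using kappa_hom[OF v(2)] by (simp add: hom_set_iff)
  note u = into_pullback[OF pullback_square[OF v(2)] category,
      unfolded k, OF G.Comp_hom[OF proj_hom[OF v(1)] diagram_arc[OF diagram d]] leg_hom[OF v(1)] c]
  show "on_arcs (src (family \<sigma>)) d \<in> hom_set G (Dom G (proj \<sigma> (tail I d))) (Dom G (proj \<sigma> (head I d)))"
    and "proj \<sigma> (head I d) \<odot> on_arcs (src (family \<sigma>)) d = on_arcs D d \<odot> proj \<sigma> (tail I d)"
    and "leg \<sigma> (head I d) \<odot> on_arcs (src (family \<sigma>)) d = leg \<sigma> (tail I d)"
    using u d by (auto simp: pullback_family_def Let_def)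
qed

lemma family_diagram: "diagram I G (src (family \<sigma>))"
  unfolding graph_morphism_def
proof (intro conjI ballI)
  show "on_verts (src (family \<sigma>)) \<in> verts I \<rightarrow>\<^sub>E verts (underlying_graph G)"
    using G.hom_set_Obj(1)[OF proj_hom] by (auto simp: pullback_family_def Let_def)
  show "on_arcs (src (family \<sigma>)) \<in> arcs I \<rightarrow>\<^sub>E arcs (underlying_graph G)"
    using family_arc(1) by (auto simp: hom_set_iff) (auto simp: pullback_family_def Let_def)
qed (use family_arc(1) family_simps(3) in \<open>auto simp: hom_set_iff\<close>)

lemma family_Obj: "family \<sigma> \<in> Obj (cartesian_slice I G D)"
proof -
  have 1: "nat_trans I G (src (family \<sigma>)) D (val (family \<sigma>))"
  proof (rule nat_transI)
    show "val (family \<sigma>) \<in> extensional (verts I)"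
      by (simp add: pullback_family_def Let_def)
  qed (use proj_hom family_arc(2) in \<open>auto simp: family_simps\<close>)
  have 2: "is_pullback G (on_arcs D d) (proj \<sigma> (head I d)) (proj \<sigma> (tail I d)) (on_arcs (src (family \<sigma>)) d)"
    if d: "d \<in> arcs I" for d
  proof -
    have v: "tail I d \<in> verts I" "head I d \<in> verts I" using d by auto
    have k: "Dom G (\<kappa> (head I d)) = on_verts D (head I d)"
      using kappa_hom[OF v(2)] by (simp add: hom_set_iff)
    show ?thesis
      using pullback_square[OF v(1)] family_arc[OF d] diagram_arc[OF diagram d]
      by (intro pullback_left_square[OF category pullback_square[OF v(2)]])
        (auto simp: kappa_natural[OF d] k)
  qed
  show ?thesis
    unfolding Obj_cartesian_slice
    using 1 2 family_diagram diagram family_simps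
    by (intro exI[of _ "src (family \<sigma>)"] exI[of _ "val (family \<sigma>)"])
      (auto intro: arrow.expand)
qed

lemma leg_cocone: "cocone I G (src (family \<sigma>)) (Dom G \<sigma>) (\<lambda>i \<in> verts I. leg \<sigma> i)"
  using leg_hom family_arc(3) G.Dom_Obj[OF \<sigma>(1)]
  by (intro coconeI[OF category wf family_diagram]) (auto simp: family_simps)

end

text \<open>The components of the image of a morphism under the pullback functor.\<close>

definition comparison where
  "comparison \<sigma> \<sigma>' f i =
     into_pullback G (proj \<sigma>' i) (leg \<sigma>' i) (proj \<sigma> i) (f \<odot> leg \<sigma> i)"

lemma comparison:
  assumes "\<sigma> \<in> Arr G" "Cod G \<sigma> = S" "\<sigma>' \<in> Arr G" "Cod G \<sigma>' = S"
    and f: "f \<in> hom_set G (Dom G \<sigma>) (Dom G \<sigma>')" "\<sigma>' \<odot> f = \<sigma>" and i: "i \<in> verts I"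
  shows "comparison \<sigma> \<sigma>' f i \<in> hom_set G (Dom G (proj \<sigma> i)) (Dom G (proj \<sigma>' i))"
    and "proj \<sigma>' i \<odot> comparison \<sigma> \<sigma>' f i = proj \<sigma> i"
    and "leg \<sigma>' i \<odot> comparison \<sigma> \<sigma>' f i = f \<odot> leg \<sigma> i"
proof -
  have k: "Dom G (\<kappa> i) = on_verts D i"
    using kappa_hom[OF i] by (simp add: hom_set_iff)
  have "\<kappa> i \<odot> proj \<sigma> i = \<sigma>' \<odot> (f \<odot> leg \<sigma> i)"
    using G.Comp_assoc[OF leg_hom f(1) \<sigma>_hom] square_commutes assms by simp
  note u = into_pullback[OF pullback_square[OF assms(3,4) i] category,
      unfolded k, OF proj_hom[OF assms(1,2) i] G.Comp_hom[OF leg_hom[OF assms(1,2) i] f(1)] this]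
  show "comparison \<sigma> \<sigma>' f i \<in> hom_set G (Dom G (proj \<sigma> i)) (Dom G (proj \<sigma>' i))"
    and "proj \<sigma>' i \<odot> comparison \<sigma> \<sigma>' f i = proj \<sigma> i"
    and "leg \<sigma>' i \<odot> comparison \<sigma> \<sigma>' f i = f \<odot> leg \<sigma> i"
    using u by (auto simp: comparison_def)
qed

text \<open>
  Naturality of a family of arrows into pullbacks is tested on the two projections. For the
  projections to \<open>D\<close> it is naturality of \<open>\<tau>\<close>, which leaves the condition on the legs.
\<close>

lemma nat_trans_into_family:
  assumes \<sigma>: "\<sigma> \<in> Arr G" "Cod G \<sigma> = S" and E: "diagram I G E" "nat_trans I G E D \<tau>"
    and h: "h \<in> extensional (verts I)"
      "\<And>i. i \<in> verts I \<Longrightarrow> h i \<in> hom_set G (on_verts E i) (Dom G (proj \<sigma> i))"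
      "\<And>i. i \<in> verts I \<Longrightarrow> proj \<sigma> i \<odot> h i = \<tau> i"
    and l: "\<And>d. d \<in> arcs I \<Longrightarrow>
      (leg \<sigma> (head I d) \<odot> h (head I d)) \<odot> on_arcs E d = leg \<sigma> (tail I d) \<odot> h (tail I d)"
  shows "nat_trans I G E (src (family \<sigma>)) h"
proof (rule nat_transI)
  fix d assume d: "d \<in> arcs I"
  let ?s = "tail I d" and ?t = "head I d" and ?e = "on_arcs (src (family \<sigma>)) d"
  have v: "?s \<in> verts I" "?t \<in> verts I" using d by auto
  note a = diagram_arc[OF E(1) d] diagram_arc[OF diagram d] and F = family_arc[OF \<sigma> d]
  note p = proj_hom[OF \<sigma> v(1)] proj_hom[OF \<sigma> v(2)] leg_hom[OF \<sigma> v(1)] leg_hom[OF \<sigma> v(2)]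
  show "h ?t \<odot> on_arcs E d = ?e \<odot> h ?s"
  proof (rule pullback_jointly_monic[OF pullback_square[OF \<sigma> v(2)] category
        G.Comp_hom[OF a(1) h(2)[OF v(2)]] G.Comp_hom[OF h(2)[OF v(1)] F(1)]])
    show "proj \<sigma> ?t \<odot> (h ?t \<odot> on_arcs E d) = proj \<sigma> ?t \<odot> (?e \<odot> h ?s)"
      using G.Comp_assoc[OF a(1) h(2)[OF v(2)] p(2)] h(3)[OF v(1)] h(3)[OF v(2)]
        G.Comp_assoc[OF h(2)[OF v(1)] F(1) p(2)] G.Comp_assoc[OF h(2)[OF v(1)] p(1) a(2)]
        F(2) nat_trans_natural[OF E(2) d] by simp
    show "leg \<sigma> ?t \<odot> (h ?t \<odot> on_arcs E d) = leg \<sigma> ?t \<odot> (?e \<odot> h ?s)"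
      using G.Comp_assoc[OF a(1) h(2)[OF v(2)] p(4)] l[OF d]
        G.Comp_assoc[OF h(2)[OF v(1)] F(1) p(4)] F(3) by simp
  qed
qed (use h in \<open>auto simp: family_simps[OF \<sigma>]\<close>)

abbreviation pullback where "pullback \<equiv> pullback_functor I G pb D S \<kappa>"

lemma pullback_on_verts: "\<sigma> \<in> Arr G \<Longrightarrow> Cod G \<sigma> = S \<Longrightarrow> on_verts pullback \<sigma> = family \<sigma>"
  by (simp add: pullback_functor_def Let_def)

lemma pullback_on_arcs:
  "Arrow \<sigma> f \<sigma>' \<in> Arr (slice G S) \<Longrightarrow> on_arcs pullback (Arrow \<sigma> f \<sigma>') =
    Arrow (family \<sigma>) (Arrow (src (family \<sigma>)) (\<lambda>i \<in> verts I. comparison \<sigma> \<sigma>' f i) (src (family \<sigma>')))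
      (family \<sigma>')"
  by (simp add: pullback_functor_def Let_def comparison_def cong: restrict_cong)

lemma comparison_nat_trans:
  assumes "\<sigma> \<in> Arr G" "Cod G \<sigma> = S" "\<sigma>' \<in> Arr G" "Cod G \<sigma>' = S"
    and f: "f \<in> hom_set G (Dom G \<sigma>) (Dom G \<sigma>')" "\<sigma>' \<odot> f = \<sigma>"
  shows "nat_trans I G (src (family \<sigma>)) (src (family \<sigma>')) (\<lambda>i \<in> verts I. comparison \<sigma> \<sigma>' f i)"
proof (rule nat_trans_into_family[OF assms(3,4)])
  show "nat_trans I G (src (family \<sigma>)) D (val (family \<sigma>))"
    using family_Obj[OF assms(1,2)] by (auto simp: Obj_cartesian_slice)
  fix d assume d: "d \<in> arcs I"
  have v: "tail I d \<in> verts I" "head I d \<in> verts I" using d by auto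
  note l = leg_hom[OF assms(1,2) v(1)] leg_hom[OF assms(1,2) v(2)]
  show "(leg \<sigma>' (head I d) \<odot> (\<lambda>i\<in>verts I. comparison \<sigma> \<sigma>' f i) (head I d)) \<odot>
     on_arcs (src (family \<sigma>)) d =
     leg \<sigma>' (tail I d) \<odot> (\<lambda>i\<in>verts I. comparison \<sigma> \<sigma>' f i) (tail I d)"
    using v comparison(3)[OF assms] G.Comp_assoc[OF family_arc(1)[OF assms(1,2) d] l(2) f(1)]
      family_arc(3)[OF assms(1,2) d] by simp
qed (use comparison[OF assms] family_diagram[OF assms(1,2)] family_simps[OF assms(1,2)] in auto)

lemma pullback_arrow_hom:
  assumes "\<phi> \<in> hom_set (slice G S) \<sigma> \<sigma>'"
  shows "on_arcs pullback \<phi> \<in> hom_set (cartesian_slice I G D) (family \<sigma>) (family \<sigma>')"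
proof -
  obtain f where f: "\<phi> = Arrow \<sigma> f \<sigma>'" and a: "\<sigma> \<in> Arr G" "Cod G \<sigma> = S" "\<sigma>' \<in> Arr G" "Cod G \<sigma>' = S"
    "f \<in> hom_set G (Dom G \<sigma>) (Dom G \<sigma>')" "\<sigma>' \<odot> f = \<sigma>"
    using assms by (auto simp: hom_set_slice)
  have "\<phi> \<in> Arr (slice G S)" using assms by (simp add: hom_set_iff)
  then show ?thesis
    unfolding hom_set_cartesian_slice[OF category wf] f
    using comparison(2)[OF a] comparison_nat_trans[OF a] family_Obj a(1-4)
    by (auto simp: pullback_on_arcs family_simps)
qed

text \<open>
  Functoriality of the pullback functor and fullness come down to equations between arrows into a
  pullback family, which hold by construction after projection to \<open>D\<close> and to the domain of \<open>\<sigma>\<close>.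
\<close>

lemma into_family_eqI:
  assumes \<sigma>: "\<sigma> \<in> Arr G" "Cod G \<sigma> = S"
    and h: "nat_trans I G E (src (family \<sigma>)) h" "nat_trans I G E (src (family \<sigma>)) h'"
    and "\<And>i. i \<in> verts I \<Longrightarrow> proj \<sigma> i \<odot> h i = proj \<sigma> i \<odot> h' i"
    and "\<And>i. i \<in> verts I \<Longrightarrow> leg \<sigma> i \<odot> h i = leg \<sigma> i \<odot> h' i"
  shows "h = h'"
proof (rule nat_trans_ext[OF h])
  fix i assume i: "i \<in> verts I"
  show "h i = h' i"
    by (rule pullback_jointly_monic[OF pullback_square[OF \<sigma> i] category
          nat_trans_hom[OF h(1) i, unfolded family_simps(3)[OF \<sigma> i]]
          nat_trans_hom[OF h(2) i, unfolded family_simps(3)[OF \<sigma> i]] assms(5,6)[OF i]])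
qed

lemma pullback_is_functor: "is_functor (slice G S) (cartesian_slice I G D) pullback"
proof (rule is_functorI)
  show "on_verts pullback \<in> extensional (Obj (slice G S))"
    "on_arcs pullback \<in> extensional (Arr (slice G S))"
    by (simp_all add: pullback_functor_def Let_def)
next
  fix \<sigma> assume "\<sigma> \<in> Obj (slice G S)"
  then show "on_verts pullback \<sigma> \<in> Obj (cartesian_slice I G D)"
    by (simp add: pullback_on_verts family_Obj)
next
  fix \<phi> \<sigma> \<sigma>' assume \<phi>: "\<phi> \<in> hom_set (slice G S) \<sigma> \<sigma>'"
  then have "\<sigma> \<in> Arr G" "Cod G \<sigma> = S" "\<sigma>' \<in> Arr G" "Cod G \<sigma>' = S"
    by (auto simp: hom_set_slice)
  then show "on_arcs pullback \<phi> \<in> hom_set (cartesian_slice I G D) (on_verts pullback \<sigma>) (on_verts pullback \<sigma>')"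
    using pullback_arrow_hom[OF \<phi>] by (simp add: pullback_on_verts)
next
  fix \<sigma> assume "\<sigma> \<in> Obj (slice G S)"
  then have \<sigma>: "\<sigma> \<in> Arr G" "Cod G \<sigma> = S" by auto
  have id: "Ident G (Dom G \<sigma>) \<in> hom_set G (Dom G \<sigma>) (Dom G \<sigma>)" "\<sigma> \<odot> Ident G (Dom G \<sigma>) = \<sigma>"
    using G.Ident_hom[OF G.Dom_Obj[OF \<sigma>(1)]] G.Comp_Ident_right[OF \<sigma>_hom[OF \<sigma>]] by auto
  have "Arrow \<sigma> (Ident G (Dom G \<sigma>)) \<sigma> \<in> Arr (slice G S)"
    using id \<sigma> by (simp add: slice_def)
  moreover have "(\<lambda>i \<in> verts I. comparison \<sigma> \<sigma> (Ident G (Dom G \<sigma>)) i) =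
    (\<lambda>i \<in> verts I. Ident G (on_verts (src (family \<sigma>)) i))"
    using comparison[OF \<sigma> \<sigma> id] family_simps[OF \<sigma>] G.Comp_Ident_right[OF proj_hom[OF \<sigma>]]
      G.Comp_Ident_right[OF leg_hom[OF \<sigma>]] G.Comp_Ident_left[OF leg_hom[OF \<sigma>]]
    by (intro into_family_eqI[OF \<sigma> comparison_nat_trans[OF \<sigma> \<sigma> id]
          nat_trans_Ident[OF category wf family_diagram[OF \<sigma>]]]) auto
  ultimately show "on_arcs pullback (Ident (slice G S) \<sigma>) =
      Ident (cartesian_slice I G D) (on_verts pullback \<sigma>)"
    using \<sigma> by (simp add: pullback_on_arcs pullback_on_verts cartesian_slice_def diagram_category_def)
next
  fix \<phi> \<psi> \<sigma> \<sigma>' \<sigma>''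
  assume \<phi>: "\<phi> \<in> hom_set (slice G S) \<sigma> \<sigma>'" and \<psi>: "\<psi> \<in> hom_set (slice G S) \<sigma>' \<sigma>''"
  obtain f where f: "\<phi> = Arrow \<sigma> f \<sigma>'" and \<sigma>: "\<sigma> \<in> Arr G" "Cod G \<sigma> = S"
    and \<sigma>': "\<sigma>' \<in> Arr G" "Cod G \<sigma>' = S"
    and f': "f \<in> hom_set G (Dom G \<sigma>) (Dom G \<sigma>')" "\<sigma>' \<odot> f = \<sigma>"
    using \<phi> by (auto simp: hom_set_slice)
  obtain g where g: "\<psi> = Arrow \<sigma>' g \<sigma>''" and \<sigma>'': "\<sigma>'' \<in> Arr G" "Cod G \<sigma>'' = S"
    and g': "g \<in> hom_set G (Dom G \<sigma>') (Dom G \<sigma>'')" "\<sigma>'' \<odot> g = \<sigma>'"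
    using \<psi> by (auto simp: hom_set_slice)
  interpret slice: category "slice G S" by (rule category_slice[OF category])
  have gf: "Arrow \<sigma> (g \<odot> f) \<sigma>'' \<in> hom_set (slice G S) \<sigma> \<sigma>''"
    using slice.Comp_hom[OF \<phi> \<psi>] by (simp add: f g)
  then have gf': "g \<odot> f \<in> hom_set G (Dom G \<sigma>) (Dom G \<sigma>'')" "\<sigma>'' \<odot> (g \<odot> f) = \<sigma>"
    by (auto simp: hom_set_slice)
  let ?F = "comparison \<sigma> \<sigma>' f" and ?G = "comparison \<sigma>' \<sigma>'' g"
  have "(\<lambda>i \<in> verts I. comparison \<sigma> \<sigma>'' (g \<odot> f) i) =
    (\<lambda>i \<in> verts I. (\<lambda>i \<in> verts I. ?G i) i \<odot> (\<lambda>i \<in> verts I. ?F i) i)"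
  proof (rule into_family_eqI[OF \<sigma>'' comparison_nat_trans[OF \<sigma> \<sigma>'' gf'] nat_trans_Comp[OF category wf
          family_diagram[OF \<sigma>] family_diagram[OF \<sigma>'] family_diagram[OF \<sigma>'']
          comparison_nat_trans[OF \<sigma> \<sigma>' f'] comparison_nat_trans[OF \<sigma>' \<sigma>'' g']]])
    fix i assume i: "i \<in> verts I"
    note c = comparison[OF \<sigma> \<sigma>' f' i] comparison[OF \<sigma>' \<sigma>'' g' i] comparison[OF \<sigma> \<sigma>'' gf' i]
    show "proj \<sigma>'' i \<odot> (\<lambda>i \<in> verts I. comparison \<sigma> \<sigma>'' (g \<odot> f) i) i =
      proj \<sigma>'' i \<odot> (\<lambda>i \<in> verts I. (\<lambda>i \<in> verts I. ?G i) i \<odot> (\<lambda>i \<in> verts I. ?F i) i) i"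
      using c i G.Comp_assoc[OF c(1) c(4) proj_hom[OF \<sigma>'' i]] by simp
    show "leg \<sigma>'' i \<odot> (\<lambda>i \<in> verts I. comparison \<sigma> \<sigma>'' (g \<odot> f) i) i =
      leg \<sigma>'' i \<odot> (\<lambda>i \<in> verts I. (\<lambda>i \<in> verts I. ?G i) i \<odot> (\<lambda>i \<in> verts I. ?F i) i) i"
      using c i G.Comp_assoc[OF c(1) c(4) leg_hom[OF \<sigma>'' i]]
        G.Comp_assoc[OF c(1) leg_hom[OF \<sigma>' i] g'(1)] G.Comp_assoc[OF leg_hom[OF \<sigma> i] f'(1) g'(1)]
      by simp
  qed
  then show "on_arcs pullback (\<psi> \<odot>\<^bsub>slice G S\<^esub> \<phi>) =
      on_arcs pullback \<psi> \<odot>\<^bsub>cartesian_slice I G D\<^esub> on_arcs pullback \<phi>"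
    using \<phi> \<psi> gf unfolding f g
    by (simp add: pullback_on_arcs cartesian_slice_def hom_set_iff diagram_category_def)
qed

text \<open>
  If the colimit is stable under pullback, arrows out of the domain of \<open>\<sigma>\<close> are the same as cocones
  on its pullback family. A morphism of pullback families, followed by the legs of the second one,
  is such a cocone and so descends to a unique arrow; uniqueness also shows that this arrow lies
  over \<open>S\<close>.
\<close>

lemma pullback_fully_faithful:
  assumes stable: "\<And>\<sigma>. \<sigma> \<in> Arr G \<Longrightarrow> Cod G \<sigma> = S \<Longrightarrow>
      colimiting_cocone I G (src (family \<sigma>)) (Dom G \<sigma>) (\<lambda>i \<in> verts I. leg \<sigma> i)"
    and o: "\<sigma> \<in> Obj (slice G S)" "\<sigma>' \<in> Obj (slice G S)"
  shows "bij_betw (on_arcs pullback) (hom_set (slice G S) \<sigma> \<sigma>')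
    (hom_set (cartesian_slice I G D) (on_verts pullback \<sigma>) (on_verts pullback \<sigma>'))"
proof -
  have \<sigma>: "\<sigma> \<in> Arr G" "Cod G \<sigma> = S" and \<sigma>': "\<sigma>' \<in> Arr G" "Cod G \<sigma>' = S" using o by auto
  have uniq: "u = v" if "u \<in> hom_set G (Dom G \<sigma>) T" "v \<in> hom_set G (Dom G \<sigma>) T"
    "\<And>i. i \<in> verts I \<Longrightarrow> u \<odot> leg \<sigma> i = v \<odot> leg \<sigma> i" for u v T
    using that(3) by (intro colimiting_eqI[OF category wf stable[OF \<sigma>] that(1,2)]) simp
  have "inj_on (on_arcs pullback) (hom_set (slice G S) \<sigma> \<sigma>')"
  proof (rule inj_onI)
    fix \<phi> \<psi> assume \<phi>: "\<phi> \<in> hom_set (slice G S) \<sigma> \<sigma>'" and \<psi>: "\<psi> \<in> hom_set (slice G S) \<sigma> \<sigma>'"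
      and eq: "on_arcs pullback \<phi> = on_arcs pullback \<psi>"
    obtain f where f: "\<phi> = Arrow \<sigma> f \<sigma>'" "f \<in> hom_set G (Dom G \<sigma>) (Dom G \<sigma>')" "\<sigma>' \<odot> f = \<sigma>"
      using \<phi> by (auto simp: hom_set_slice)
    obtain g where g: "\<psi> = Arrow \<sigma> g \<sigma>'" "g \<in> hom_set G (Dom G \<sigma>) (Dom G \<sigma>')" "\<sigma>' \<odot> g = \<sigma>"
      using \<psi> by (auto simp: hom_set_slice)
    have *: "(\<lambda>i \<in> verts I. comparison \<sigma> \<sigma>' f i) = (\<lambda>i \<in> verts I. comparison \<sigma> \<sigma>' g i)"
      using eq \<phi> \<psi> unfolding f(1) g(1) by (simp add: pullback_on_arcs hom_set_iff)
    have "f \<odot> leg \<sigma> i = g \<odot> leg \<sigma> i" if i: "i \<in> verts I" for i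
      using fun_cong[OF *, of i] comparison(3)[OF \<sigma> \<sigma>' f(2,3) i] comparison(3)[OF \<sigma> \<sigma>' g(2,3) i] i
      by simp
    then show "\<phi> = \<psi>" using uniq[OF f(2) g(2)] f(1) g(1) by simp
  qed
  moreover have "\<exists>\<phi> \<in> hom_set (slice G S) \<sigma> \<sigma>'. on_arcs pullback \<phi> = \<chi>"
    if \<chi>_hom: "\<chi> \<in> hom_set (cartesian_slice I G D) (family \<sigma>) (family \<sigma>')" for \<chi>
  proof -
    obtain h where \<chi>: "\<chi> = Arrow (family \<sigma>) (Arrow (src (family \<sigma>)) h (src (family \<sigma>'))) (family \<sigma>')"
      and h: "nat_trans I G (src (family \<sigma>)) (src (family \<sigma>')) h"
      and "\<forall>i \<in> verts I. val (family \<sigma>') i \<odot> h i = val (family \<sigma>) i"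
      using \<chi>_hom[unfolded hom_set_cartesian_slice[OF category wf]] by blast
    then have ph: "proj \<sigma>' i \<odot> h i = proj \<sigma> i" if "i \<in> verts I" for i
      using that by (auto simp: family_simps[OF \<sigma>] family_simps[OF \<sigma>'])
    have hh: "h i \<in> hom_set G (Dom G (proj \<sigma> i)) (Dom G (proj \<sigma>' i))" if "i \<in> verts I" for i
      using nat_trans_hom[OF h that] that by (simp add: family_simps[OF \<sigma>] family_simps[OF \<sigma>'])
    obtain f where f: "f \<in> hom_set G (Dom G \<sigma>) (Dom G \<sigma>')"
      and fl': "\<And>i. i \<in> verts I \<Longrightarrow> f \<odot> (\<lambda>i \<in> verts I. leg \<sigma> i) i =
        (\<lambda>i \<in> verts I. (\<lambda>i \<in> verts I. leg \<sigma>' i) i \<odot> h i) i"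
      using colimiting_factor[OF stable[OF \<sigma>] cocone_nat_trans[OF category wf family_diagram[OF \<sigma>] h
            leg_cocone[OF \<sigma>']]] by blast
    have fl: "f \<odot> leg \<sigma> i = leg \<sigma>' i \<odot> h i" if "i \<in> verts I" for i
      using fl'[OF that] that by simp
    have f\<sigma>: "\<sigma>' \<odot> f = \<sigma>"
    proof (rule uniq[OF G.Comp_hom[OF f \<sigma>_hom[OF \<sigma>']] \<sigma>_hom[OF \<sigma>]])
      fix i assume i: "i \<in> verts I"
      show "(\<sigma>' \<odot> f) \<odot> leg \<sigma> i = \<sigma> \<odot> leg \<sigma> i"
        using G.Comp_assoc[OF leg_hom[OF \<sigma> i] f \<sigma>_hom[OF \<sigma>']] fl[OF i]
          G.Comp_assoc[OF hh[OF i] leg_hom[OF \<sigma>' i] \<sigma>_hom[OF \<sigma>']] square_commutes[OF \<sigma>' i]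
          G.Comp_assoc[OF hh[OF i] proj_hom[OF \<sigma>' i] kappa_hom[OF i]] ph[OF i]
          square_commutes[OF \<sigma> i] by simp
    qed
    have *: "(\<lambda>i \<in> verts I. comparison \<sigma> \<sigma>' f i) = h"
      using comparison[OF \<sigma> \<sigma>' f f\<sigma>] ph fl
      by (intro into_family_eqI[OF \<sigma>' comparison_nat_trans[OF \<sigma> \<sigma>' f f\<sigma>] h]) auto
    have "Arrow \<sigma> f \<sigma>' \<in> hom_set (slice G S) \<sigma> \<sigma>'"
      using \<sigma> \<sigma>' f f\<sigma> by (simp add: hom_set_slice)
    then show ?thesis
      by (intro bexI[of _ "Arrow \<sigma> f \<sigma>'"]) (auto simp: pullback_on_arcs hom_set_iff * \<chi>)
  qed
  moreover have "on_arcs pullback \<phi> \<in> hom_set (cartesian_slice I G D) (family \<sigma>) (family \<sigma>')"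
    if "\<phi> \<in> hom_set (slice G S) \<sigma> \<sigma>'" for \<phi>
    using pullback_arrow_hom[OF that] .
  ultimately show ?thesis
    unfolding bij_betw_def pullback_on_verts[OF \<sigma>] pullback_on_verts[OF \<sigma>'] by blast
qed

text \<open>Pullbacks are unique up to isomorphism, here for a whole family of them.\<close>

lemma isomorphic_pullback_family:
  assumes \<sigma>: "\<sigma> \<in> Arr G" "Cod G \<sigma> = S"
    and E: "Arrow E \<tau> D \<in> Obj (cartesian_slice I G D)"
    and cc: "cocone I G E (Dom G \<sigma>) \<rho>"
    and sq: "\<And>i. i \<in> verts I \<Longrightarrow> is_pullback G (\<kappa> i) \<sigma> (\<tau> i) (\<rho> i)"
  shows "isomorphic_in (cartesian_slice I G D) (on_verts pullback \<sigma>) (Arrow E \<tau> D)"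
proof -
  have E': "diagram I G E" and \<tau>: "nat_trans I G E D \<tau>"
    using E by (auto simp: Obj_cartesian_slice)
  have k: "Dom G (\<kappa> i) = on_verts D i" "Dom G (\<tau> i) = on_verts E i" if "i \<in> verts I" for i
    using kappa_hom[OF that] nat_trans_hom[OF \<tau> that] by (auto simp: hom_set_iff)
  define h where "h = (\<lambda>i \<in> verts I. into_pullback G (proj \<sigma> i) (leg \<sigma> i) (\<tau> i) (\<rho> i))"
  have h_ext: "h \<in> extensional (verts I)" by (simp add: h_def)
  define h' where "h' = (\<lambda>i \<in> verts I. into_pullback G (\<tau> i) (\<rho> i) (proj \<sigma> i) (leg \<sigma> i))"
  have h'_ext: "h' \<in> extensional (verts I)" by (simp add: h'_def)
  have h: "h i \<in> hom_set G (on_verts E i) (Dom G (proj \<sigma> i))"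
    "proj \<sigma> i \<odot> h i = \<tau> i" "leg \<sigma> i \<odot> h i = \<rho> i" if i: "i \<in> verts I" for i
    using into_pullback[OF pullback_square[OF \<sigma> i] category, of "\<tau> i" "on_verts E i" "\<rho> i"]
      pullback_hom[OF sq[OF i]] k[OF i] i by (auto simp: h_def)
  have h': "h' i \<in> hom_set G (Dom G (proj \<sigma> i)) (on_verts E i)"
    "\<tau> i \<odot> h' i = proj \<sigma> i" "\<rho> i \<odot> h' i = leg \<sigma> i" if i: "i \<in> verts I" for i
    using into_pullback[OF sq[OF i] category, of "proj \<sigma> i" "Dom G (proj \<sigma> i)" "leg \<sigma> i"]
      pullback_hom[OF pullback_square[OF \<sigma> i]] k[OF i] i by (auto simp: h'_def)
  have hh': "h i \<odot> h' i = Ident G (Dom G (proj \<sigma> i))" if i: "i \<in> verts I" for i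
    using h[OF i] h'[OF i] G.Comp_assoc[OF h'(1)[OF i] h(1)[OF i] proj_hom[OF \<sigma> i]]
      G.Comp_assoc[OF h'(1)[OF i] h(1)[OF i] leg_hom[OF \<sigma> i]]
      G.Comp_Ident_right[OF proj_hom[OF \<sigma> i]] G.Comp_Ident_right[OF leg_hom[OF \<sigma> i]]
    by (intro pullback_jointly_monic[OF pullback_square[OF \<sigma> i] category
          G.Comp_hom[OF h'(1)[OF i] h(1)[OF i]] G.Ident_hom[OF G.hom_set_Obj(1)[OF proj_hom[OF \<sigma> i]]]])
      auto
  have \<tau>i: "\<tau> i \<in> hom_set G (on_verts E i) (on_verts D i)" if "i \<in> verts I" for i
    using nat_trans_hom[OF \<tau> that] .
  have \<rho>i: "\<rho> i \<in> hom_set G (on_verts E i) (Dom G \<sigma>)" if "i \<in> verts I" for i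
    using cocone_hom[OF cc that] .
  have h'h: "h' i \<odot> h i = Ident G (on_verts E i)" if i: "i \<in> verts I" for i
    using h[OF i] h'[OF i] G.Comp_assoc[OF h(1)[OF i] h'(1)[OF i] \<tau>i[OF i]]
      G.Comp_assoc[OF h(1)[OF i] h'(1)[OF i] \<rho>i[OF i]]
      G.Comp_Ident_right[OF \<tau>i[OF i]] G.Comp_Ident_right[OF \<rho>i[OF i]]
    by (intro pullback_jointly_monic[OF sq[OF i] category, unfolded k[OF i],
          OF G.Comp_hom[OF h(1)[OF i] h'(1)[OF i]] G.Ident_hom[OF G.hom_set_Obj(1)[OF \<tau>i[OF i]]]])
      auto
  have nh: "nat_trans I G E (src (family \<sigma>)) h"
  proof (rule nat_trans_into_family[OF \<sigma> E' \<tau> h_ext h(1,2)])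
    fix d assume d: "d \<in> arcs I"
    have v: "tail I d \<in> verts I" "head I d \<in> verts I" using d by auto
    show "(leg \<sigma> (head I d) \<odot> h (head I d)) \<odot> on_arcs E d = leg \<sigma> (tail I d) \<odot> h (tail I d)"
      using h(3)[OF v(1)] h(3)[OF v(2)] cocone_natural[OF category wf cc d] by simp
  qed
  have nh': "nat_trans I G (src (family \<sigma>)) E h'"
    using h'(1) hh' h'h h'_ext
    by (intro nat_trans_inverse[OF category wf family_diagram[OF \<sigma>] E' nh]) (auto simp: family_simps[OF \<sigma>])
  let ?h = "Arrow (Arrow E \<tau> D) (Arrow E h (src (family \<sigma>))) (family \<sigma>)"
  let ?h' = "Arrow (family \<sigma>) (Arrow (src (family \<sigma>)) h' E) (Arrow E \<tau> D)"
  have "?h \<in> hom_set (cartesian_slice I G D) (Arrow E \<tau> D) (family \<sigma>)"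
    "?h' \<in> hom_set (cartesian_slice I G D) (family \<sigma>) (Arrow E \<tau> D)"
    using E nh nh' family_Obj[OF \<sigma>] h(2) h'(2)
    by (auto simp: hom_set_cartesian_slice[OF category wf] family_simps[OF \<sigma>])
  moreover have "?h \<odot>\<^bsub>cartesian_slice I G D\<^esub> ?h' = Ident (cartesian_slice I G D) (family \<sigma>)"
    "?h' \<odot>\<^bsub>cartesian_slice I G D\<^esub> ?h = Ident (cartesian_slice I G D) (Arrow E \<tau> D)"
    using hh' h'h by (auto simp: cartesian_slice_def family_simps[OF \<sigma>] diagram_category_def intro!: restrict_ext)
  ultimately show ?thesis
    unfolding isomorphic_in_def pullback_on_verts[OF \<sigma>] by blast
qed

lemma van_kampen_cocone_iff_equivalence:
  "van_kampen_cocone I G pb D S \<kappa> \<longleftrightarrow>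
    equivalence_functor (slice G S) (cartesian_slice I G D) pullback"
  using cocone by (simp add: van_kampen_cocone_def)

end

section \<open>Small sets\<close>

locale universe =
  fixes U :: "'u set set"
  assumes universe: "set_universe U"
begin

lemma universe_lepoll: "A \<in> U \<Longrightarrow> C \<lesssim> A \<Longrightarrow> C \<in> U"
  using universe by (auto simp: set_universe_def)

lemma universe_UN: "A \<in> U \<Longrightarrow> (\<And>a. a \<in> A \<Longrightarrow> F a \<in> U) \<Longrightarrow> (\<Union>a \<in> A. F a) \<in> U"
  using universe by (auto simp: set_universe_def)

lemma universe_infinite: "\<exists>A \<in> U. infinite A"
  using universe by (auto simp: set_universe_def)

text \<open>
  A binary union is a union indexed by an infinite member of the universe, one index of which
  selects the first set and all others the second.
\<close>

lemma universe_Un: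
  assumes "A \<in> U" "C \<in> U" shows "A \<union> C \<in> U"
proof -
  obtain V where V: "V \<in> U" "infinite V" using universe_infinite by blast
  then obtain v w where v: "v \<in> V" "w \<in> V" "v \<noteq> w"
    by (metis finite.emptyI finite_insert insertI1 is_singletonI' is_singleton_the_elem all_not_in_conv)
  have "(\<Union>x \<in> V. if x = v then A else C) = A \<union> C"
    using v by (auto split: if_splits)
  then show ?thesis
    using universe_UN[OF V(1), of "\<lambda>x. if x = v then A else C"] assms by simp
qed

lemma small_lepoll:
  assumes "small U A" "C \<lesssim> A" shows "small U C"
proof -
  obtain V where V: "V \<in> U" "A \<approx> V" using assms(1) by (auto simp: small_def)
  then have "C \<lesssim> V" using assms(2) lepoll_trans2 by blast
  then obtain f where "inj_on f C" "f ` C \<subseteq> V" by (auto simp: lepoll_def)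
  then have "f ` C \<subseteq> V" "C \<approx> f ` C"
    by (auto intro: inj_on_image_eqpoll_self[THEN eqpoll_sym])
  then show ?thesis
    unfolding small_def using universe_lepoll[OF V(1)] subset_imp_lepoll by blast
qed

lemma small_universe: "A \<in> U \<Longrightarrow> small U A"
  by (auto simp: small_def)

lemma small_subset: "small U A \<Longrightarrow> C \<subseteq> A \<Longrightarrow> small U C"
  using small_lepoll subset_imp_lepoll by blast

lemma small_image: "small U A \<Longrightarrow> small U (f ` A)"
  using small_lepoll image_lepoll by blast

text \<open>An infinite set has the size of its square, so products of small sets are small.\<close>

lemma small_Times:
  assumes "small U A" "small U C" shows "small U (A \<times> C)"
proof -
  obtain V where V: "V \<in> U" "A \<approx> V" using assms(1) by (auto simp: small_def)
  obtain W where W: "W \<in> U" "C \<approx> W" using assms(2) by (auto simp: small_def)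
  obtain N where N: "N \<in> U" "infinite N" using universe_infinite by blast
  let ?Z = "V \<union> W \<union> N"
  have "A \<lesssim> ?Z"
    by (rule lepoll_trans[OF eqpoll_imp_lepoll[OF V(2)] subset_imp_lepoll]) auto
  moreover have "C \<lesssim> ?Z"
    by (rule lepoll_trans[OF eqpoll_imp_lepoll[OF W(2)] subset_imp_lepoll]) auto
  ultimately have AC: "A \<times> C \<lesssim> ?Z \<times> ?Z"
    by (rule times_lepoll_mono)
  have sq: "?Z \<times> ?Z \<lesssim> ?Z"
    using N(2) card_of_Times_same_infinite[of ?Z]
    by (intro eqpoll_imp_lepoll) (simp add: eqpoll_iff_card_of_ordIso)
  have "?Z \<in> U" using V W N by (simp add: universe_Un)
  then show ?thesis
    by (rule small_lepoll[OF small_universe lepoll_trans[OF AC sq]])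
qed

text \<open>
  The disjoint union embeds into the product of the index set with the union of copies of the
  summands in the universe.
\<close>

lemma small_Sigma:
  assumes A: "small U A" and F: "\<And>a. a \<in> A \<Longrightarrow> small U (F a)"
  shows "small U (Sigma A F)"
proof -
  obtain V where V: "V \<in> U" "A \<approx> V" using A by (auto simp: small_def)
  then obtain f where f: "bij_betw f V A" by (meson eqpoll_def eqpoll_sym)
  obtain W where W: "\<And>a. a \<in> A \<Longrightarrow> W a \<in> U \<and> F a \<approx> W a"
    using F unfolding small_def by metis
  then obtain e where e: "\<And>a. a \<in> A \<Longrightarrow> bij_betw (e a) (F a) (W a)"
    unfolding eqpoll_def by metis
  have "(\<Union>a \<in> A. W a) = (\<Union>x \<in> V. W (f x))" using f by (auto simp: bij_betw_def)
  also have "\<dots> \<in> U" using W f by (intro universe_UN V(1)) (auto simp: bij_betw_def)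
  finally have "small U (A \<times> (\<Union>a \<in> A. W a))" by (intro small_Times A small_universe)
  moreover have "Sigma A F \<lesssim> A \<times> (\<Union>a \<in> A. W a)"
    unfolding lepoll_def
  proof (intro exI conjI)
    show "inj_on (\<lambda>(a, x). (a, e a x)) (Sigma A F)"
      using e by (auto simp: inj_on_def bij_betw_def)
    show "(\<lambda>(a, x). (a, e a x)) ` Sigma A F \<subseteq> A \<times> (\<Union>a \<in> A. W a)"
      using e by (auto simp: bij_betw_def)
  qed
  ultimately show ?thesis by (rule small_lepoll)
qed

text \<open>
  A formal combination is determined by the finite set of its nonzero coefficients together with
  their indices, and an infinite set has only as many finite subsets as it has elements.
\<close>

lemma small_frag:
  assumes "small U A" shows "small U {c :: 'x \<Rightarrow>\<^sub>0 int. Poly_Mapping.keys c \<subseteq> A}"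
proof -
  obtain V where V: "V \<in> U" "A \<approx> V" using assms by (auto simp: small_def)
  obtain N where N: "N \<in> U" "infinite N" using universe_infinite by blast
  then obtain s :: "nat \<Rightarrow> 'u" where s: "inj s" "range s \<subseteq> N"
    using infinite_countable_subset by blast
  have nat: "small U (UNIV :: nat set)"
    using small_lepoll[OF small_universe[OF N(1)]] s unfolding lepoll_def by blast
  have int: "small U (UNIV :: int set)"
    by (rule small_lepoll[OF nat]) (auto simp: lepoll_def intro: inj_to_nat)
  have "{c :: 'x \<Rightarrow>\<^sub>0 int. Poly_Mapping.keys c \<subseteq> A} \<lesssim> Fpow (A \<times> (UNIV :: int set))"
    unfolding lepoll_def
  proof (intro exI conjI)
    let ?g = "\<lambda>c :: 'x \<Rightarrow>\<^sub>0 int. (\<lambda>x. (x, Poly_Mapping.lookup c x)) ` Poly_Mapping.keys c"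
    show "?g ` {c. Poly_Mapping.keys c \<subseteq> A} \<subseteq> Fpow (A \<times> UNIV)"
      by (auto simp: Fpow_def)
    show "inj_on ?g {c. Poly_Mapping.keys c \<subseteq> A}"
    proof (rule inj_onI, rule poly_mapping_eqI)
      fix c c' :: "'x \<Rightarrow>\<^sub>0 int" and x assume eq: "?g c = ?g c'"
      have k: "Poly_Mapping.keys c = Poly_Mapping.keys c'"
        using arg_cong[OF eq, of "image fst"] by (simp add: image_image)
      show "Poly_Mapping.lookup c x = Poly_Mapping.lookup c' x"
      proof (cases "x \<in> Poly_Mapping.keys c")
        case True
        then have "(x, Poly_Mapping.lookup c x) \<in> ?g c'" using eq by blast
        then show ?thesis by auto
      next
        case False
        then show ?thesis using k by (metis in_keys_iff)
      qed
    qed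
  qed
  moreover have "small U (Fpow (A \<times> (UNIV :: int set)))"
  proof (cases "A = {}")
    case True
    then show ?thesis
      by (intro small_subset[OF small_image[OF nat, of "\<lambda>_. {}"]]) (auto simp: Fpow_def)
  next
    case False
    then have "infinite (A \<times> (UNIV :: int set))"
      by (simp add: finite_cartesian_product_iff infinite_UNIV_int)
    then show ?thesis
      by (intro small_lepoll[OF small_Times[OF assms int]] eqpoll_imp_lepoll eqpoll_Fpow)
  qed
  ultimately show ?thesis using small_lepoll by metis
qed

end

section \<open>Presheaves in terms of elements\<close>

definition act :: "('o, 'a, 'u) presheaf \<Rightarrow> 'a \<Rightarrow> 'u \<Rightarrow> 'u" where
  "act F f = val (on_arcs F f)"

definition component :: "('o, 'a, 'u) presheaf_arrow \<Rightarrow> 'o \<Rightarrow> 'u \<Rightarrow> 'u" where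
  "component \<alpha> X = val (val \<alpha> X)"

lemma map_at_component: "map_at D d X = component (on_arcs D d) X"
  by (simp add: map_at_def component_def)

lemma set_category_simps [simp]:
  "Obj (set_category U) = U"
  "Dom (set_category U) = src"
  "Cod (set_category U) = trg"
  "Ident (set_category U) = (\<lambda>A. Arrow A (\<lambda>x \<in> A. x) A)"
  "Comp (set_category U) = (\<lambda>g f. Arrow (src f) (compose (src f) (val g) (val f)) (trg g))"
  by (simp_all add: set_category_def)

lemma hom_set_set_category:
  "\<alpha> \<in> hom_set (set_category U) A C \<longleftrightarrow> (\<exists>f. \<alpha> = Arrow A f C \<and> A \<in> U \<and> C \<in> U \<and> f \<in> A \<rightarrow>\<^sub>E C)"
  by (auto simp: hom_set_def set_category_def)

lemma category_set_category: "category (set_category U)"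
proof
  fix f assume "f \<in> Arr (set_category U)"
  then show "Dom (set_category U) f \<in> Obj (set_category U)" "Cod (set_category U) f \<in> Obj (set_category U)"
    by (auto simp: set_category_def)
next
  fix f g w x y h z
  assume "f \<in> hom_set (set_category U) w x" "g \<in> hom_set (set_category U) x y"
    "h \<in> hom_set (set_category U) y z"
  then show "(h \<odot>\<^bsub>set_category U\<^esub> g) \<odot>\<^bsub>set_category U\<^esub> f = h \<odot>\<^bsub>set_category U\<^esub> g \<odot>\<^bsub>set_category U\<^esub> f"
    by (auto simp: hom_set_set_category intro!: compose_assoc[symmetric])
next
  fix f x y assume "f \<in> hom_set (set_category U) x y"
  then obtain g where f: "f = Arrow x g y" "g \<in> x \<rightarrow>\<^sub>E y"
    by (auto simp: hom_set_set_category)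
  have "compose x g (\<lambda>u \<in> x. u) = g" "compose x (\<lambda>u \<in> y. u) g = g"
    using f(2) by (auto simp: PiE_def intro: compose_Id Id_compose)
  then show "f \<odot>\<^bsub>set_category U\<^esub> Ident (set_category U) x = f"
    "Ident (set_category U) y \<odot>\<^bsub>set_category U\<^esub> f = f"
    by (auto simp: f(1))
qed (auto simp: hom_set_set_category compose_def PiE_def extensional_def)

locale presheaf_setting = universe U + B: category B
  for U :: "'u set set" and B :: "('o, 'a) category" +
  assumes small_Arr: "small U (Arr B)"
begin

abbreviation PSh where "PSh \<equiv> presheaves U B"

lemma category_PSh: "category PSh"
  by (intro category_functor_category B.category_axioms category_set_category)

lemma presheaf_set: "F \<in> Obj PSh \<Longrightarrow> X \<in> Obj B \<Longrightarrow> on_verts F X \<in> U"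
  using is_functor_Obj by fastforce

lemma presheaf_arc:
  assumes F: "F \<in> Obj PSh" and f: "f \<in> hom_set B X Y"
  shows "on_arcs F f = Arrow (on_verts F X) (act F f) (on_verts F Y)"
    and "act F f \<in> on_verts F X \<rightarrow>\<^sub>E on_verts F Y"
  using is_functor_hom[of B "set_category U" F f X Y] F f
  by (auto simp: act_def hom_set_set_category)

lemma act_closed:
  assumes "F \<in> Obj PSh" "f \<in> hom_set B X Y" "x \<in> on_verts F X"
  shows "act F f x \<in> on_verts F Y"
  using presheaf_arc(2)[OF assms(1,2)] assms(3) by auto

lemma act_Ident:
  assumes "F \<in> Obj PSh" "X \<in> Obj B" "x \<in> on_verts F X"
  shows "act F (Ident B X) x = x"
  using is_functor_Ident[of B "set_category U" F X] assms by (simp add: act_def)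

lemma act_Comp:
  assumes F: "F \<in> Obj PSh" and f: "f \<in> hom_set B X Y" "g \<in> hom_set B Y Z" and x: "x \<in> on_verts F X"
  shows "act F (g \<odot>\<^bsub>B\<^esub> f) x = act F g (act F f x)"
proof -
  have "src (on_arcs F f) = on_verts F X" by (simp add: presheaf_arc(1)[OF F f(1)])
  then show ?thesis
    using is_functor_Comp[of B "set_category U" F f X Y g Z] assms
    by (simp add: act_def compose_def)
qed

lemma hom_PSh_iff:
  "\<alpha> \<in> hom_set PSh F F' \<longleftrightarrow>
    (\<exists>\<tau>. \<alpha> = Arrow F \<tau> F' \<and> F \<in> Obj PSh \<and> F' \<in> Obj PSh \<and>
      nat_trans (underlying_graph B) (set_category U) F F' \<tau>)"
  by (simp add: hom_set_functor_category)

lemma component_closed: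
  assumes "\<alpha> \<in> hom_set PSh F F'" "X \<in> Obj B" "x \<in> on_verts F X"
  shows "component \<alpha> X x \<in> on_verts F' X"
proof -
  obtain \<tau> where "\<alpha> = Arrow F \<tau> F'" "nat_trans (underlying_graph B) (set_category U) F F' \<tau>"
    using assms(1) by (auto simp: hom_PSh_iff)
  then show ?thesis
    using nat_trans_hom[of "underlying_graph B" "set_category U" F F' \<tau> X] assms(2,3)
    by (auto simp: component_def hom_set_set_category)
qed

lemma component_natural:
  assumes \<alpha>: "\<alpha> \<in> hom_set PSh F F'" and f: "f \<in> hom_set B X Y" and x: "x \<in> on_verts F X"
  shows "component \<alpha> Y (act F f x) = act F' f (component \<alpha> X x)"
proof -
  obtain \<tau> where \<tau>: "\<alpha> = Arrow F \<tau> F'" "nat_trans (underlying_graph B) (set_category U) F F' \<tau>"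
    and F: "F \<in> Obj PSh" "F' \<in> Obj PSh"
    using \<alpha> by (auto simp: hom_PSh_iff)
  have o: "X \<in> Obj B" "Y \<in> Obj B" using B.hom_set_Obj[OF f] by auto
  have a: "f \<in> Arr B" "Dom B f = X" "Cod B f = Y" using f by (auto simp: hom_set_iff)
  have s: "src (\<tau> X) = on_verts F X"
    using nat_trans_hom[OF \<tau>(2), of X] o by (auto simp: hom_set_set_category)
  show ?thesis
    using arg_cong[OF nat_trans_natural[OF \<tau>(2), of f], of "\<lambda>\<alpha>. val \<alpha> x"] a x s
      presheaf_arc(1)[OF F(1) f] presheaf_arc(1)[OF F(2) f]
    by (simp add: \<tau>(1) component_def compose_def)
qed

lemma hom_PSh_eqI:
  assumes \<alpha>: "\<alpha> \<in> hom_set PSh F F'" and \<beta>: "\<beta> \<in> hom_set PSh F F'"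
    and eq: "\<And>X x. X \<in> Obj B \<Longrightarrow> x \<in> on_verts F X \<Longrightarrow> component \<alpha> X x = component \<beta> X x"
  shows "\<alpha> = \<beta>"
proof -
  obtain \<tau> where \<tau>: "\<alpha> = Arrow F \<tau> F'" "nat_trans (underlying_graph B) (set_category U) F F' \<tau>"
    using \<alpha> by (auto simp: hom_PSh_iff)
  obtain \<rho> where \<rho>: "\<beta> = Arrow F \<rho> F'" "nat_trans (underlying_graph B) (set_category U) F F' \<rho>"
    using \<beta> by (auto simp: hom_PSh_iff)
  have "\<tau> X = \<rho> X" if "X \<in> Obj B" for X
    using nat_trans_hom[OF \<tau>(2), of X] nat_trans_hom[OF \<rho>(2), of X] eq[of X] that
    by (auto simp: hom_set_set_category component_def \<tau>(1) \<rho>(1) intro!: PiE_ext)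
  then show ?thesis
    using nat_trans_ext[OF \<tau>(2) \<rho>(2)] by (simp add: \<tau>(1) \<rho>(1))
qed

lemma component_Comp:
  assumes \<alpha>: "\<alpha> \<in> hom_set PSh F F'" and \<beta>: "\<beta> \<in> hom_set PSh F' F''"
    and x: "X \<in> Obj B" "x \<in> on_verts F X"
  shows "component (\<beta> \<odot>\<^bsub>PSh\<^esub> \<alpha>) X x = component \<beta> X (component \<alpha> X x)"
proof -
  obtain \<tau> where \<tau>: "\<alpha> = Arrow F \<tau> F'" "nat_trans (underlying_graph B) (set_category U) F F' \<tau>"
    using \<alpha> by (auto simp: hom_PSh_iff)
  have "src (\<tau> X) = on_verts F X"
    using nat_trans_hom[OF \<tau>(2), of X] x by (auto simp: hom_set_set_category)
  then show ?thesis
    using x by (simp add: \<tau>(1) component_def compose_def functor_category_Comp)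
qed

lemma component_Ident:
  "X \<in> Obj B \<Longrightarrow> x \<in> on_verts F X \<Longrightarrow> component (Ident PSh F) X x = x"
  by (simp add: component_def)

definition mk_arrow where
  "mk_arrow F F' t =
     Arrow F (\<lambda>X \<in> Obj B. Arrow (on_verts F X) (\<lambda>x \<in> on_verts F X. t X x) (on_verts F' X)) F'"

lemma component_mk_arrow:
  "X \<in> Obj B \<Longrightarrow> x \<in> on_verts F X \<Longrightarrow> component (mk_arrow F F' t) X x = t X x"
  by (simp add: mk_arrow_def component_def)

lemma mk_arrow_hom:
  assumes F: "F \<in> Obj PSh" "F' \<in> Obj PSh"
    and closed: "\<And>X x. X \<in> Obj B \<Longrightarrow> x \<in> on_verts F X \<Longrightarrow> t X x \<in> on_verts F' X"
    and natural: "\<And>f X Y x. f \<in> hom_set B X Y \<Longrightarrow> X \<in> Obj B \<Longrightarrow> Y \<in> Obj B \<Longrightarrow>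
      x \<in> on_verts F X \<Longrightarrow> t Y (act F f x) = act F' f (t X x)"
  shows "mk_arrow F F' t \<in> hom_set PSh F F'"
  unfolding hom_PSh_iff
proof (intro exI conjI)
  let ?\<tau> = "\<lambda>X \<in> Obj B. Arrow (on_verts F X) (\<lambda>x \<in> on_verts F X. t X x) (on_verts F' X)"
  show "mk_arrow F F' t = Arrow F ?\<tau> F'" by (simp add: mk_arrow_def)
  show "nat_trans (underlying_graph B) (set_category U) F F' ?\<tau>"
  proof (rule nat_transI)
    fix f assume "f \<in> arcs (underlying_graph B)"
    then obtain X Y where f: "f \<in> hom_set B X Y" and [simp]: "Dom B f = X" "Cod B f = Y"
      by (auto simp: hom_set_iff)
    have o: "X \<in> Obj B" "Y \<in> Obj B" using B.hom_set_Obj[OF f] by auto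
    show "?\<tau> (head (underlying_graph B) f) \<odot>\<^bsub>set_category U\<^esub> on_arcs F f =
       on_arcs F' f \<odot>\<^bsub>set_category U\<^esub> ?\<tau> (tail (underlying_graph B) f)"
      using o natural[OF f o] closed act_closed[OF F(1) f]
      by (auto simp: presheaf_arc(1)[OF F(1) f] presheaf_arc(1)[OF F(2) f] compose_def
          intro!: restrict_ext)
  next
    fix X assume "X \<in> verts (underlying_graph B)"
    then show "?\<tau> X \<in> hom_set (set_category U) (on_verts F X) (on_verts F' X)"
      using presheaf_set[OF F(1)] presheaf_set[OF F(2)] closed by (auto simp: hom_set_set_category)
  qed simp
qed (use F in simp_all)

text \<open>
  Representables, colimits and coverings are first built from sets of some convenient type, such as
  equivalence classes or pairs. Being small, these sets can be copied into the universe; \<open>c\<close> is the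
  copying bijection.
\<close>

lemma presheaf_exists:
  fixes P :: "'o \<Rightarrow> 'x set" and a :: "'a \<Rightarrow> 'x \<Rightarrow> 'x"
  assumes small: "\<And>X. X \<in> Obj B \<Longrightarrow> small U (P X)"
    and closed: "\<And>f X Y x. f \<in> hom_set B X Y \<Longrightarrow> x \<in> P X \<Longrightarrow> a f x \<in> P Y"
    and Ident: "\<And>X x. X \<in> Obj B \<Longrightarrow> x \<in> P X \<Longrightarrow> a (Ident B X) x = x"
    and Comp: "\<And>f g X Y Z x. f \<in> hom_set B X Y \<Longrightarrow> g \<in> hom_set B Y Z \<Longrightarrow> x \<in> P X \<Longrightarrow>
      a (g \<odot>\<^bsub>B\<^esub> f) x = a g (a f x)"
  shows "\<exists>F c. F \<in> Obj PSh \<and> (\<forall>X \<in> Obj B. bij_betw (c X) (P X) (on_verts F X)) \<and>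
    (\<forall>f X Y x. f \<in> hom_set B X Y \<longrightarrow> x \<in> P X \<longrightarrow> act F f (c X x) = c Y (a f x))"
proof -
  obtain W c where W: "\<And>X. X \<in> Obj B \<Longrightarrow> W X \<in> U" and c: "\<And>X. X \<in> Obj B \<Longrightarrow> bij_betw (c X) (P X) (W X)"
    using small unfolding small_def eqpoll_def by metis
  define i where "i X = the_inv_into (P X) (c X)" for X
  have i: "i X (c X x) = x" if "X \<in> Obj B" "x \<in> P X" for X x
    using c[OF that(1)] that(2) by (simp add: i_def bij_betw_def the_inv_into_f_f)
  have i': "i X y \<in> P X" "c X (i X y) = y" if "X \<in> Obj B" "y \<in> W X" for X y
    using c[OF that(1)] that(2)
    by (auto simp: i_def bij_betw_def the_inv_into_into f_the_inv_into_f)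
  have cW: "c X x \<in> W X" if "X \<in> Obj B" "x \<in> P X" for X x
    using c[OF that(1)] that(2) by (auto simp: bij_betw_def)
  define F where "F = \<lparr>on_verts = (\<lambda>X \<in> Obj B. W X),
    on_arcs = (\<lambda>f \<in> Arr B. Arrow (W (Dom B f))
      (\<lambda>y \<in> W (Dom B f). c (Cod B f) (a f (i (Dom B f) y))) (W (Cod B f)))\<rparr>"
  have Fv: "on_verts F X = W X" if "X \<in> Obj B" for X using that by (simp add: F_def)
  have Fa: "on_arcs F f = Arrow (W X) (\<lambda>y \<in> W X. c Y (a f (i X y))) (W Y)"
    if "f \<in> hom_set B X Y" for f X Y
    using that by (auto simp: F_def hom_set_iff)
  have Fc: "c Y (a f (i X y)) \<in> W Y" if "f \<in> hom_set B X Y" "y \<in> W X" for f X Y y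
    using that closed[OF that(1)] i' cW B.hom_set_Obj[OF that(1)] by simp
  have "is_functor B (set_category U) F"
  proof (rule is_functorI)
    fix f X Y assume f: "f \<in> hom_set B X Y"
    then show "on_arcs F f \<in> hom_set (set_category U) (on_verts F X) (on_verts F Y)"
      using B.hom_set_Obj[OF f] W Fc[OF f] by (auto simp: Fa Fv hom_set_set_category)
  next
    fix X assume X: "X \<in> Obj B"
    then show "on_arcs F (Ident B X) = Ident (set_category U) (on_verts F X)"
      using Ident i' by (auto simp: Fa[OF B.Ident_hom] Fv intro!: restrict_ext)
  next
    fix f g X Y Z assume f: "f \<in> hom_set B X Y" and g: "g \<in> hom_set B Y Z"
    have o: "X \<in> Obj B" "Y \<in> Obj B" "Z \<in> Obj B" using B.hom_set_Obj f g by auto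
    show "on_arcs F (g \<odot>\<^bsub>B\<^esub> f) = on_arcs F g \<odot>\<^bsub>set_category U\<^esub> on_arcs F f"
      using o Comp[OF f g] closed[OF f] i i' Fc[OF f]
      by (auto simp: Fa[OF f] Fa[OF g] Fa[OF B.Comp_hom[OF f g]] compose_def intro!: restrict_ext)
  qed (auto simp: F_def W)
  moreover have "act F f (c X x) = c Y (a f x)" if f: "f \<in> hom_set B X Y" and x: "x \<in> P X" for f X Y x
    using cW[OF _ x] i[OF _ x] B.hom_set_Obj[OF f] by (simp add: act_def Fa[OF f])
  ultimately show ?thesis
    using c by (intro exI[of _ F] exI[of _ c]) (auto simp: Fv)
qed

text \<open>
  By the Yoneda lemma the elements of a presheaf are its generalised elements on a representable
  presheaf. So the universal property of a pullback, tested on representables, says that the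
  pullback is computed elementwise.
\<close>

lemma representable_exists:
  assumes X: "X \<in> Obj B"
  shows "\<exists>R r. R \<in> Obj PSh \<and> r \<in> on_verts R X \<and>
    (\<forall>F \<in> Obj PSh. \<forall>x \<in> on_verts F X. \<exists>\<alpha> \<in> hom_set PSh R F. component \<alpha> X r = x) \<and>
    (\<forall>F \<alpha> \<beta>. \<alpha> \<in> hom_set PSh R F \<longrightarrow> \<beta> \<in> hom_set PSh R F \<longrightarrow>
       component \<alpha> X r = component \<beta> X r \<longrightarrow> \<alpha> = \<beta>)"
proof -
  have 1: "small U (hom_set B X Y)" for Y
    by (rule small_subset[OF small_Arr]) (auto simp: hom_set_def)
  have "\<exists>R c. R \<in> Obj PSh \<and> (\<forall>Y \<in> Obj B. bij_betw (c Y) (hom_set B X Y) (on_verts R Y)) \<and>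
    (\<forall>f Y Z h. f \<in> hom_set B Y Z \<longrightarrow> h \<in> hom_set B X Y \<longrightarrow> act R f (c Y h) = c Z (f \<odot>\<^bsub>B\<^esub> h))"
    by (rule presheaf_exists) (use 1 in \<open>auto intro: B.Comp_hom B.Comp_Ident_left B.Comp_assoc\<close>)
  then obtain R c where R: "R \<in> Obj PSh"
    and c: "\<And>Y. Y \<in> Obj B \<Longrightarrow> bij_betw (c Y) (hom_set B X Y) (on_verts R Y)"
    and act: "\<And>f Y Z h. f \<in> hom_set B Y Z \<Longrightarrow> h \<in> hom_set B X Y \<Longrightarrow> act R f (c Y h) = c Z (f \<odot>\<^bsub>B\<^esub> h)"
    by blast
  define r where "r = c X (Ident B X)"
  have r: "r \<in> on_verts R X"
    using c[OF X] B.Ident_hom[OF X] by (auto simp: r_def bij_betw_def)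
  define i where "i Y = the_inv_into (hom_set B X Y) (c Y)" for Y
  have i: "i Y (c Y h) = h" if "Y \<in> Obj B" "h \<in> hom_set B X Y" for Y h
    using c[OF that(1)] that(2) by (simp add: i_def bij_betw_def the_inv_into_f_f)
  have i': "i Y y \<in> hom_set B X Y" "c Y (i Y y) = y" if "Y \<in> Obj B" "y \<in> on_verts R Y" for Y y
    using c[OF that(1)] that(2)
    by (auto simp: i_def bij_betw_def the_inv_into_into f_the_inv_into_f)
  have gen: "y = act R (i Y y) r" if "Y \<in> Obj B" "y \<in> on_verts R Y" for Y y
    using act[OF i'(1)[OF that] B.Ident_hom[OF X]] i'[OF that] B.Comp_Ident_right
    by (simp add: r_def)
  have "\<exists>\<alpha> \<in> hom_set PSh R F. component \<alpha> X r = x" if F: "F \<in> Obj PSh" and x: "x \<in> on_verts F X" for F x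
  proof (intro bexI)
    let ?\<alpha> = "mk_arrow R F (\<lambda>Y y. act F (i Y y) x)"
    show "component ?\<alpha> X r = x"
      using X r x F i[OF X B.Ident_hom[OF X]] by (simp only: component_mk_arrow) (simp add: r_def act_Ident)
    show "?\<alpha> \<in> hom_set PSh R F"
    proof (rule mk_arrow_hom[OF R F])
      fix Y y assume Y: "Y \<in> Obj B" "y \<in> on_verts R Y"
      show "act F (i Y y) x \<in> on_verts F Y" using act_closed[OF F i'(1)[OF Y] x] .
    next
      fix f Y Z y assume f: "f \<in> hom_set B Y Z" and o: "Y \<in> Obj B" "Z \<in> Obj B" and y: "y \<in> on_verts R Y"
      have "i Z (act R f y) = f \<odot>\<^bsub>B\<^esub> i Y y"
        using act[OF f i'(1)[OF o(1) y]] i'(2)[OF o(1) y] i[OF o(2) B.Comp_hom[OF i'(1)[OF o(1) y] f]]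
        by simp
      then show "act F (i Z (act R f y)) x = act F f (act F (i Y y) x)"
        using act_Comp[OF F i'(1)[OF o(1) y] f x] by simp
    qed
  qed
  moreover have "\<alpha> = \<beta>" if "\<alpha> \<in> hom_set PSh R F" "\<beta> \<in> hom_set PSh R F"
    "component \<alpha> X r = component \<beta> X r" for \<alpha> \<beta> F
  proof (rule hom_PSh_eqI[OF that(1,2)])
    fix Y y assume Y: "Y \<in> Obj B" "y \<in> on_verts R Y"
    show "component \<alpha> Y y = component \<beta> Y y"
      using component_natural[OF that(1) i'(1)[OF Y] r] component_natural[OF that(2) i'(1)[OF Y] r]
        gen[OF Y] that(3) by simp
  qed
  ultimately show ?thesis using R r by blast
qed

lemma is_pullback_PSh_iff:
  assumes f: "f \<in> hom_set PSh F H" and g: "g \<in> hom_set PSh F' H"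
    and p: "p \<in> hom_set PSh P F" and q: "q \<in> hom_set PSh P F'"
  shows "is_pullback PSh f g p q \<longleftrightarrow>
    (\<forall>X \<in> Obj B. (\<forall>z \<in> on_verts P X. component f X (component p X z) = component g X (component q X z)) \<and>
      (\<forall>x \<in> on_verts F X. \<forall>y \<in> on_verts F' X. component f X x = component g X y \<longrightarrow>
        (\<exists>!z. z \<in> on_verts P X \<and> component p X z = x \<and> component q X z = y)))"
    (is "_ \<longleftrightarrow> (\<forall>X \<in> Obj B. ?comm X \<and> ?uni X)")
proof
  assume pb: "is_pullback PSh f g p q"
  have D: "Dom PSh f = F" "Dom PSh g = F'" "Dom PSh p = P" using f g p by (auto simp: hom_set_iff)
  have PF: "P \<in> Obj PSh" "F \<in> Obj PSh" "F' \<in> Obj PSh"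
    using category.hom_set_Obj[OF category_PSh] p q by blast+
  show "\<forall>X \<in> Obj B. ?comm X \<and> ?uni X"
  proof (intro ballI conjI impI)
    fix X z assume X: "X \<in> Obj B" and z: "z \<in> on_verts P X"
    show "component f X (component p X z) = component g X (component q X z)"
      using component_Comp[OF p f X z] component_Comp[OF q g X z] pullback_hom(5)[OF pb] by simp
  next
    fix X x y assume X: "X \<in> Obj B" and x: "x \<in> on_verts F X" and y: "y \<in> on_verts F' X"
      and xy: "component f X x = component g X y"
    obtain R r where R: "R \<in> Obj PSh" "r \<in> on_verts R X"
      and ex: "\<And>F x. F \<in> Obj PSh \<Longrightarrow> x \<in> on_verts F X \<Longrightarrow> \<exists>\<alpha> \<in> hom_set PSh R F. component \<alpha> X r = x"
      and un: "\<And>F \<alpha> \<beta>. \<alpha> \<in> hom_set PSh R F \<Longrightarrow> \<beta> \<in> hom_set PSh R F \<Longrightarrow>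
        component \<alpha> X r = component \<beta> X r \<Longrightarrow> \<alpha> = \<beta>"
      using representable_exists[OF X] by blast
    obtain h where h: "h \<in> hom_set PSh R F" "component h X r = x" using ex[OF PF(2) x] by blast
    obtain k where k: "k \<in> hom_set PSh R F'" "component k X r = y" using ex[OF PF(3) y] by blast
    have "f \<odot>\<^bsub>PSh\<^esub> h = g \<odot>\<^bsub>PSh\<^esub> k"
      using component_Comp[OF h(1) f X R(2)] component_Comp[OF k(1) g X R(2)] h k xy
      by (intro un[OF category.Comp_hom[OF category_PSh h(1) f] category.Comp_hom[OF category_PSh k(1) g]])
        simp
    then obtain u where u: "u \<in> hom_set PSh R P" "p \<odot>\<^bsub>PSh\<^esub> u = h" "q \<odot>\<^bsub>PSh\<^esub> u = k"
      using pullback_ex1[OF pb category_PSh, unfolded D, OF h(1) k(1)] by blast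
    show "\<exists>!z. z \<in> on_verts P X \<and> component p X z = x \<and> component q X z = y"
    proof (rule ex1I)
      show "component u X r \<in> on_verts P X \<and> component p X (component u X r) = x \<and>
          component q X (component u X r) = y"
        using component_closed[OF u(1) X R(2)] component_Comp[OF u(1) p X R(2)]
          component_Comp[OF u(1) q X R(2)] u h k by simp
      fix z assume z: "z \<in> on_verts P X \<and> component p X z = x \<and> component q X z = y"
      then obtain v where v: "v \<in> hom_set PSh R P" "component v X r = z"
        using ex[OF PF(1)] by blast
      have "p \<odot>\<^bsub>PSh\<^esub> v = p \<odot>\<^bsub>PSh\<^esub> u"
        using component_Comp[OF v(1) p X R(2)] v(2) z h(2) u(2)
        by (intro un[OF category.Comp_hom[OF category_PSh v(1) p] category.Comp_hom[OF category_PSh u(1) p]])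
          simp
      moreover have "q \<odot>\<^bsub>PSh\<^esub> v = q \<odot>\<^bsub>PSh\<^esub> u"
        using component_Comp[OF v(1) q X R(2)] v(2) z k(2) u(3)
        by (intro un[OF category.Comp_hom[OF category_PSh v(1) q] category.Comp_hom[OF category_PSh u(1) q]])
          simp
      ultimately have "v = u"
        using pullback_jointly_monic[OF pb category_PSh, unfolded D, OF v(1) u(1)] by simp
      then show "z = component u X r" using v(2) by simp
    qed
  qed
next
  assume *: "\<forall>X \<in> Obj B. ?comm X \<and> ?uni X"
  have PF: "P \<in> Obj PSh" using category.hom_set_Obj[OF category_PSh] p by blast
  show "is_pullback PSh f g p q"
  proof (rule is_pullbackI[OF f g p q])
    show "f \<odot>\<^bsub>PSh\<^esub> p = g \<odot>\<^bsub>PSh\<^esub> q"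
      using * component_Comp[OF p f] component_Comp[OF q g]
      by (intro hom_PSh_eqI[OF category.Comp_hom[OF category_PSh p f] category.Comp_hom[OF category_PSh q g]])
        simp
  next
    fix T h k assume h: "h \<in> hom_set PSh T F" and k: "k \<in> hom_set PSh T F'"
      and hk: "f \<odot>\<^bsub>PSh\<^esub> h = g \<odot>\<^bsub>PSh\<^esub> k"
    have T: "T \<in> Obj PSh" using category.hom_set_Obj[OF category_PSh] h by blast
    have ex1: "\<exists>!z. z \<in> on_verts P X \<and> component p X z = component h X t \<and> component q X z = component k X t"
      if X: "X \<in> Obj B" and t: "t \<in> on_verts T X" for X t
      using * X component_closed[OF h X t] component_closed[OF k X t]
        component_Comp[OF h f X t] component_Comp[OF k g X t] hk by simp
    define w where "w X t = (THE z. z \<in> on_verts P X \<and> component p X z = component h X t \<and>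
      component q X z = component k X t)" for X t
    have w: "w X t \<in> on_verts P X" "component p X (w X t) = component h X t"
      "component q X (w X t) = component k X t" if "X \<in> Obj B" "t \<in> on_verts T X" for X t
      using theI'[OF ex1[OF that]] by (auto simp: w_def)
    let ?u = "mk_arrow T P w"
    have u: "?u \<in> hom_set PSh T P"
    proof (rule mk_arrow_hom[OF T PF w(1)])
      fix e X Y t assume e: "e \<in> hom_set B X Y" and o: "X \<in> Obj B" "Y \<in> Obj B" and t: "t \<in> on_verts T X"
      have t': "act T e t \<in> on_verts T Y" using act_closed[OF T e t] .
      show "w Y (act T e t) = act P e (w X t)"
        using ex1[OF o(2) t'] w[OF o(2) t'] w[OF o(1) t] act_closed[OF PF e w(1)[OF o(1) t]]
          component_natural[OF p e w(1)[OF o(1) t]] component_natural[OF q e w(1)[OF o(1) t]]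
          component_natural[OF h e t] component_natural[OF k e t] by auto
    qed
    show "\<exists>!u. u \<in> hom_set PSh T P \<and> p \<odot>\<^bsub>PSh\<^esub> u = h \<and> q \<odot>\<^bsub>PSh\<^esub> u = k"
    proof (intro ex1I conjI)
      show "?u \<in> hom_set PSh T P" by fact
      show "p \<odot>\<^bsub>PSh\<^esub> ?u = h"
        using component_Comp[OF u p] w
        by (intro hom_PSh_eqI[OF category.Comp_hom[OF category_PSh u p] h]) (simp add: component_mk_arrow)
      show "q \<odot>\<^bsub>PSh\<^esub> ?u = k"
        using component_Comp[OF u q] w
        by (intro hom_PSh_eqI[OF category.Comp_hom[OF category_PSh u q] k]) (simp add: component_mk_arrow)
    next
      fix v assume v: "v \<in> hom_set PSh T P \<and> p \<odot>\<^bsub>PSh\<^esub> v = h \<and> q \<odot>\<^bsub>PSh\<^esub> v = k"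
      then have v': "v \<in> hom_set PSh T P" by simp
      show "v = ?u"
      proof (rule hom_PSh_eqI[OF v' u])
        fix X t assume t: "X \<in> Obj B" "t \<in> on_verts T X"
        show "component v X t = component ?u X t"
          using ex1[OF t] w[OF t] component_closed[OF v' t] component_Comp[OF v' p t]
            component_Comp[OF v' q t] v component_mk_arrow[OF t] by auto
      qed
    qed
  qed
qed

end

section \<open>Colimits in terms of elements\<close>

locale presheaf_diagrams = presheaf_setting U B + I: wf_digraph I
  for U :: "'u set set" and B :: "('o, 'a) category" and I :: "('v, 'e) pre_digraph" +
  assumes small_verts: "small U (verts I)"
begin

lemma diagram_set:
  assumes "diagram I PSh E" "i \<in> verts I"
  shows "on_verts E i \<in> Obj PSh"
  using diagram_vert[OF assms] .

lemma map_at_closed: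
  assumes "diagram I PSh E" "d \<in> arcs I" "X \<in> Obj B" "x \<in> set_at E (tail I d) X"
  shows "map_at E d X x \<in> set_at E (head I d) X"
  using component_closed[OF diagram_arc[OF assms(1,2)] assms(3)] assms(4)
  by (simp add: set_at_def map_at_component)

lemma map_at_natural:
  assumes "diagram I PSh E" "d \<in> arcs I" "f \<in> hom_set B X Y" "x \<in> set_at E (tail I d) X"
  shows "map_at E d Y (act (on_verts E (tail I d)) f x) = act (on_verts E (head I d)) f (map_at E d X x)"
  using component_natural[OF diagram_arc[OF assms(1,2)] assms(3)] assms(4)
  by (simp add: set_at_def map_at_component)

lemma set_at_act:
  assumes "diagram I PSh E" "i \<in> verts I" "f \<in> hom_set B X Y" "x \<in> set_at E i X"
  shows "act (on_verts E i) f x \<in> set_at E i Y"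
  using act_closed[OF diagram_set[OF assms(1,2)] assms(3)] assms(4) by (simp add: set_at_def)

text \<open>
  At every object \<open>X\<close> of \<open>B\<close> the elements of a diagram are the vertices of a graph, whose edges lead
  from \<open>(i, x)\<close> to \<open>(j, E\<^sub>d x)\<close> for \<open>d : i \<rightarrow> j\<close>. Elements carry their vertex of \<open>I\<close>, because the sets
  of a diagram may overlap. Two elements are linked if a zigzag of edges joins them, and the
  colimit at \<open>X\<close> is the set of connected components.
\<close>

definition elements where
  "elements E X = Sigma (verts I) (\<lambda>i. set_at E i X)"

definition glue where
  "glue E X = {((tail I d, x), (head I d, map_at E d X x)) | d x.
     d \<in> arcs I \<and> x \<in> set_at E (tail I d) X}"

definition linked where
  "linked E X = (glue E X \<union> (glue E X)\<inverse>)\<^sup>*"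

lemma linked_refl: "(e, e) \<in> linked E X"
  by (simp add: linked_def)

lemma linked_sym: "(e, e') \<in> linked E X \<Longrightarrow> (e', e) \<in> linked E X"
  unfolding linked_def
  by (metis converse_Un converse_converse rtrancl_converseI sup_commute)

lemma linked_trans: "(e, e') \<in> linked E X \<Longrightarrow> (e', e'') \<in> linked E X \<Longrightarrow> (e, e'') \<in> linked E X"
  unfolding linked_def by (rule rtrancl_trans)

lemma linked_arc:
  "d \<in> arcs I \<Longrightarrow> x \<in> set_at E (tail I d) X \<Longrightarrow>
    ((tail I d, x), (head I d, map_at E d X x)) \<in> linked E X"
  unfolding linked_def by (rule r_into_rtrancl) (auto simp: glue_def)

text \<open>
  Induction along a zigzag. The step is an equivalence because a zigzag may traverse an edge in
  either direction.
\<close>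

lemma linked_invariant:
  assumes "((i, x), (j, y)) \<in> linked E X" "P i x"
    and inv: "\<And>d x. d \<in> arcs I \<Longrightarrow> x \<in> set_at E (tail I d) X \<Longrightarrow>
      P (tail I d) x \<longleftrightarrow> P (head I d) (map_at E d X x)"
  shows "P j y"
proof -
  have "case (j, y) of (j, y) \<Rightarrow> P j y"
    using assms(1)[unfolded linked_def]
  proof (induction rule: rtrancl_induct)
    case base
    then show ?case using assms(2) by simp
  next
    case (step e e')
    then show ?case using inv by (auto simp: glue_def)
  qed
  then show ?thesis by simp
qed

lemma linked_map:
  assumes "((i, x), (j, y)) \<in> linked E X"
    and "\<And>d x. d \<in> arcs I \<Longrightarrow> x \<in> set_at E (tail I d) X \<Longrightarrow> h (tail I d) x \<in> set_at E' (tail I d) Y"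
    and "\<And>d x. d \<in> arcs I \<Longrightarrow> x \<in> set_at E (tail I d) X \<Longrightarrow>
      h (head I d) (map_at E d X x) = map_at E' d Y (h (tail I d) x)"
  shows "((i, h i x), (j, h j y)) \<in> linked E' Y"
proof (rule linked_invariant[OF assms(1), of "\<lambda>j y. ((i, h i x), (j, h j y)) \<in> linked E' Y"])
  fix d y assume d: "d \<in> arcs I" "y \<in> set_at E (tail I d) X"
  show "((i, h i x), (tail I d, h (tail I d) y)) \<in> linked E' Y \<longleftrightarrow>
    ((i, h i x), (head I d, h (head I d) (map_at E d X y))) \<in> linked E' Y"
    using linked_arc[OF d(1) assms(2)[OF d]] assms(3)[OF d] linked_trans linked_sym by metis
qed (rule linked_refl)

lemma nat_trans_component:
  assumes "nat_trans I PSh E D \<tau>"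
  shows "i \<in> verts I \<Longrightarrow> X \<in> Obj B \<Longrightarrow> x \<in> set_at E i X \<Longrightarrow> component (\<tau> i) X x \<in> set_at D i X"
    and "diagram I PSh E \<Longrightarrow> diagram I PSh D \<Longrightarrow> d \<in> arcs I \<Longrightarrow> X \<in> Obj B \<Longrightarrow> x \<in> set_at E (tail I d) X \<Longrightarrow>
      component (\<tau> (head I d)) X (map_at E d X x) = map_at D d X (component (\<tau> (tail I d)) X x)"
proof -
  show "i \<in> verts I \<Longrightarrow> X \<in> Obj B \<Longrightarrow> x \<in> set_at E i X \<Longrightarrow> component (\<tau> i) X x \<in> set_at D i X"
    using component_closed[OF nat_trans_hom[OF assms]] by (simp add: set_at_def)
  assume E: "diagram I PSh E" and D: "diagram I PSh D" and d: "d \<in> arcs I"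
    and x: "X \<in> Obj B" "x \<in> set_at E (tail I d) X"
  have v: "tail I d \<in> verts I" "head I d \<in> verts I" using d by auto
  note x' = x(2)[unfolded set_at_def]
  show "component (\<tau> (head I d)) X (map_at E d X x) = map_at D d X (component (\<tau> (tail I d)) X x)"
    using component_Comp[OF diagram_arc[OF E d] nat_trans_hom[OF assms v(2)] x(1) x']
      component_Comp[OF nat_trans_hom[OF assms v(1)] diagram_arc[OF D d] x(1) x']
      nat_trans_natural[OF assms d] by (simp add: map_at_component)
qed

lemma cocone_component_arc:
  assumes c: "cocone I PSh E K \<rho>" and d: "d \<in> arcs I" and x: "X \<in> Obj B" "x \<in> set_at E (tail I d) X"
  shows "component (\<rho> (head I d)) X (map_at E d X x) = component (\<rho> (tail I d)) X x"
proof -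
  have E: "diagram I PSh E" using c by (simp add: cocone_def)
  have v: "head I d \<in> verts I" using d by auto
  show ?thesis
    using component_Comp[OF diagram_arc[OF E d] cocone_hom[OF c v] x(1) x(2)[unfolded set_at_def]]
      cocone_natural[OF category_PSh I.wf_digraph_axioms c d] by (simp add: map_at_component)
qed

lemma cocone_linked:
  assumes c: "cocone I PSh E K \<rho>" and X: "X \<in> Obj B" and l: "((i, x), (j, y)) \<in> linked E X"
  shows "component (\<rho> i) X x = component (\<rho> j) X y"
  by (rule linked_invariant[OF l, of "\<lambda>j y. component (\<rho> i) X x = component (\<rho> j) X y"])
    (use cocone_component_arc[OF c _ X] in auto)

lemma cocone_component_closed:
  assumes "cocone I PSh E K \<rho>" "i \<in> verts I" "X \<in> Obj B" "x \<in> set_at E i X"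
  shows "component (\<rho> i) X x \<in> on_verts K X"
  using component_closed[OF cocone_hom[OF assms(1,2)] assms(3)] assms(4) by (simp add: set_at_def)

text \<open>
  The cocone identifies the sets of \<open>K\<close> with the sets of connected components.
\<close>

definition elementwise_colimit where
  "elementwise_colimit E K \<rho> \<longleftrightarrow> cocone I PSh E K \<rho> \<and>
    (\<forall>X \<in> Obj B. \<forall>k \<in> on_verts K X. \<exists>i \<in> verts I. \<exists>x \<in> set_at E i X. component (\<rho> i) X x = k) \<and>
    (\<forall>X \<in> Obj B. \<forall>i \<in> verts I. \<forall>j \<in> verts I. \<forall>x \<in> set_at E i X. \<forall>y \<in> set_at E j X.
      component (\<rho> i) X x = component (\<rho> j) X y \<longrightarrow> ((i, x), (j, y)) \<in> linked E X)"

lemma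
  assumes "elementwise_colimit E K \<rho>"
  shows elementwise_cocone: "cocone I PSh E K \<rho>"
    and elementwise_surj: "X \<in> Obj B \<Longrightarrow> k \<in> on_verts K X \<Longrightarrow>
      \<exists>i \<in> verts I. \<exists>x \<in> set_at E i X. component (\<rho> i) X x = k"
    and elementwise_linked: "X \<in> Obj B \<Longrightarrow> i \<in> verts I \<Longrightarrow> j \<in> verts I \<Longrightarrow>
      x \<in> set_at E i X \<Longrightarrow> y \<in> set_at E j X \<Longrightarrow> component (\<rho> i) X x = component (\<rho> j) X y \<Longrightarrow>
      ((i, x), (j, y)) \<in> linked E X"
  using assms unfolding elementwise_colimit_def by blast+

text \<open>
  Components of the graphs of elements form a presheaf: the maps of a diagram are natural, so an
  arrow of \<open>B\<close> sends linked elements to linked elements.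
\<close>

lemma elementwise_colimit_exists:
  assumes E: "diagram I PSh E"
  shows "\<exists>K \<rho>. elementwise_colimit E K \<rho>"
proof -
  define cl where "cl X e = linked E X `` {e}" for X and e :: "'v \<times> 'u"
  define P where "P X = cl X ` elements E X" for X
  define push where "push f = (\<lambda>(i, x). (i, act (on_verts E i) f x))" for f
  define a where "a f c = linked E (Cod B f) `` (push f ` c)" for f c
  have cl_eq: "cl X e = cl X e' \<longleftrightarrow> (e, e') \<in> linked E X" for X e e'
  proof
    assume "cl X e = cl X e'"
    moreover have "e' \<in> cl X e'" unfolding cl_def by (rule ImageI[OF linked_refl]) simp
    ultimately have "e' \<in> cl X e" by simp
    then show "(e, e') \<in> linked E X" unfolding cl_def by (rule ImageE) simp
  next
    assume l: "(e, e') \<in> linked E X"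
    show "cl X e = cl X e'"
      unfolding cl_def by (auto intro: linked_trans[OF l] linked_trans[OF linked_sym[OF l]])
  qed
  have push_elements: "push f (i, x) \<in> elements E Y" if "f \<in> hom_set B X Y" "(i, x) \<in> elements E X" for f X Y i x
    using that set_at_act[OF E] by (auto simp: push_def elements_def)
  have push_linked: "(push f (i, x), push f (j, y)) \<in> linked E Y"
    if f: "f \<in> hom_set B X Y" and l: "((i, x), (j, y)) \<in> linked E X" for f X Y i x j y
    using linked_map[OF l, of "\<lambda>i. act (on_verts E i) f" E Y] set_at_act[OF E _ f] map_at_natural[OF E _ f]
    by (simp add: push_def)
  have a_cl: "a f (cl X (i, x)) = cl Y (push f (i, x))" if f: "f \<in> hom_set B X Y" for f X Y i x
  proof -
    have "Cod B f = Y" using f by (simp add: hom_set_iff)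
    moreover have "linked E Y `` (push f ` (linked E X `` {(i, x)})) = linked E Y `` {push f (i, x)}"
    proof (intro equalityI subsetI)
      fix e assume "e \<in> linked E Y `` (push f ` (linked E X `` {(i, x)}))"
      then obtain j y where "((i, x), (j, y)) \<in> linked E X" "(push f (j, y), e) \<in> linked E Y" by auto
      then show "e \<in> linked E Y `` {push f (i, x)}"
        using linked_trans[OF push_linked[OF f]] by blast
    next
      fix e assume "e \<in> linked E Y `` {push f (i, x)}"
      moreover have "(i, x) \<in> linked E X `` {(i, x)}"
        by (rule ImageI[OF linked_refl]) simp
      ultimately show "e \<in> linked E Y `` (push f ` (linked E X `` {(i, x)}))" by blast
    qed
    ultimately show ?thesis unfolding a_def cl_def by simp
  qed
  have "\<exists>K c. K \<in> Obj PSh \<and> (\<forall>X \<in> Obj B. bij_betw (c X) (P X) (on_verts K X)) \<and>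
    (\<forall>f X Y x. f \<in> hom_set B X Y \<longrightarrow> x \<in> P X \<longrightarrow> act K f (c X x) = c Y (a f x))"
  proof (rule presheaf_exists)
    fix X assume X: "X \<in> Obj B"
    have "small U (set_at E i X)" if "i \<in> verts I" for i
      using presheaf_set[OF diagram_set[OF E that] X] by (simp add: set_at_def small_universe)
    then show "small U (P X)"
      unfolding P_def elements_def by (intro small_image small_Sigma small_verts)
  next
    fix f X Y c assume "f \<in> hom_set B X Y" "c \<in> P X"
    then show "a f c \<in> P Y" by (auto simp: P_def a_cl intro: push_elements)
  next
    fix X c assume X: "X \<in> Obj B" and "c \<in> P X"
    then show "a (Ident B X) c = c"
      using diagram_set[OF E]
      by (auto simp: P_def a_cl[OF B.Ident_hom] push_def elements_def set_at_def act_Ident)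
  next
    fix f g X Y Z c assume f: "f \<in> hom_set B X Y" and g: "g \<in> hom_set B Y Z" and "c \<in> P X"
    then obtain i x where c: "c = cl X (i, x)" "i \<in> verts I" "x \<in> on_verts (on_verts E i) X"
      by (auto simp: P_def elements_def set_at_def)
    have "push (g \<odot>\<^bsub>B\<^esub> f) (i, x) = push g (push f (i, x))"
      using act_Comp[OF diagram_set[OF E c(2)] f g c(3)] by (simp add: push_def)
    moreover have "a g (cl Y (push f (i, x))) = cl Z (push g (push f (i, x)))"
      using a_cl[OF g] by (simp add: push_def)
    ultimately show "a (g \<odot>\<^bsub>B\<^esub> f) c = a g (a f c)"
      using a_cl[OF f] a_cl[OF B.Comp_hom[OF f g]] c(1) by simp
  qed
  then obtain K c where K: "K \<in> Obj PSh"
    and c: "\<And>X. X \<in> Obj B \<Longrightarrow> bij_betw (c X) (P X) (on_verts K X)"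
    and act: "\<And>f X Y x. f \<in> hom_set B X Y \<Longrightarrow> x \<in> P X \<Longrightarrow> act K f (c X x) = c Y (a f x)"
    by blast
  define \<rho> where "\<rho> = (\<lambda>i \<in> verts I. mk_arrow (on_verts E i) K (\<lambda>X x. c X (cl X (i, x))))"
  have \<rho>_ext: "\<rho> \<in> extensional (verts I)" by (simp add: \<rho>_def)
  have el: "cl X (i, x) \<in> P X" if "i \<in> verts I" "x \<in> set_at E i X" for i X x
    using that by (auto simp: P_def elements_def)
  have \<rho>: "\<rho> i \<in> hom_set PSh (on_verts E i) K" if i: "i \<in> verts I" for i
    unfolding \<rho>_def restrict_apply'[OF i]
  proof (rule mk_arrow_hom[OF diagram_set[OF E i] K])
    fix X x assume X: "X \<in> Obj B" "x \<in> on_verts (on_verts E i) X"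
    then show "c X (cl X (i, x)) \<in> on_verts K X"
      using c[OF X(1)] el[OF i, of x X] by (auto simp: bij_betw_def set_at_def)
  next
    fix f X Y x assume f: "f \<in> hom_set B X Y" and x: "x \<in> on_verts (on_verts E i) X"
    show "c Y (cl Y (i, act (on_verts E i) f x)) = act K f (c X (cl X (i, x)))"
      using act[OF f el[OF i]] x a_cl[OF f] by (simp add: set_at_def push_def)
  qed
  have \<rho>_comp: "component (\<rho> i) X x = c X (cl X (i, x))" if "i \<in> verts I" "X \<in> Obj B" "x \<in> set_at E i X" for i X x
    using that by (simp add: \<rho>_def component_mk_arrow set_at_def)
  have "cocone I PSh E K \<rho>"
  proof (rule coconeI[OF category_PSh I.wf_digraph_axioms E K \<rho>_ext \<rho>])
    fix d assume d: "d \<in> arcs I"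
    have v: "tail I d \<in> verts I" "head I d \<in> verts I" using d by auto
    show "\<rho> (head I d) \<odot>\<^bsub>PSh\<^esub> on_arcs E d = \<rho> (tail I d)"
    proof (rule hom_PSh_eqI[OF category.Comp_hom[OF category_PSh diagram_arc[OF E d] \<rho>[OF v(2)]] \<rho>[OF v(1)]])
      fix X x assume X: "X \<in> Obj B" and x: "x \<in> on_verts (on_verts E (tail I d)) X"
      have x': "x \<in> set_at E (tail I d) X" using x by (simp add: set_at_def)
      have "cl X (head I d, map_at E d X x) = cl X (tail I d, x)"
        unfolding cl_eq by (rule linked_sym[OF linked_arc[OF d x']])
      then show "component (\<rho> (head I d) \<odot>\<^bsub>PSh\<^esub> on_arcs E d) X x = component (\<rho> (tail I d)) X x"
        using component_Comp[OF diagram_arc[OF E d] \<rho>[OF v(2)] X x] \<rho>_comp[OF v(1) X x']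
          \<rho>_comp[OF v(2) X map_at_closed[OF E d X x']] by (simp add: map_at_component)
    qed
  qed
  moreover have "\<exists>i \<in> verts I. \<exists>x \<in> set_at E i X. component (\<rho> i) X x = k"
    if X: "X \<in> Obj B" and k: "k \<in> on_verts K X" for X k
  proof -
    have k': "k \<in> c X ` cl X ` elements E X" using c[OF X] k by (simp add: bij_betw_def P_def)
    obtain i x where "i \<in> verts I" "x \<in> set_at E i X" "k = c X (cl X (i, x))"
      using k' by (auto simp: elements_def)
    then show ?thesis using \<rho>_comp X by blast
  qed
  moreover have "((i, x), (j, y)) \<in> linked E X"
    if "X \<in> Obj B" "i \<in> verts I" "j \<in> verts I" "x \<in> set_at E i X" "y \<in> set_at E j X"
      "component (\<rho> i) X x = component (\<rho> j) X y" for X i j x y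
  proof -
    have "c X (cl X (i, x)) = c X (cl X (j, y))" using that \<rho>_comp by simp
    then have "cl X (i, x) = cl X (j, y)"
      by (rule inj_onD[OF bij_betw_imp_inj_on[OF c[OF that(1)]] _ el[OF that(2,4)] el[OF that(3,5)]])
    then show ?thesis by (simp only: cl_eq)
  qed
  ultimately show ?thesis unfolding elementwise_colimit_def by blast
qed

text \<open>
  A cocone takes the same value on linked elements, so it factors through the components.
\<close>

lemma elementwise_imp_colimiting:
  assumes c: "elementwise_colimit E K \<rho>"
  shows "colimiting_cocone I PSh E K \<rho>"
  unfolding colimiting_cocone_def
proof (intro conjI allI impI)
  show co: "cocone I PSh E K \<rho>" using elementwise_cocone[OF c] .
  then have E: "diagram I PSh E" and K: "K \<in> Obj PSh" by (auto simp: cocone_def)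
  fix T \<pi> assume \<pi>: "cocone I PSh E T \<pi>"
  then have T: "T \<in> Obj PSh" by (simp add: cocone_def)
  define w where "w X k = (SOME t. \<exists>i \<in> verts I. \<exists>x \<in> set_at E i X.
    component (\<rho> i) X x = k \<and> t = component (\<pi> i) X x)" for X k
  have w: "w X (component (\<rho> i) X x) = component (\<pi> i) X x"
    if i: "i \<in> verts I" and X: "X \<in> Obj B" and x: "x \<in> set_at E i X" for i X x
  proof -
    have "\<exists>j \<in> verts I. \<exists>y \<in> set_at E j X. component (\<rho> j) X y = component (\<rho> i) X x \<and>
        w X (component (\<rho> i) X x) = component (\<pi> j) X y"
      unfolding w_def by (rule someI_ex) (use i x in blast)
    then obtain j y where j: "j \<in> verts I" "y \<in> set_at E j X" "component (\<rho> j) X y = component (\<rho> i) X x"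
        "w X (component (\<rho> i) X x) = component (\<pi> j) X y" by blast
    show ?thesis
      using cocone_linked[OF \<pi> X elementwise_linked[OF c X j(1) i j(2) x j(3)]] j(4) by simp
  qed
  let ?u = "mk_arrow K T w"
  have u: "?u \<in> hom_set PSh K T"
  proof (rule mk_arrow_hom[OF K T])
    fix X k assume "X \<in> Obj B" "k \<in> on_verts K X"
    then obtain i x where "i \<in> verts I" "x \<in> set_at E i X" "component (\<rho> i) X x = k"
      using elementwise_surj[OF c] by blast
    then show "w X k \<in> on_verts T X"
      using w \<open>X \<in> Obj B\<close> cocone_component_closed[OF \<pi>] by fastforce
  next
    fix f X Y k assume f: "f \<in> hom_set B X Y" and o: "X \<in> Obj B" "Y \<in> Obj B" and "k \<in> on_verts K X"
    then obtain i x where i: "i \<in> verts I" "x \<in> set_at E i X" "component (\<rho> i) X x = k"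
      using elementwise_surj[OF c] by blast
    have x: "x \<in> on_verts (on_verts E i) X" using i(2) by (simp add: set_at_def)
    show "w Y (act K f k) = act T f (w X k)"
      using component_natural[OF cocone_hom[OF co i(1)] f x] component_natural[OF cocone_hom[OF \<pi> i(1)] f x]
        w[OF i(1) o(1) i(2)] w[OF i(1) o(2) set_at_act[OF E i(1) f i(2)]] i(3) by simp
  qed
  have u\<rho>: "component ?u X (component (\<rho> i) X x) = component (\<pi> i) X x"
    if "i \<in> verts I" "X \<in> Obj B" "x \<in> set_at E i X" for i X x
    using w[OF that] that cocone_component_closed[OF co that] by (simp add: component_mk_arrow)
  show "\<exists>!u. u \<in> hom_set PSh K T \<and> (\<forall>i \<in> verts I. u \<odot>\<^bsub>PSh\<^esub> \<rho> i = \<pi> i)"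
  proof (intro ex1I conjI ballI)
    show "?u \<in> hom_set PSh K T" by fact
    fix i assume i: "i \<in> verts I"
    show "?u \<odot>\<^bsub>PSh\<^esub> \<rho> i = \<pi> i"
      using component_Comp[OF cocone_hom[OF co i] u] u\<rho>[OF i]
      by (intro hom_PSh_eqI[OF category.Comp_hom[OF category_PSh cocone_hom[OF co i] u] cocone_hom[OF \<pi> i]])
        (simp add: set_at_def)
  next
    fix v assume v: "v \<in> hom_set PSh K T \<and> (\<forall>i \<in> verts I. v \<odot>\<^bsub>PSh\<^esub> \<rho> i = \<pi> i)"
    then have v': "v \<in> hom_set PSh K T" by simp
    show "v = ?u"
    proof (rule hom_PSh_eqI[OF v' u])
      fix X k assume X: "X \<in> Obj B" and "k \<in> on_verts K X"
      then obtain i x where i: "i \<in> verts I" "x \<in> set_at E i X" "component (\<rho> i) X x = k"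
        using elementwise_surj[OF c] by blast
      show "component v X k = component ?u X k"
        using component_Comp[OF cocone_hom[OF co i(1)] v' X] i u\<rho>[OF i(1) X i(2)] v
        by (auto simp: set_at_def)
    qed
  qed
qed

text \<open>
  A colimiting cocone factors through the elementwise colimit \<open>T\<close>, which separates elements that
  are not linked. The composite of \<open>K\<close> to \<open>T\<close> and back is the identity, so every element of \<open>K\<close>
  comes from one of \<open>T\<close> and hence of the diagram.
\<close>

lemma colimiting_imp_elementwise:
  assumes c: "colimiting_cocone I PSh E K \<rho>"
  shows "elementwise_colimit E K \<rho>"
proof -
  have co: "cocone I PSh E K \<rho>" using c by (simp add: colimiting_cocone_def)
  then have E: "diagram I PSh E" and K: "K \<in> Obj PSh" by (auto simp: cocone_def)
  obtain T \<pi> where T: "elementwise_colimit E T \<pi>" using elementwise_colimit_exists[OF E] by blast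
  note co' = elementwise_cocone[OF T]
  obtain u where u: "u \<in> hom_set PSh K T" "\<And>i. i \<in> verts I \<Longrightarrow> u \<odot>\<^bsub>PSh\<^esub> \<rho> i = \<pi> i"
    using colimiting_factor[OF c co'] by blast
  obtain v where v: "v \<in> hom_set PSh T K" "\<And>i. i \<in> verts I \<Longrightarrow> v \<odot>\<^bsub>PSh\<^esub> \<pi> i = \<rho> i"
    using colimiting_factor[OF elementwise_imp_colimiting[OF T] co] by blast
  have u\<rho>: "component u X (component (\<rho> i) X x) = component (\<pi> i) X x"
    if "i \<in> verts I" "X \<in> Obj B" "x \<in> set_at E i X" for i X x
    using component_Comp[OF cocone_hom[OF co that(1)] u(1) that(2)] that u(2) by (simp add: set_at_def)
  have v\<pi>: "component v X (component (\<pi> i) X x) = component (\<rho> i) X x"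
    if "i \<in> verts I" "X \<in> Obj B" "x \<in> set_at E i X" for i X x
    using component_Comp[OF cocone_hom[OF co' that(1)] v(1) that(2)] that v(2) by (simp add: set_at_def)
  note P = category.Comp_hom[OF category_PSh] category.Comp_assoc[OF category_PSh]
  have vu: "v \<odot>\<^bsub>PSh\<^esub> u = Ident PSh K"
    using P(2)[OF cocone_hom[OF co] u(1) v(1)] u(2) v(2)
      category.Comp_Ident_left[OF category_PSh cocone_hom[OF co]]
    by (intro colimiting_eqI[OF category_PSh I.wf_digraph_axioms c P(1)[OF u(1) v(1)]
          category.Ident_hom[OF category_PSh K]]) simp
  have "\<exists>i \<in> verts I. \<exists>x \<in> set_at E i X. component (\<rho> i) X x = k"
    if X: "X \<in> Obj B" and k: "k \<in> on_verts K X" for X k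
  proof -
    obtain i x where i: "i \<in> verts I" "x \<in> set_at E i X" "component (\<pi> i) X x = component u X k"
      using elementwise_surj[OF T X component_closed[OF u(1) X k]] by blast
    have "component (\<rho> i) X x = component v X (component u X k)"
      using v\<pi>[OF i(1) X i(2)] i(3) by simp
    also have "\<dots> = k"
      using component_Comp[OF u(1) v(1) X k] vu component_Ident[OF X k] by simp
    finally show ?thesis using i by blast
  qed
  moreover have "((i, x), (j, y)) \<in> linked E X"
    if "X \<in> Obj B" "i \<in> verts I" "j \<in> verts I" "x \<in> set_at E i X" "y \<in> set_at E j X"
      "component (\<rho> i) X x = component (\<rho> j) X y" for X i j x y
    using that u\<rho>[OF that(2,1,4)] u\<rho>[OF that(3,1,5)] elementwise_linked[OF T that(1-5)] by simp
  ultimately show ?thesis unfolding elementwise_colimit_def using co by blast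
qed

lemma pullback_square_element:
  assumes "is_pullback PSh f g p q" "f \<in> hom_set PSh F H" "g \<in> hom_set PSh F' H"
    "p \<in> hom_set PSh P F" "q \<in> hom_set PSh P F'" and X: "X \<in> Obj B"
  shows pullback_element_comm: "z \<in> on_verts P X \<Longrightarrow>
      component f X (component p X z) = component g X (component q X z)"
    and pullback_element_ex: "x \<in> on_verts F X \<Longrightarrow> y \<in> on_verts F' X \<Longrightarrow>
      component f X x = component g X y \<Longrightarrow> \<exists>z \<in> on_verts P X. component p X z = x \<and> component q X z = y"
    and pullback_element_unique: "z \<in> on_verts P X \<Longrightarrow> z' \<in> on_verts P X \<Longrightarrow>
      component p X z = component p X z' \<Longrightarrow> component q X z = component q X z' \<Longrightarrow> z = z'"
proof -
  note * = is_pullback_PSh_iff[OF assms(2-5), THEN iffD1, OF assms(1), rule_format, OF X]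
  show "z \<in> on_verts P X \<Longrightarrow> component f X (component p X z) = component g X (component q X z)"
    using * by blast
  show "x \<in> on_verts F X \<Longrightarrow> y \<in> on_verts F' X \<Longrightarrow>
      component f X x = component g X y \<Longrightarrow> \<exists>z \<in> on_verts P X. component p X z = x \<and> component q X z = y"
    using * by blast
  assume z: "z \<in> on_verts P X" "z' \<in> on_verts P X"
      "component p X z = component p X z'" "component q X z = component q X z'"
  have "component p X z \<in> on_verts F X" "component q X z \<in> on_verts F' X"
    using component_closed assms X z(1) by blast+
  then show "z = z'" using * z by metis
qed

text \<open>
  Fix an element \<open>k\<close> of \<open>K\<close>. Every element of \<open>D\<close> in the component \<open>\<sigma> k\<close> has exactly one element of \<open>E\<close>
  above it that is mapped to \<open>k\<close>, and the arcs respect this correspondence. So a zigzag in \<open>D\<close>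
  within that component lifts to a zigzag in \<open>E\<close> within the fibre of \<open>k\<close>.
\<close>

lemma elementwise_colimit_stable:
  assumes D: "elementwise_colimit D S \<kappa>" and \<sigma>: "\<sigma> \<in> hom_set PSh K S"
    and p: "nat_trans I PSh E D p" and q: "cocone I PSh E K q"
    and pb: "\<And>i. i \<in> verts I \<Longrightarrow> is_pullback PSh (\<kappa> i) \<sigma> (p i) (q i)"
  shows "elementwise_colimit E K q"
proof -
  note co = elementwise_cocone[OF D]
  have E: "diagram I PSh E" and dD: "diagram I PSh D" using q co by (auto simp: cocone_def)
  have comm: "component (\<kappa> i) X (component (p i) X z) = component \<sigma> X (component (q i) X z)"
    if "i \<in> verts I" "X \<in> Obj B" "z \<in> set_at E i X" for i X z
    using pullback_element_comm[OF pb cocone_hom[OF co] \<sigma> nat_trans_hom[OF p] cocone_hom[OF q]] that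
    by (simp add: set_at_def)
  have ex: "\<exists>z \<in> set_at E i X. component (p i) X z = y \<and> component (q i) X z = k"
    if "i \<in> verts I" "X \<in> Obj B" "y \<in> set_at D i X" "k \<in> on_verts K X"
      "component (\<kappa> i) X y = component \<sigma> X k" for i X y k
    using pullback_element_ex[OF pb cocone_hom[OF co] \<sigma> nat_trans_hom[OF p] cocone_hom[OF q]] that
    by (simp add: set_at_def)
  have un: "z = z'" if "i \<in> verts I" "X \<in> Obj B" "z \<in> set_at E i X" "z' \<in> set_at E i X"
    "component (p i) X z = component (p i) X z'" "component (q i) X z = component (q i) X z'" for i X z z'
    using pullback_element_unique[OF pb cocone_hom[OF co] \<sigma> nat_trans_hom[OF p] cocone_hom[OF q]] that
    by (simp add: set_at_def)
  have "\<exists>i \<in> verts I. \<exists>x \<in> set_at E i X. component (q i) X x = k"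
    if X: "X \<in> Obj B" and k: "k \<in> on_verts K X" for X k
  proof -
    obtain i y where "i \<in> verts I" "y \<in> set_at D i X" "component (\<kappa> i) X y = component \<sigma> X k"
      using elementwise_surj[OF D X component_closed[OF \<sigma> X k]] by blast
    then show ?thesis using ex X k by blast
  qed
  moreover have "((i, z), (j, z')) \<in> linked E X"
    if X: "X \<in> Obj B" and i: "i \<in> verts I" and j: "j \<in> verts I" and z: "z \<in> set_at E i X"
      and z': "z' \<in> set_at E j X" and eq: "component (q i) X z = component (q j) X z'" for X i j z z'
  proof -
    let ?k = "component (q i) X z"
    have k: "?k \<in> on_verts K X" using cocone_component_closed[OF q i X z] .
    have "component (\<kappa> i) X (component (p i) X z) = component (\<kappa> j) X (component (p j) X z')"
      using comm[OF i X z] comm[OF j X z'] eq by simp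
    then have l: "((i, component (p i) X z), (j, component (p j) X z')) \<in> linked D X"
      using elementwise_linked[OF D X i j] nat_trans_component(1)[OF p] X i j z z' by blast
    let ?P = "\<lambda>j y. \<forall>z' \<in> set_at E j X. component (p j) X z' = y \<and> component (q j) X z' = ?k \<and>
      component (\<kappa> j) X y = component \<sigma> X ?k \<longrightarrow> ((i, z), (j, z')) \<in> linked E X"
    have "?P j (component (p j) X z')"
    proof (rule linked_invariant[OF l, of ?P])
      show "?P i (component (p i) X z)"
      proof (intro ballI impI)
        fix z2 assume "z2 \<in> set_at E i X"
          "component (p i) X z2 = component (p i) X z \<and> component (q i) X z2 = ?k \<and>
            component (\<kappa> i) X (component (p i) X z) = component \<sigma> X ?k"
        then have "z2 = z" by (intro un[OF i X _ z]) auto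
        then show "((i, z), (i, z2)) \<in> linked E X" by (simp add: linked_refl)
      qed
    next
      fix d y assume d: "d \<in> arcs I" and y: "y \<in> set_at D (tail I d) X"
      have v: "tail I d \<in> verts I" "head I d \<in> verts I" using d by auto
      have E1: "map_at E d X z1 \<in> set_at E (head I d) X"
        "component (p (head I d)) X (map_at E d X z1) = map_at D d X (component (p (tail I d)) X z1)"
        "component (q (head I d)) X (map_at E d X z1) = component (q (tail I d)) X z1"
        if "z1 \<in> set_at E (tail I d) X" for z1
        using map_at_closed[OF E d X that] nat_trans_component(2)[OF p E dD d X that]
          cocone_component_arc[OF q d X that] by auto
      have \<kappa>: "component (\<kappa> (head I d)) X (map_at D d X y) = component (\<kappa> (tail I d)) X y"
        using cocone_component_arc[OF co d X y] .
      show "?P (tail I d) y \<longleftrightarrow> ?P (head I d) (map_at D d X y)"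
      proof (intro iffI ballI impI)
        fix z2 assume P: "?P (tail I d) y" and z2: "z2 \<in> set_at E (head I d) X"
          and h: "component (p (head I d)) X z2 = map_at D d X y \<and> component (q (head I d)) X z2 = ?k \<and>
            component (\<kappa> (head I d)) X (map_at D d X y) = component \<sigma> X ?k"
        then obtain z1 where z1: "z1 \<in> set_at E (tail I d) X" "component (p (tail I d)) X z1 = y"
            "component (q (tail I d)) X z1 = ?k"
          using ex[OF v(1) X y k] \<kappa> by auto
        have "map_at E d X z1 = z2" using E1[OF z1(1)] z1 h by (intro un[OF v(2) X _ z2]) auto
        moreover have "((i, z), (tail I d, z1)) \<in> linked E X" using P z1 h \<kappa> by auto
        ultimately show "((i, z), (head I d, z2)) \<in> linked E X"
          using linked_arc[OF d z1(1)] linked_trans by metis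
      next
        fix z1 assume P: "?P (head I d) (map_at D d X y)" and z1: "z1 \<in> set_at E (tail I d) X"
          and h: "component (p (tail I d)) X z1 = y \<and> component (q (tail I d)) X z1 = ?k \<and>
            component (\<kappa> (tail I d)) X y = component \<sigma> X ?k"
        then have "((i, z), (head I d, map_at E d X z1)) \<in> linked E X"
          using E1[OF z1] \<kappa> by auto
        then show "((i, z), (tail I d, z1)) \<in> linked E X"
          using linked_sym[OF linked_arc[OF d z1]] linked_trans by metis
      qed
    qed
    then show ?thesis
      using z' eq comm[OF j X z'] by simp
  qed
  ultimately show ?thesis unfolding elementwise_colimit_def using q by blast
qed

end

section \<open>Cartesian transformations over forests\<close>

lemma opposite_opposite [simp]: "opposite (opposite \<delta>) = \<delta>"
  by (cases \<delta>) auto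

lemma not_proper_pathE:
  assumes "\<not> proper_path p"
  obtains a s b s' c where "p = a @ s # b @ s' # c" "weakly_equal s s'"
proof -
  obtain m n where mn: "m < length p" "n < length p" "m \<noteq> n" "weakly_equal (p ! m) (p ! n)"
    using assms by (auto simp: proper_path_def)
  have sym: "weakly_equal s s' \<Longrightarrow> weakly_equal s' s" for s s' :: "('e, 'u) segment"
    by (cases s; cases s') auto
  have "\<exists>m n. m < n \<and> n < length p \<and> weakly_equal (p ! m) (p ! n)"
    using mn sym by (metis nat_neq_iff)
  then obtain m n where mn: "m < n" "n < length p" "weakly_equal (p ! m) (p ! n)" by blast
  have "p = take m p @ p ! m # drop (Suc m) p" using mn by (simp add: id_take_nth_drop)
  moreover have "drop (Suc m) p = take (n - Suc m) (drop (Suc m) p) @ p ! n # drop (Suc n) p"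
    using mn id_take_nth_drop[of "n - Suc m" "drop (Suc m) p"] by simp
  ultimately show ?thesis using that mn(3) by metis
qed

context presheaf_diagrams
begin

context
  fixes E D \<tau>
  assumes E: "diagram I PSh E" and D: "diagram I PSh D" and \<tau>: "nat_trans I PSh E D \<tau>"
begin

text \<open>
  \<open>lift X e p e'\<close>: the path \<open>p\<close> in \<open>D\<close> is the image of a zigzag from \<open>e\<close> to \<open>e'\<close> in the elements
  of \<open>E\<close>.
\<close>

inductive lift :: "'o \<Rightarrow> 'v \<times> 'u \<Rightarrow> ('e, 'u) segment list \<Rightarrow> 'v \<times> 'u \<Rightarrow> bool" for X where
  Nil: "i \<in> verts I \<Longrightarrow> x \<in> set_at E i X \<Longrightarrow> lift X (i, x) [] (i, x)"
| Fwd: "d \<in> arcs I \<Longrightarrow> x \<in> set_at E (tail I d) X \<Longrightarrow> lift X (head I d, map_at E d X x) p e \<Longrightarrow>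
    lift X (tail I d, x)
      ((component (\<tau> (tail I d)) X x, Fwd d, component (\<tau> (head I d)) X (map_at E d X x)) # p) e"
| Opp: "d \<in> arcs I \<Longrightarrow> x \<in> set_at E (tail I d) X \<Longrightarrow> lift X (tail I d, x) p e \<Longrightarrow>
    lift X (head I d, map_at E d X x)
      ((component (\<tau> (head I d)) X (map_at E d X x), Opp d, component (\<tau> (tail I d)) X x) # p) e"

lemma lift_elements:
  assumes "X \<in> Obj B" "lift X e p e'"
  shows "fst e \<in> verts I \<and> snd e \<in> set_at E (fst e) X" "fst e' \<in> verts I \<and> snd e' \<in> set_at E (fst e') X"
  using assms(2)
  by (induction rule: lift.induct) (auto intro: map_at_closed[OF E _ assms(1)])

lemma lift_mapping_path:
  assumes "X \<in> Obj B" "lift X e p e'"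
  shows "mapping_path I D X (component (\<tau> (fst e)) X (snd e)) p (component (\<tau> (fst e')) X (snd e'))"
  using assms(2)
proof (induction rule: lift.induct)
  case (Nil i x)
  then show ?case using nat_trans_component(1)[OF \<tau>] assms(1) by (auto intro: mapping_path.empty)
next
  case (Fwd d x p e)
  then show ?case
    using nat_trans_component(1)[OF \<tau> _ assms(1)] nat_trans_component(2)[OF \<tau> E D _ assms(1)]
      map_at_closed[OF D _ assms(1)]
    by (auto intro!: mapping_path.step)
next
  case (Opp d x p e)
  then show ?case
    using nat_trans_component(1)[OF \<tau> _ assms(1)] nat_trans_component(2)[OF \<tau> E D _ assms(1)]
      map_at_closed[OF D _ assms(1)]
    by (auto intro!: mapping_path.step)
qed

lemma lift_append:
  assumes "lift X e p e'" "lift X e' q e''"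
  shows "lift X e (p @ q) e''"
  using assms by (induction rule: lift.induct) (auto intro: lift.intros)

lemma lift_appendE:
  assumes "X \<in> Obj B" "lift X e (p @ q) e''"
  obtains e' where "lift X e p e'" "lift X e' q e''"
proof -
  have "\<exists>e'. lift X e p e' \<and> lift X e' q e''"
    using assms(2)
  proof (induction p arbitrary: e)
    case Nil
    then have "fst e \<in> verts I \<and> snd e \<in> set_at E (fst e) X"
      using lift_elements(1)[OF assms(1)] by simp
    then have "lift X e [] e" using lift.Nil[of "fst e" "snd e" X] by simp
    then show ?case using Nil by (intro exI[of _ e]) simp
  next
    case (Cons s p)
    from Cons.prems[simplified] show ?case
    proof (cases rule: lift.cases)
      case (Fwd d x)
      then show ?thesis using Cons.IH lift.Fwd by blast
    next
      case (Opp d x)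
      then show ?thesis using Cons.IH lift.Opp by blast
    qed
  qed
  then show ?thesis using that by blast
qed

fun start :: "'e dir_arc \<Rightarrow> 'v" where
  "start (Fwd d) = tail I d"
| "start (Opp d) = head I d"

text \<open>
  The directed arc of a segment determines the vertices of \<open>I\<close> between which its lifts run. So two
  lifts of the same segment start at the same vertex.
\<close>

lemma lift_singleton:
  assumes "lift X e [(y, \<delta>, y')] e'"
  shows "fst e = start \<delta>" "component (\<tau> (fst e)) X (snd e) = y"
    "fst e' = start (opposite \<delta>)" "component (\<tau> (fst e')) X (snd e') = y'"
    "\<delta> = Fwd d \<Longrightarrow> d \<in> arcs I \<and> snd e \<in> set_at E (tail I d) X \<and> snd e' = map_at E d X (snd e)"
    "\<delta> = Opp d \<Longrightarrow> d \<in> arcs I \<and> snd e' \<in> set_at E (tail I d) X \<and> snd e = map_at E d X (snd e')"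
  using assms by (auto elim!: lift.cases)

lemma lift_linked:
  assumes "X \<in> Obj B" "((i, x), (j, y)) \<in> linked E X" "i \<in> verts I" "x \<in> set_at E i X"
  shows "\<exists>p. lift X (i, x) p (j, y)"
proof (rule linked_invariant[OF assms(2), of "\<lambda>j y. \<exists>p. lift X (i, x) p (j, y)"])
  show "\<exists>p. lift X (i, x) p (i, x)" using lift.Nil assms(3,4) by blast
next
  fix d y assume d: "d \<in> arcs I" "y \<in> set_at E (tail I d) X"
  have "lift X (tail I d, y) [] (tail I d, y)"
    "lift X (head I d, map_at E d X y) [] (head I d, map_at E d X y)"
    using d map_at_closed[OF E _ assms(1)] by (auto intro!: lift.Nil)
  from lift.Opp[OF d this(1)] lift.Fwd[OF d this(2)]
  show "(\<exists>p. lift X (i, x) p (tail I d, y)) \<longleftrightarrow> (\<exists>p. lift X (i, x) p (head I d, map_at E d X y))"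
    using lift_append by blast
qed

text \<open>
  Induction on the length of the zigzag. Its image in \<open>D\<close> is a closed path, which is empty if it is
  proper. Otherwise some segment is traversed twice in the same direction or once in each
  direction. The part in between closes up by the induction hypothesis, and cutting it out leaves a
  shorter zigzag with the same ends.
\<close>

lemma lift_over_forest:
  assumes X: "X \<in> Obj B"
    and forest: "\<And>z p. mapping_path I D X z p z \<Longrightarrow> proper_path p \<Longrightarrow> p = []"
    and inj: "\<And>d x y. d \<in> arcs I \<Longrightarrow> x \<in> set_at E (tail I d) X \<Longrightarrow> y \<in> set_at E (tail I d) X \<Longrightarrow>
      component (\<tau> (tail I d)) X x = component (\<tau> (tail I d)) X y \<Longrightarrow>
      map_at E d X x = map_at E d X y \<Longrightarrow> x = y"
    and "lift X (i, x) p (i, x')" "component (\<tau> i) X x = component (\<tau> i) X x'"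
  shows "x = x'"
  using assms(4,5)
proof (induction p arbitrary: i x x' rule: length_induct)
  case (1 p)
  have IH: "e = e'" if "lift X e q e'" "length q < length p" "fst e = fst e'"
    "component (\<tau> (fst e)) X (snd e) = component (\<tau> (fst e')) X (snd e')" for q e e'
    using 1(1)[rule_format, OF that(2), of "fst e" "snd e" "snd e'"] that by (cases e; cases e') auto
  have eq: "component (\<tau> i) X x = component (\<tau> i) X x'" by (rule 1(3))
  show ?case
  proof (cases "proper_path p")
    case True
    then have "p = []" using forest lift_mapping_path[OF X 1(2)] 1(3) by simp
    then show ?thesis using 1(2) by (auto elim: lift.cases)
  next
    case False
    then obtain a s b s' c where p: "p = a @ [s] @ b @ [s'] @ c" and w: "weakly_equal s s'"
      by (auto elim: not_proper_pathE)
    obtain y \<delta> y' where s: "s = (y, \<delta>, y')" by (cases s)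
    obtain e1 e2 e3 e4 where l: "lift X (i, x) a e1" "lift X e1 [s] e2" "lift X e2 b e3"
      "lift X e3 [s'] e4" "lift X e4 c (i, x')"
      using 1(2) unfolding p by (blast elim: lift_appendE[OF X])
    note l2 = lift_singleton[OF l(2)[unfolded s]]
    obtain z \<epsilon> z' where s': "s' = (z, \<epsilon>, z')" by (cases s')
    have "s' = s \<or> s' = (y', opposite \<delta>, y)"
      using w unfolding s s' weakly_equal.simps by auto
    then consider "s' = s" | "s' = (y', opposite \<delta>, y)" by blast
    then show ?thesis
    proof cases
      case 1
      note l4 = lift_singleton[OF l(4)[unfolded 1 s]]
      have "e1 = e3"
        using lift_append[OF l(2,3)] l2(1,2) l4(1,2) by (intro IH) (auto simp: p)
      \<comment> \<open>the loop between the two traversals closes up in \<open>E\<close> and is cut out\<close>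
      then have "lift X (i, x) (a @ [s'] @ c) (i, x')"
        using lift_append[OF l(1)] lift_append[OF l(4,5)] by simp
      then have "(i, x) = (i, x')" by (rule IH) (simp_all add: p eq)
      then show ?thesis by simp
    next
      case 2
      note l4 = lift_singleton[OF l(4)[unfolded 2]]
      \<comment> \<open>the detour \<open>b\<close> closes up, so \<open>s\<close> is undone by \<open>s'\<close> and both are cut out\<close>
      have e: "e2 = e3"
        using l(3) l2(3,4) l4(1,2) by (intro IH) (auto simp: p)
      have "e1 = e4"
      proof (cases \<delta>)
        case (Fwd d)
        have d: "d \<in> arcs I" "snd e1 \<in> set_at E (tail I d) X" "snd e2 = map_at E d X (snd e1)"
          using l2(5)[OF Fwd] by simp_all
        have d': "snd e4 \<in> set_at E (tail I d) X" "snd e3 = map_at E d X (snd e4)"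
          using l4(6)[of d] Fwd by simp_all
        have f: "fst e1 = tail I d" "fst e4 = tail I d"
          using l2(1) l4(3) Fwd by simp_all
        have "snd e1 = snd e4"
          using l2(2) l4(4) d(3) d'(2) e unfolding f by (intro inj[OF d(1,2) d'(1)]) simp_all
        then show ?thesis using f by (simp add: prod_eq_iff)
      next
        case (Opp d)
        have "snd e1 = map_at E d X (snd e2)" "snd e4 = map_at E d X (snd e3)"
          using l2(6)[OF Opp] l4(5)[of d] Opp by simp_all
        moreover have "fst e1 = fst e4" using l2(1) l4(3) by simp
        ultimately show ?thesis using e by (simp add: prod_eq_iff)
      qed
      then have "lift X (i, x) (a @ c) (i, x')"
        using lift_append[OF l(1)] l(5) by simp
      then have "(i, x) = (i, x')" by (rule IH) (simp_all add: p eq)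
      then show ?thesis by simp
    qed
  qed
qed

end

text \<open>
  For the element of \<open>E\<close> over a compatible pair of elements of \<open>D\<close> and \<open>K\<close>, a representative of the
  second is transported along a zigzag in \<open>D\<close>, which lifts because \<open>\<tau>\<close> is cartesian. Two such
  elements are joined by a zigzag in \<open>E\<close> with closed image, and over a forest this makes them equal.
\<close>

lemma cartesian_over_forest:
  assumes D: "elementwise_colimit D S \<kappa>"
    and E: "Arrow E \<tau> D \<in> Obj (cartesian_slice I PSh D)" and K: "elementwise_colimit E K \<rho>"
    and \<sigma>: "\<sigma> \<in> hom_set PSh K S" "\<And>i. i \<in> verts I \<Longrightarrow> \<sigma> \<odot>\<^bsub>PSh\<^esub> \<rho> i = \<kappa> i \<odot>\<^bsub>PSh\<^esub> \<tau> i"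
    and forest: "\<And>X z p. X \<in> Obj B \<Longrightarrow> mapping_path I D X z p z \<Longrightarrow> proper_path p \<Longrightarrow> p = []"
    and i: "i \<in> verts I"
  shows "is_pullback PSh (\<kappa> i) \<sigma> (\<tau> i) (\<rho> i)"
proof -
  have dE: "diagram I PSh E" and dD: "diagram I PSh D" and \<tau>: "nat_trans I PSh E D \<tau>"
    and cart: "\<And>d. d \<in> arcs I \<Longrightarrow>
      is_pullback PSh (on_arcs D d) (\<tau> (head I d)) (\<tau> (tail I d)) (on_arcs E d)"
    using E by (auto simp: Obj_cartesian_slice)
  note co = elementwise_cocone[OF D] and co' = elementwise_cocone[OF K]
  have comm: "component (\<kappa> j) X (component (\<tau> j) X z) = component \<sigma> X (component (\<rho> j) X z)"
    if "j \<in> verts I" "X \<in> Obj B" "z \<in> set_at E j X" for j X z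
    using component_Comp[OF nat_trans_hom[OF \<tau> that(1)] cocone_hom[OF co that(1)] that(2)]
      component_Comp[OF cocone_hom[OF co' that(1)] \<sigma>(1) that(2)] \<sigma>(2)[OF that(1)] that(3)
    by (simp add: set_at_def)
  have inj: "x = y"
    if d: "d \<in> arcs I" and X: "X \<in> Obj B" and "x \<in> set_at E (tail I d) X" "y \<in> set_at E (tail I d) X"
      "component (\<tau> (tail I d)) X x = component (\<tau> (tail I d)) X y" "map_at E d X x = map_at E d X y"
    for d X x y
    using pullback_element_unique[OF cart[OF d] diagram_arc[OF dD d] nat_trans_hom[OF \<tau>]
        nat_trans_hom[OF \<tau>] diagram_arc[OF dE d] X] that
    by (simp add: set_at_def map_at_component)
  have surj: "\<exists>x \<in> set_at E (tail I d) X. component (\<tau> (tail I d)) X x = y \<and> map_at E d X x = z"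
    if d: "d \<in> arcs I" and X: "X \<in> Obj B" and "y \<in> set_at D (tail I d) X" "z \<in> set_at E (head I d) X"
      "map_at D d X y = component (\<tau> (head I d)) X z" for d X y z
    using pullback_element_ex[OF cart[OF d] diagram_arc[OF dD d] nat_trans_hom[OF \<tau>]
        nat_trans_hom[OF \<tau>] diagram_arc[OF dE d] X] that
    by (simp add: set_at_def map_at_component)
  show ?thesis
    unfolding is_pullback_PSh_iff[OF cocone_hom[OF co i] \<sigma>(1) nat_trans_hom[OF \<tau> i] cocone_hom[OF co' i]]
  proof (intro ballI conjI impI)
    fix X z assume X: "X \<in> Obj B" and z: "z \<in> on_verts (on_verts E i) X"
    then show "component (\<kappa> i) X (component (\<tau> i) X z) = component \<sigma> X (component (\<rho> i) X z)"
      using comm[OF i] by (simp add: set_at_def)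
  next
    fix X y k assume X: "X \<in> Obj B" and y: "y \<in> on_verts (on_verts D i) X" and k: "k \<in> on_verts K X"
      and yk: "component (\<kappa> i) X y = component \<sigma> X k"
    obtain j z where j: "j \<in> verts I" and z: "z \<in> set_at E j X" and zk: "component (\<rho> j) X z = k"
      using elementwise_surj[OF K X k] by blast
    have "((j, component (\<tau> j) X z), (i, y)) \<in> linked D X"
      using elementwise_linked[OF D X j i] nat_trans_component(1)[OF \<tau> j X z] y comm[OF j X z] zk yk
      by (simp add: set_at_def)
    then have "\<exists>z' \<in> set_at E i X. component (\<tau> i) X z' = y \<and> component (\<rho> i) X z' = k"
    proof (rule linked_invariant[where P = "\<lambda>i y. \<exists>z' \<in> set_at E i X. component (\<tau> i) X z' = y \<and>
          component (\<rho> i) X z' = k"])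
      show "\<exists>z' \<in> set_at E j X. component (\<tau> j) X z' = component (\<tau> j) X z \<and> component (\<rho> j) X z' = k"
        using z zk by blast
    next
      fix d y assume d: "d \<in> arcs I" and y: "y \<in> set_at D (tail I d) X"
      show "(\<exists>z' \<in> set_at E (tail I d) X. component (\<tau> (tail I d)) X z' = y \<and>
          component (\<rho> (tail I d)) X z' = k) \<longleftrightarrow>
        (\<exists>z' \<in> set_at E (head I d) X. component (\<tau> (head I d)) X z' = map_at D d X y \<and>
          component (\<rho> (head I d)) X z' = k)"
      proof
        assume "\<exists>z' \<in> set_at E (tail I d) X. component (\<tau> (tail I d)) X z' = y \<and>
          component (\<rho> (tail I d)) X z' = k"
        then obtain z1 where z1: "z1 \<in> set_at E (tail I d) X" "component (\<tau> (tail I d)) X z1 = y"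
          "component (\<rho> (tail I d)) X z1 = k" by blast
        show "\<exists>z' \<in> set_at E (head I d) X. component (\<tau> (head I d)) X z' = map_at D d X y \<and>
          component (\<rho> (head I d)) X z' = k"
          using map_at_closed[OF dE d X z1(1)] nat_trans_component(2)[OF \<tau> dE dD d X z1(1)]
            cocone_component_arc[OF co' d X z1(1)] z1(2,3)
          by (intro bexI[of _ "map_at E d X z1"]) auto
      next
        assume "\<exists>z' \<in> set_at E (head I d) X. component (\<tau> (head I d)) X z' = map_at D d X y \<and>
          component (\<rho> (head I d)) X z' = k"
        then obtain z2 where z2: "z2 \<in> set_at E (head I d) X"
          "component (\<tau> (head I d)) X z2 = map_at D d X y" "component (\<rho> (head I d)) X z2 = k" by blast
        obtain z1 where z1: "z1 \<in> set_at E (tail I d) X" "component (\<tau> (tail I d)) X z1 = y"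
          "map_at E d X z1 = z2"
          using surj[OF d X y z2(1)] z2(2) by auto
        show "\<exists>z' \<in> set_at E (tail I d) X. component (\<tau> (tail I d)) X z' = y \<and>
          component (\<rho> (tail I d)) X z' = k"
          using cocone_component_arc[OF co' d X z1(1)] z1 z2(3)
          by (intro bexI[of _ z1]) auto
      qed
    qed
    then obtain z' where z': "z' \<in> set_at E i X" "component (\<tau> i) X z' = y" "component (\<rho> i) X z' = k"
      by blast
    show "\<exists>!z. z \<in> on_verts (on_verts E i) X \<and> component (\<tau> i) X z = y \<and> component (\<rho> i) X z = k"
    proof (rule ex1I)
      show "z' \<in> on_verts (on_verts E i) X \<and> component (\<tau> i) X z' = y \<and> component (\<rho> i) X z' = k"
        using z' by (simp add: set_at_def)
    next
      fix z2 assume "z2 \<in> on_verts (on_verts E i) X \<and> component (\<tau> i) X z2 = y \<and> component (\<rho> i) X z2 = k"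
      then have z2: "z2 \<in> set_at E i X" "component (\<tau> i) X z2 = y" "component (\<rho> i) X z2 = k"
        by (auto simp: set_at_def)
      have "((i, z2), (i, z')) \<in> linked E X"
        using elementwise_linked[OF K X i i] z2 z' by simp
      then obtain p where l: "lift E \<tau> X (i, z2) p (i, z')"
        using lift_linked[OF dE dD \<tau> X _ i z2(1)] by blast
      show "z2 = z'"
      proof (rule lift_over_forest[OF dE dD \<tau> X _ _ l])
        show "component (\<tau> i) X z2 = component (\<tau> i) X z'" using z2(2) z'(2) by simp
      qed (use forest[OF X] inj[OF _ X] in blast)+
    qed
  qed
qed

end

section \<open>The twisted covering of a diagram\<close>

context presheaf_diagrams
begin

text \<open>
  The pair \<open>(d, y)\<close> stands for the edge from \<open>y\<close> to \<open>D\<^sub>d y\<close> in the graph of elements, and chains are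
  finite integer combinations of edges.
\<close>

definition edges where
  "edges D X = Sigma (arcs I) (\<lambda>d. set_at D (tail I d) X)"

definition chains :: "('v, 'e, 'o, 'a, 'u) presheaf_diagram \<Rightarrow> 'o \<Rightarrow> ('e \<times> 'u \<Rightarrow>\<^sub>0 int) set" where
  "chains D X = {c. Poly_Mapping.keys c \<subseteq> edges D X}"

definition push_edge where
  "push_edge D f = (\<lambda>(d, y). (d, act (on_verts D (tail I d)) f y))"

definition push_chain :: "('v, 'e, 'o, 'a, 'u) presheaf_diagram \<Rightarrow> 'a \<Rightarrow> ('e \<times> 'u \<Rightarrow>\<^sub>0 int) \<Rightarrow> ('e \<times> 'u \<Rightarrow>\<^sub>0 int)" where
  "push_chain D f = frag_extend (frag_of \<circ> push_edge D f)"

lemma chains_add: "c \<in> chains D X \<Longrightarrow> c' \<in> chains D X \<Longrightarrow> c + c' \<in> chains D X"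
  unfolding chains_def using keys_add[of c c'] by blast

lemma chains_diff: "c \<in> chains D X \<Longrightarrow> c' \<in> chains D X \<Longrightarrow> c - c' \<in> chains D X"
  unfolding chains_def using keys_diff[of c c'] by blast

lemma chains_frag_of: "d \<in> arcs I \<Longrightarrow> y \<in> set_at D (tail I d) X \<Longrightarrow> frag_of (d, y) \<in> chains D X"
  by (simp add: chains_def edges_def)

lemma chains_0: "0 \<in> chains D X"
  by (simp add: chains_def)

context
  fixes D assumes D: "diagram I PSh D"
begin

lemma push_edge_closed:
  assumes "f \<in> hom_set B X Y" "e \<in> edges D X"
  shows "push_edge D f e \<in> edges D Y"
  using assms(2) set_at_act[OF D I.tail_in_verts assms(1)]
  by (auto simp: push_edge_def edges_def)

lemma push_chain_closed:
  assumes f: "f \<in> hom_set B X Y" and c: "c \<in> chains D X"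
  shows "push_chain D f c \<in> chains D Y"
proof -
  have "Poly_Mapping.keys (push_chain D f c) \<subseteq> (\<Union>e \<in> Poly_Mapping.keys c. {push_edge D f e})"
    using keys_frag_extend[of "frag_of \<circ> push_edge D f" c] by (simp add: push_chain_def)
  then show ?thesis
    using push_edge_closed[OF f] c unfolding chains_def by blast
qed

lemma push_chain_Ident:
  assumes X: "X \<in> Obj B" and c: "c \<in> chains D X"
  shows "push_chain D (Ident B X) c = c"
proof -
  have "push_edge D (Ident B X) e = e" if "e \<in> edges D X" for e
    using that act_Ident[OF diagram_set[OF D I.tail_in_verts] X]
    by (auto simp: push_edge_def edges_def set_at_def)
  then have "push_chain D (Ident B X) c = frag_extend frag_of c"
    unfolding push_chain_def using c by (intro frag_extend_eq) (auto simp: chains_def)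
  then show ?thesis by (simp add: frag_expansion[symmetric])
qed

lemma push_chain_Comp:
  assumes f: "f \<in> hom_set B X Y" and g: "g \<in> hom_set B Y Z" and c: "c \<in> chains D X"
  shows "push_chain D (g \<odot>\<^bsub>B\<^esub> f) c = push_chain D g (push_chain D f c)"
proof -
  have "push_edge D (g \<odot>\<^bsub>B\<^esub> f) e = push_edge D g (push_edge D f e)" if "e \<in> edges D X" for e
    using that act_Comp[OF diagram_set[OF D I.tail_in_verts] f g]
    by (auto simp: push_edge_def edges_def set_at_def)
  then show ?thesis
    unfolding push_chain_def frag_extend_compose
    using c by (intro frag_extend_eq) (auto simp: chains_def)
qed

lemma push_chain_add_edge:
  "push_chain D f (c + frag_of (d, y)) =
    push_chain D f c + frag_of (d, act (on_verts D (tail I d)) f y)"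
  by (simp add: push_chain_def frag_extend_add push_edge_def)

text \<open>
  A covering whose monodromy detects every cycle: the fibre over each element consists of all
  chains, and an arc of \<open>I\<close> adds the edge that it traverses. The fibre maps are translations,
  hence bijective, so the squares are pullbacks. The construction is natural in the objects of
  \<open>B\<close> because edges are mapped to edges and chains are pushed forward linearly.
\<close>

lemma twisted_covering_exists:
  assumes small_arcs: "small U (arcs I)"
  shows "\<exists>E \<tau> c. Arrow E \<tau> D \<in> Obj (cartesian_slice I PSh D) \<and>
    (\<forall>i \<in> verts I. \<forall>X \<in> Obj B. bij_betw (c i X) (set_at D i X \<times> chains D X) (set_at E i X) \<and>
      (\<forall>y \<in> set_at D i X. \<forall>a \<in> chains D X. component (\<tau> i) X (c i X (y, a)) = y)) \<and>
    (\<forall>d \<in> arcs I. \<forall>X \<in> Obj B. \<forall>y \<in> set_at D (tail I d) X. \<forall>a \<in> chains D X.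
      map_at E d X (c (tail I d) X (y, a)) = c (head I d) X (map_at D d X y, a + frag_of (d, y)))"
proof -
  have "\<exists>F c. F \<in> Obj PSh \<and> (\<forall>X \<in> Obj B. bij_betw (c X) (set_at D i X \<times> chains D X) (on_verts F X)) \<and>
    (\<forall>f X Y x. f \<in> hom_set B X Y \<longrightarrow> x \<in> set_at D i X \<times> chains D X \<longrightarrow>
      act F f (c X x) = c Y (act (on_verts D i) f (fst x), push_chain D f (snd x)))"
    if i: "i \<in> verts I" for i
  proof (rule presheaf_exists[where P = "\<lambda>X. set_at D i X \<times> chains D X" and
        a = "\<lambda>f x. (act (on_verts D i) f (fst x), push_chain D f (snd x))"])
    fix X assume X: "X \<in> Obj B"
    have s: "small U (set_at D j X)" if "j \<in> verts I" for j
      using presheaf_set[OF diagram_set[OF D that] X] by (simp add: set_at_def small_universe)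
    then have "small U (edges D X)"
      unfolding edges_def by (intro small_Sigma small_arcs) auto
    then show "small U (set_at D i X \<times> chains D X)"
      unfolding chains_def by (intro small_Times small_frag s i)
  next
    fix f X Y x assume f: "f \<in> hom_set B X Y" and "x \<in> set_at D i X \<times> chains D X"
    then show "(act (on_verts D i) f (fst x), push_chain D f (snd x)) \<in> set_at D i Y \<times> chains D Y"
      using set_at_act[OF D i f] push_chain_closed[OF f] by auto
  next
    fix X x assume "X \<in> Obj B" "x \<in> set_at D i X \<times> chains D X"
    then show "(act (on_verts D i) (Ident B X) (fst x), push_chain D (Ident B X) (snd x)) = x"
      using act_Ident[OF diagram_set[OF D i]] push_chain_Ident by (auto simp: set_at_def)
  next
    fix f g X Y Z x
    assume fg: "f \<in> hom_set B X Y" "g \<in> hom_set B Y Z" and "x \<in> set_at D i X \<times> chains D X"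
    then show "(act (on_verts D i) (g \<odot>\<^bsub>B\<^esub> f) (fst x), push_chain D (g \<odot>\<^bsub>B\<^esub> f) (snd x)) =
      (act (on_verts D i) g (fst (act (on_verts D i) f (fst x), push_chain D f (snd x))),
       push_chain D g (snd (act (on_verts D i) f (fst x), push_chain D f (snd x))))"
      using act_Comp[OF diagram_set[OF D i] fg] push_chain_Comp[OF fg] by (auto simp: set_at_def)
  qed
  then obtain F c where F: "\<And>i. i \<in> verts I \<Longrightarrow> F i \<in> Obj PSh"
    and c: "\<And>i X. i \<in> verts I \<Longrightarrow> X \<in> Obj B \<Longrightarrow>
      bij_betw (c i X) (set_at D i X \<times> chains D X) (on_verts (F i) X)"
    and act: "\<And>i f X Y x. i \<in> verts I \<Longrightarrow> f \<in> hom_set B X Y \<Longrightarrow> x \<in> set_at D i X \<times> chains D X \<Longrightarrow>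
      act (F i) f (c i X x) = c i Y (act (on_verts D i) f (fst x), push_chain D f (snd x))"
    by metis
  define \<iota> where "\<iota> i X = the_inv_into (set_at D i X \<times> chains D X) (c i X)" for i X
  have \<iota>: "\<iota> i X (c i X (y, a)) = (y, a)"
    if "i \<in> verts I" "X \<in> Obj B" "y \<in> set_at D i X" "a \<in> chains D X" for i X y a
    unfolding \<iota>_def using c[OF that(1,2)] that(3,4)
    by (intro the_inv_into_f_f) (auto simp: bij_betw_def)
  have elem: "\<exists>y \<in> set_at D i X. \<exists>a \<in> chains D X. x = c i X (y, a)"
    if "i \<in> verts I" "X \<in> Obj B" "x \<in> on_verts (F i) X" for i X x
  proof -
    have "x \<in> c i X ` (set_at D i X \<times> chains D X)"
      using c[OF that(1,2)] that(3) by (simp add: bij_betw_def)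
    then show ?thesis by auto
  qed
  have cF: "c i X (y, a) \<in> on_verts (F i) X"
    if "i \<in> verts I" "X \<in> Obj B" "y \<in> set_at D i X" "a \<in> chains D X" for i X y a
  proof -
    have "c i X (y, a) \<in> c i X ` (set_at D i X \<times> chains D X)" using that by blast
    then show ?thesis using c[OF that(1,2)] by (simp add: bij_betw_def)
  qed
  define arrow where "arrow d = mk_arrow (F (tail I d)) (F (head I d))
    (\<lambda>X x. let (y, a) = \<iota> (tail I d) X x in c (head I d) X (map_at D d X y, a + frag_of (d, y)))" for d
  define proj where "proj i = mk_arrow (F i) (on_verts D i) (\<lambda>X x. fst (\<iota> i X x))" for i
  define E where "E = \<lparr>on_verts = (\<lambda>i \<in> verts I. F i), on_arcs = (\<lambda>d \<in> arcs I. arrow d)\<rparr>"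
  define \<tau> where "\<tau> = (\<lambda>i \<in> verts I. proj i)"
  have arrow_comp: "component (arrow d) X (c (tail I d) X (y, a)) =
      c (head I d) X (map_at D d X y, a + frag_of (d, y))"
    if d: "d \<in> arcs I" and X: "X \<in> Obj B" and y: "y \<in> set_at D (tail I d) X" and a: "a \<in> chains D X" for d X y a
  proof -
    have v: "tail I d \<in> verts I" using d by auto
    show ?thesis
      using cF[OF v X y a] \<iota>[OF v X y a] X by (simp add: arrow_def component_mk_arrow)
  qed
  have proj_comp: "component (proj i) X (c i X (y, a)) = y"
    if "i \<in> verts I" "X \<in> Obj B" "y \<in> set_at D i X" "a \<in> chains D X" for i X y a
    using cF[OF that] \<iota>[OF that] that(2) by (simp add: proj_def component_mk_arrow)
  have arrow_hom: "arrow d \<in> hom_set PSh (F (tail I d)) (F (head I d))" if d: "d \<in> arcs I" for d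
  proof -
    have v: "tail I d \<in> verts I" "head I d \<in> verts I" using d by auto
    show ?thesis
      unfolding arrow_def
    proof (rule mk_arrow_hom[OF F[OF v(1)] F[OF v(2)]])
      fix X x assume X: "X \<in> Obj B" and "x \<in> on_verts (F (tail I d)) X"
      then obtain y a where x: "y \<in> set_at D (tail I d) X" "a \<in> chains D X" "x = c (tail I d) X (y, a)"
        using elem[OF v(1)] by blast
      show "(let (y, a) = \<iota> (tail I d) X x in c (head I d) X (map_at D d X y, a + frag_of (d, y)))
          \<in> on_verts (F (head I d)) X"
        using \<iota>[OF v(1) X x(1,2)] x(3)
          cF[OF v(2) X map_at_closed[OF D d X x(1)] chains_add[OF x(2) chains_frag_of[OF d x(1)]]]
        by simp
    next
      fix f X Y x assume f: "f \<in> hom_set B X Y" and o: "X \<in> Obj B" "Y \<in> Obj B"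
        and "x \<in> on_verts (F (tail I d)) X"
      then obtain y a where x: "y \<in> set_at D (tail I d) X" "a \<in> chains D X" "x = c (tail I d) X (y, a)"
        using elem[OF v(1)] by blast
      have fx: "act (F (tail I d)) f x = c (tail I d) Y (act (on_verts D (tail I d)) f y, push_chain D f a)"
        using act[OF v(1) f, of "(y, a)"] x by simp
      show "(let (y, a) = \<iota> (tail I d) Y (act (F (tail I d)) f x)
           in c (head I d) Y (map_at D d Y y, a + frag_of (d, y))) =
         act (F (head I d)) f (let (y, a) = \<iota> (tail I d) X x in c (head I d) X (map_at D d X y, a + frag_of (d, y)))"
        using \<iota>[OF v(1) o(1) x(1,2)] x(3) fx
          \<iota>[OF v(1) o(2) set_at_act[OF D v(1) f x(1)] push_chain_closed[OF f x(2)]]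
          act[OF v(2) f, of "(map_at D d X y, a + frag_of (d, y))"]
          map_at_closed[OF D d o(1) x(1)] chains_add[OF x(2) chains_frag_of[OF d x(1)]]
          map_at_natural[OF D d f x(1)]
        by (simp add: push_chain_add_edge)
    qed
  qed
  have proj_hom: "proj i \<in> hom_set PSh (F i) (on_verts D i)" if i: "i \<in> verts I" for i
    unfolding proj_def
  proof (rule mk_arrow_hom[OF F[OF i] diagram_set[OF D i]])
    fix X x assume X: "X \<in> Obj B" and "x \<in> on_verts (F i) X"
    then obtain y a where x: "y \<in> set_at D i X" "a \<in> chains D X" "x = c i X (y, a)"
      using elem[OF i] by blast
    then show "fst (\<iota> i X x) \<in> on_verts (on_verts D i) X"
      using \<iota>[OF i X x(1,2)] by (simp add: set_at_def)
  next
    fix f X Y x assume f: "f \<in> hom_set B X Y" and o: "X \<in> Obj B" "Y \<in> Obj B" and "x \<in> on_verts (F i) X"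
    then obtain y a where x: "y \<in> set_at D i X" "a \<in> chains D X" "x = c i X (y, a)"
      using elem[OF i] by blast
    show "fst (\<iota> i Y (act (F i) f x)) = act (on_verts D i) f (fst (\<iota> i X x))"
      using \<iota>[OF i o(1) x(1,2)] \<iota>[OF i o(2) set_at_act[OF D i f x(1)] push_chain_closed[OF f x(2)]]
        act[OF i f, of "(y, a)"] x by simp
  qed
  have E_vert: "on_verts E i = F i" if "i \<in> verts I" for i using that by (simp add: E_def)
  have E_arc: "on_arcs E d = arrow d" if "d \<in> arcs I" for d using that by (simp add: E_def)
  have E: "diagram I PSh E"
    unfolding graph_morphism_def
  proof (intro conjI ballI)
    show "on_verts E \<in> verts I \<rightarrow>\<^sub>E verts (underlying_graph PSh)" using F by (auto simp: E_def)
    show "on_arcs E \<in> arcs I \<rightarrow>\<^sub>E arcs (underlying_graph PSh)"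
      using arrow_hom by (auto simp: E_def hom_set_iff simp del: functor_category_simps)
  next
    fix d assume d: "d \<in> arcs I"
    then show "tail (underlying_graph PSh) (on_arcs E d) = on_verts E (tail I d)"
      "head (underlying_graph PSh) (on_arcs E d) = on_verts E (head I d)"
      using arrow_hom[OF d] by (auto simp: E_vert E_arc hom_set_iff)
  qed
  have \<tau>_vert: "\<tau> i = proj i" if "i \<in> verts I" for i using that by (simp add: \<tau>_def)
  have sq: "component (on_arcs D d) X (component (proj (tail I d)) X x) =
      component (proj (head I d)) X (component (arrow d) X x)"
    if d: "d \<in> arcs I" and X: "X \<in> Obj B" and x: "x \<in> on_verts (F (tail I d)) X" for d X x
  proof -
    have v: "tail I d \<in> verts I" "head I d \<in> verts I" using d by auto
    obtain y a where x: "y \<in> set_at D (tail I d) X" "a \<in> chains D X" "x = c (tail I d) X (y, a)"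
      using elem[OF v(1) X x] by blast
    show ?thesis
      using proj_comp[OF v(1) X x(1,2)] arrow_comp[OF d X x(1,2)]
        proj_comp[OF v(2) X map_at_closed[OF D d X x(1)] chains_add[OF x(2) chains_frag_of[OF d x(1)]]]
      by (simp add: x(3) map_at_component)
  qed
  have cart: "is_pullback PSh (on_arcs D d) (proj (head I d)) (proj (tail I d)) (arrow d)"
    if d: "d \<in> arcs I" for d
  proof -
    have v: "tail I d \<in> verts I" "head I d \<in> verts I" using d by auto
    show ?thesis
      unfolding is_pullback_PSh_iff[OF diagram_arc[OF D d] proj_hom[OF v(2)] proj_hom[OF v(1)] arrow_hom[OF d]]
    proof (intro ballI conjI impI)
      fix X x assume "X \<in> Obj B" "x \<in> on_verts (F (tail I d)) X"
      then show "component (on_arcs D d) X (component (proj (tail I d)) X x) =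
        component (proj (head I d)) X (component (arrow d) X x)" by (rule sq[OF d])
    next
      fix X y w assume X: "X \<in> Obj B" and y: "y \<in> on_verts (on_verts D (tail I d)) X"
        and w: "w \<in> on_verts (F (head I d)) X"
        and eq: "component (on_arcs D d) X y = component (proj (head I d)) X w"
      have y': "y \<in> set_at D (tail I d) X" using y by (simp add: set_at_def)
      obtain y2 a where "y2 \<in> set_at D (head I d) X" and a: "a \<in> chains D X" and "w = c (head I d) X (y2, a)"
        using elem[OF v(2) X w] by blast
      then have w': "w = c (head I d) X (map_at D d X y, a)"
        using eq proj_comp[OF v(2) X] by (simp add: map_at_component)
      \<comment> \<open>the translation by the edge \<open>(d, y)\<close> is undone\<close>
      let ?a = "a - frag_of (d, y)"
      have a': "?a \<in> chains D X" by (rule chains_diff[OF a chains_frag_of[OF d y']])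
      show "\<exists>!z. z \<in> on_verts (F (tail I d)) X \<and> component (proj (tail I d)) X z = y \<and>
        component (arrow d) X z = w"
      proof (rule ex1I)
        show "c (tail I d) X (y, ?a) \<in> on_verts (F (tail I d)) X \<and>
          component (proj (tail I d)) X (c (tail I d) X (y, ?a)) = y \<and>
          component (arrow d) X (c (tail I d) X (y, ?a)) = w"
          using cF[OF v(1) X y' a'] proj_comp[OF v(1) X y' a'] arrow_comp[OF d X y' a'] w' by simp
      next
        fix z assume z: "z \<in> on_verts (F (tail I d)) X \<and> component (proj (tail I d)) X z = y \<and>
          component (arrow d) X z = w"
        then obtain y3 b where b: "y3 \<in> set_at D (tail I d) X" "b \<in> chains D X" "z = c (tail I d) X (y3, b)"
          using elem[OF v(1) X] by blast
        have y3: "y3 = y" using z proj_comp[OF v(1) X b(1,2)] b(3) by simp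
        have bd: "b + frag_of (d, y) \<in> chains D X" by (rule chains_add[OF b(2) chains_frag_of[OF d y']])
        have "c (head I d) X (map_at D d X y, b + frag_of (d, y)) = c (head I d) X (map_at D d X y, a)"
          using z arrow_comp[OF d X b(1,2)] b(3) y3 w' by simp
        then have "(map_at D d X y, b + frag_of (d, y)) = (map_at D d X y, a)"
          using \<iota>[OF v(2) X map_at_closed[OF D d X y'] bd] \<iota>[OF v(2) X map_at_closed[OF D d X y'] a]
          by metis
        then have "b = ?a" by auto
        then show "z = c (tail I d) X (y, ?a)" using b(3) y3 by simp
      qed
    qed
  qed
  have nt: "nat_trans I PSh E D \<tau>"
  proof (rule nat_transI)
    show "\<tau> \<in> extensional (verts I)" unfolding \<tau>_def by (rule restrict_extensional)
    show "\<tau> i \<in> hom_set PSh (on_verts E i) (on_verts D i)" if "i \<in> verts I" for i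
      using proj_hom[OF that] that by (simp add: E_vert \<tau>_vert)
    fix d assume d: "d \<in> arcs I"
    have v: "tail I d \<in> verts I" "head I d \<in> verts I" using d by auto
    show "\<tau> (head I d) \<odot>\<^bsub>PSh\<^esub> on_arcs E d = on_arcs D d \<odot>\<^bsub>PSh\<^esub> \<tau> (tail I d)"
      using pullback_hom(5)[OF cart[OF d]] v d by (simp add: E_arc \<tau>_vert)
  qed
  have "\<forall>d \<in> arcs I. is_pullback PSh (on_arcs D d) (\<tau> (head I d)) (\<tau> (tail I d)) (on_arcs E d)"
    using cart by (auto simp: E_arc \<tau>_vert)
  then have "Arrow E \<tau> D \<in> Obj (cartesian_slice I PSh D)"
    unfolding Obj_cartesian_slice using E D nt by blast
  then show ?thesis
    by (intro exI[of _ E] exI[of _ \<tau>] exI[of _ c])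
      (use c proj_comp arrow_comp in \<open>auto simp: set_at_def E_vert E_arc \<tau>_vert map_at_component\<close>)
qed

end

end

section \<open>Mapping paths and their chains\<close>

text \<open>
  A segment runs along an edge of the graph of elements, forwards or backwards. The chain of a path
  counts its edges with signs, so that traversing an edge back and forth cancels.
\<close>

fun segment_edge :: "('e, 'u) segment \<Rightarrow> 'e \<times> 'u" where
  "segment_edge (y, Fwd d, y') = (d, y)"
| "segment_edge (y, Opp d, y') = (d, y')"

fun segment_chain :: "('e, 'u) segment \<Rightarrow> ('e \<times> 'u \<Rightarrow>\<^sub>0 int)" where
  "segment_chain (y, Fwd d, y') = frag_of (d, y)"
| "segment_chain (y, Opp d, y') = - frag_of (d, y')"

definition path_chain :: "('e, 'u) segment list \<Rightarrow> ('e \<times> 'u \<Rightarrow>\<^sub>0 int)" where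
  "path_chain p = sum_list (map segment_chain p)"

lemma path_chain_simps [simp]:
  "path_chain [] = 0" "path_chain (s # p) = segment_chain s + path_chain p"
  by (simp_all add: path_chain_def)

lemma weakly_equal_iff_edge:
  assumes "path_segment I D X s" "path_segment I D X s'"
  shows "weakly_equal s s' \<longleftrightarrow> segment_edge s = segment_edge s'"
proof -
  obtain y \<delta> y' where s: "s = (y, \<delta>, y')" by (cases s)
  obtain z \<epsilon> z' where s': "s' = (z, \<epsilon>, z')" by (cases s')
  show ?thesis
    using assms unfolding s s' by (cases \<delta>; cases \<epsilon>) auto
qed

lemma mapping_path_segments:
  "mapping_path I D X z p z' \<Longrightarrow> s \<in> set p \<Longrightarrow> path_segment I D X s"
  by (induction rule: mapping_path.induct) auto

lemma proper_path_distinct_edges: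
  assumes "mapping_path I D X z p z'" "proper_path p"
  shows "distinct (map segment_edge p)"
  unfolding distinct_conv_nth
proof (intro allI impI)
  fix m n assume "m < length (map segment_edge p)" "n < length (map segment_edge p)" "m \<noteq> n"
  then show "map segment_edge p ! m \<noteq> map segment_edge p ! n"
    using assms(2) weakly_equal_iff_edge[of I D X "p ! m" "p ! n"] mapping_path_segments[OF assms(1)]
    by (auto simp: proper_path_def)
qed

text \<open>
  Each edge occurs at most once and so keeps its coefficient \<open>1\<close> or \<open>-1\<close>; in particular the chain of
  a nonempty proper path is not zero.
\<close>

lemma keys_path_chain:
  assumes "distinct (map segment_edge p)"
  shows "Poly_Mapping.keys (path_chain p) = segment_edge ` set p"
  using assms
proof (induction p)
  case Nil
  then show ?case by simp
next
  case (Cons s p)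
  have "segment_chain s = Poly_Mapping.single (segment_edge s) 1 \<or>
      segment_chain s = Poly_Mapping.single (segment_edge s) (- 1)"
    by (cases s rule: segment_chain.cases) (auto simp: single_uminus)
  then obtain k :: int where k: "k \<noteq> 0" "segment_chain s = Poly_Mapping.single (segment_edge s) k"
    by (metis neg_equal_0_iff_equal zero_neq_one)
  have l: "Poly_Mapping.lookup (path_chain p) (segment_edge s) = 0"
    using Cons by (metis distinct.simps(2) in_keys_iff list.simps(9) list.set_map)
  have "e \<in> Poly_Mapping.keys (path_chain (s # p)) \<longleftrightarrow>
      e = segment_edge s \<or> e \<in> Poly_Mapping.keys (path_chain p)" for e
    using k l by (auto simp: in_keys_iff lookup_add lookup_single when_def)
  then show ?case using Cons by auto
qed

context wf_digraph
begin

lemma mapping_path_ends: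
  assumes "mapping_path G D X z p z'"
  shows "\<exists>i \<in> verts G. z \<in> set_at D i X" "\<exists>i \<in> verts G. z' \<in> set_at D i X"
proof -
  have *: "\<exists>i \<in> verts G. y \<in> set_at D i X" if "path_segment G D X (y, \<delta>, y')" for y \<delta> y'
    using that by (cases \<delta>) auto
  show "\<exists>i \<in> verts G. z \<in> set_at D i X" "\<exists>i \<in> verts G. z' \<in> set_at D i X"
    using assms by (induction rule: mapping_path.induct) (use * in blast)+
qed

lemma mapping_path_append:
  "mapping_path G D X z (a @ b) z' \<longleftrightarrow> (\<exists>w. mapping_path G D X z a w \<and> mapping_path G D X w b z')"
proof (induction a arbitrary: z)
  case Nil
  have "w = z" if "mapping_path G D X z [] w" for w using that by (auto elim: mapping_path.cases)
  moreover have "mapping_path G D X z [] z" if "mapping_path G D X z b z'"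
    using mapping_path_ends(1)[OF that] mapping_path.empty by metis
  ultimately show ?case by auto
next
  case (Cons s a)
  show ?case
  proof
    assume "mapping_path G D X z ((s # a) @ b) z'"
    then obtain \<delta> y where s: "s = (z, \<delta>, y)" "path_segment G D X s" "mapping_path G D X y (a @ b) z'"
      by (auto elim: mapping_path.cases)
    then show "\<exists>w. mapping_path G D X z (s # a) w \<and> mapping_path G D X w b z'"
      using Cons.IH mapping_path.step by metis
  next
    assume "\<exists>w. mapping_path G D X z (s # a) w \<and> mapping_path G D X w b z'"
    then obtain w \<delta> y where "mapping_path G D X w b z'" and s: "s = (z, \<delta>, y)" "path_segment G D X s"
      "mapping_path G D X y a w"
      by (auto elim: mapping_path.cases)
    then show "mapping_path G D X z ((s # a) @ b) z'"
      using Cons.IH mapping_path.step by (metis append_Cons)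
  qed
qed

lemma mapping_path_Cons:
  "mapping_path G D X z (s # p) z' \<longleftrightarrow>
    (\<exists>\<delta> y. s = (z, \<delta>, y) \<and> path_segment G D X s \<and> mapping_path G D X y p z')"
  by (auto elim: mapping_path.cases intro: mapping_path.step)

lemma mapping_path_prefix:
  assumes "mapping_path G D X z (a @ (y, \<delta>, y') # b) z'"
  shows "mapping_path G D X z a y" "mapping_path G D X z (a @ [(y, \<delta>, y')]) y'"
proof -
  obtain w where w: "mapping_path G D X z a w" "mapping_path G D X w ((y, \<delta>, y') # b) z'"
    using assms by (auto simp: mapping_path_append)
  then show "mapping_path G D X z a y" by (auto simp: mapping_path_Cons)
  have "mapping_path G D X y' [] y'"
    using w(2) mapping_path_ends(1) mapping_path.empty by (metis mapping_path_Cons prod.inject)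
  then have "mapping_path G D X y [(y, \<delta>, y')] y'"
    using w(2) by (auto simp: mapping_path_Cons)
  then show "mapping_path G D X z (a @ [(y, \<delta>, y')]) y'"
    using \<open>mapping_path G D X z a y\<close> by (auto simp: mapping_path_append)
qed

text \<open>
  Two different proper paths with the same chain traverse the same edges. At the point where they
  part, the next edge of the one is traversed later by the other, in either direction, which
  closes a path without repeated edges; its chain is not zero.
\<close>

lemma proper_path_unique:
  assumes chain: "\<And>z z' p q. mapping_path G D X z p z' \<Longrightarrow> mapping_path G D X z q z' \<Longrightarrow>
      path_chain p = path_chain q"
    and "mapping_path G D X z p z'" "proper_path p" "mapping_path G D X z q z'" "proper_path q"
  shows "p = q"
proof -
  have closed: "p = []" if "mapping_path G D X z p z" "distinct (map segment_edge p)" for z p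
  proof -
    have "mapping_path G D X z [] z"
      using mapping_path_ends(1)[OF that(1)] mapping_path.empty by metis
    then have "path_chain p = 0" using chain[OF that(1)] by simp
    then show ?thesis using keys_path_chain[OF that(2)] by simp
  qed
  have "distinct (map segment_edge p)" "distinct (map segment_edge q)"
    by (rule proper_path_distinct_edges[OF assms(2,3)], rule proper_path_distinct_edges[OF assms(4,5)])
  with assms(2,4) show ?thesis
  proof (induction p arbitrary: z q)
    case Nil
    then have "z = z'" by (auto elim: mapping_path.cases)
    then show ?case using closed Nil by metis
  next
    case (Cons s p)
    have keys: "segment_edge ` set (s # p) = segment_edge ` set q"
      using keys_path_chain[OF Cons.prems(3)] keys_path_chain[OF Cons.prems(4)]
        chain[OF Cons.prems(1,2)] by simp
    then obtain s' q' where q: "q = s' # q'" by (cases q) auto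
    obtain \<delta> y where s: "s = (z, \<delta>, y)" "path_segment G D X s" and p: "mapping_path G D X y p z'"
      using Cons.prems(1) by (auto simp: mapping_path_Cons)
    obtain \<epsilon> w where s': "s' = (z, \<epsilon>, w)" "path_segment G D X s'" and q': "mapping_path G D X w q' z'"
      using Cons.prems(2) by (auto simp: q mapping_path_Cons)
    have "s = s'"
    proof (rule ccontr)
      assume ne: "s \<noteq> s'"
      have "segment_edge s' \<in> segment_edge ` set (s # p)" using keys q by simp
      then obtain r where r: "r \<in> set (s # p)" "segment_edge r = segment_edge s'" by force
      then obtain a b where ab: "s # p = a @ r # b" by (meson split_list)
      obtain u \<eta> v where r': "r = (u, \<eta>, v)" by (cases r)
      note pre = mapping_path_prefix[OF Cons.prems(1)[unfolded ab r']]
      have d: "distinct (map segment_edge a)" "distinct (map segment_edge (a @ [r]))"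
        using Cons.prems(3) unfolding ab by auto
      have "weakly_equal r s'"
        by (rule iffD2[OF weakly_equal_iff_edge[OF mapping_path_segments[OF Cons.prems(1) r(1)] s'(2)] r(2)])
      then consider "r = s'" | "r = (w, opposite \<epsilon>, z)"
        unfolding r' s'(1) weakly_equal.simps by auto
      then show False
      proof cases
        case 1
        then have "a = []" using closed[OF _ d(1)] pre(1) r' s'(1) by simp
        then show False using ab 1 ne by simp
      next
        case 2
        then have "a @ [r] = []" using closed[OF _ d(2)] pre(2) r' by simp
        then show False by simp
      qed
    qed
    then have "y = w" using s(1) s'(1) by simp
    then have "p = q'" using Cons.IH[OF p, of q'] q' Cons.prems(3,4) q by simp
    then show ?case using q \<open>s = s'\<close> by simp
  qed
qed

end

section \<open>The Van Kampen property\<close>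

context presheaf_diagrams
begin

text \<open>
  Transport in the twisted covering. Disjointness of the sets of \<open>D\<close> is what makes consecutive
  segments of a path meet at the same vertex of \<open>I\<close>, so that their edges form a zigzag.
\<close>

lemma twisted_covering_path:
  assumes D: "diagram I PSh D"
    and disjoint: "\<And>i j. i \<in> verts I \<Longrightarrow> j \<in> verts I \<Longrightarrow> i \<noteq> j \<Longrightarrow> set_at D i X \<inter> set_at D j X = {}"
    and X: "X \<in> Obj B"
    and c: "\<And>i y a. i \<in> verts I \<Longrightarrow> y \<in> set_at D i X \<Longrightarrow> a \<in> chains D X \<Longrightarrow> c i (y, a) \<in> set_at E i X"
    and arc: "\<And>d y a. d \<in> arcs I \<Longrightarrow> y \<in> set_at D (tail I d) X \<Longrightarrow> a \<in> chains D X \<Longrightarrow>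
      map_at E d X (c (tail I d) (y, a)) = c (head I d) (map_at D d X y, a + frag_of (d, y))"
    and path: "mapping_path I D X z p z'"
    and z: "i \<in> verts I" "z \<in> set_at D i X" "j \<in> verts I" "z' \<in> set_at D j X" and a: "a \<in> chains D X"
  shows "a + path_chain p \<in> chains D X \<and>
    ((i, c i (z, a)), (j, c j (z', a + path_chain p))) \<in> linked E X"
  using path z a
proof (induction arbitrary: i a rule: mapping_path.induct)
  case (empty k y)
  then have "i = j" using disjoint by blast
  then show ?case using empty by (simp add: linked_refl)
next
  case (step y \<delta> y' p y'')
  have one: "((tail I d, c (tail I d) (x, b)), (head I d, c (head I d) (map_at D d X x, b + frag_of (d, x))))
      \<in> linked E X" if "d \<in> arcs I" "x \<in> set_at D (tail I d) X" "b \<in> chains D X" for d x b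
    using linked_arc[OF that(1) c[OF _ that(2,3)]] arc[OF that] that(1) by simp
  show ?case
  proof (cases \<delta>)
    case (Fwd d)
    then have d: "d \<in> arcs I" "y \<in> set_at D (tail I d) X" "y' = map_at D d X y"
      using step.hyps(1) by auto
    have i: "i = tail I d" using disjoint[OF step.prems(1), of "tail I d"] step.prems(2) d by auto
    have a: "a + frag_of (d, y) \<in> chains D X"
      by (rule chains_add[OF step.prems(5) chains_frag_of[OF d(1,2)]])
    have "head I d \<in> verts I" "y' \<in> set_at D (head I d) X"
      using d map_at_closed[OF D d(1) X d(2)] by auto
    from step.IH[OF this step.prems(3,4) a] one[OF d(1,2) step.prems(5)]
    show ?thesis using linked_trans by (auto simp: Fwd i d(3) add.assoc)
  next
    case (Opp d)
    then have d: "d \<in> arcs I" "y' \<in> set_at D (tail I d) X" "y = map_at D d X y'"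
      using step.hyps(1) by auto
    have i: "i = head I d"
      using disjoint[OF step.prems(1), of "head I d"] step.prems(2) d map_at_closed[OF D d(1) X d(2)]
      by auto
    have a: "a - frag_of (d, y') \<in> chains D X"
      by (rule chains_diff[OF step.prems(5) chains_frag_of[OF d(1,2)]])
    have "tail I d \<in> verts I" using d by auto
    from step.IH[OF this d(2) step.prems(3,4) a] linked_sym[OF one[OF d(1,2) a]]
    show ?thesis
      using linked_trans by (auto simp: Opp i d(3) algebra_simps)
  qed
qed

end

locale colimiting_presheaf_cocone = presheaf_diagrams U B I
  for U :: "'u set set" and B :: "('o, 'a) category" and I :: "('v, 'e) pre_digraph" +
  fixes pb D S \<kappa>
  assumes small_arcs: "small U (arcs I)"
    and chosen: "chosen_pullbacks PSh pb"
    and colimiting: "colimiting_cocone I PSh D S \<kappa>"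
begin

sublocale cocone_pullback PSh I pb D S \<kappa>
proof -
  interpret PSh: category PSh by (rule category_PSh)
  show "cocone_pullback PSh I pb D S \<kappa>"
    by unfold_locales (use chosen colimiting in \<open>auto simp: colimiting_cocone_def\<close>)
qed

lemma elementwise: "elementwise_colimit D S \<kappa>"
  by (rule colimiting_imp_elementwise[OF colimiting])

text \<open>
  If \<open>\<kappa>\<close> has the Van Kampen property, \<open>E\<close> is isomorphic to the pullback family of some
  \<open>\<sigma> : K \<rightarrow> S\<close>. The legs of that family to \<open>K\<close> are constant along zigzags, and an element of a
  pullback is determined by its images in \<open>D\<close> and in \<open>K\<close>. So \<open>E\<close> has no monodromy.
\<close>

lemma van_kampen_trivial_monodromy:
  assumes vk: "van_kampen_cocone I PSh pb D S \<kappa>"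
    and E: "Arrow E \<tau> D \<in> Obj (cartesian_slice I PSh D)"
    and X: "X \<in> Obj B" and i: "i \<in> verts I" and x: "x \<in> set_at E i X" "x' \<in> set_at E i X"
    and l: "((i, x), (i, x')) \<in> linked E X" and eq: "component (\<tau> i) X x = component (\<tau> i) X x'"
  shows "x = x'"
proof -
  let ?C = "cartesian_slice I PSh D"
  have dE: "diagram I PSh E" using E by (auto simp: Obj_cartesian_slice)
  obtain \<sigma> where "\<sigma> \<in> Obj (slice PSh S)" and iso: "isomorphic_in ?C (on_verts pullback \<sigma>) (Arrow E \<tau> D)"
    using equivalence_functor_essentially_surjective[OF _ category_cartesian_slice[OF category wf] E]
      vk van_kampen_cocone_iff_equivalence by blast
  then have \<sigma>: "\<sigma> \<in> Arr PSh" "Cod PSh \<sigma> = S" by (simp_all del: functor_category_simps)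
  let ?P = "src (family \<sigma>)"
  obtain f g where f: "f \<in> hom_set ?C (family \<sigma>) (Arrow E \<tau> D)" and g: "g \<in> hom_set ?C (Arrow E \<tau> D) (family \<sigma>)"
    and fg: "f \<odot>\<^bsub>?C\<^esub> g = Ident ?C (Arrow E \<tau> D)"
    using iso unfolding isomorphic_in_def pullback_on_verts[OF \<sigma>] by blast
  obtain k where k: "f = Arrow (family \<sigma>) (Arrow ?P k E) (Arrow E \<tau> D)" "nat_trans I PSh ?P E k"
    using f[unfolded hom_set_cartesian_slice[OF category wf]] by auto
  obtain h where h: "g = Arrow (Arrow E \<tau> D) (Arrow E h ?P) (family \<sigma>)" "nat_trans I PSh E ?P h"
    and \<tau>h: "\<And>i. i \<in> verts I \<Longrightarrow> val (family \<sigma>) i \<odot>\<^bsub>PSh\<^esub> h i = \<tau> i"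
    using g[unfolded hom_set_cartesian_slice[OF category wf]] by auto
  have kh: "k i \<odot>\<^bsub>PSh\<^esub> h i = Ident PSh (on_verts E i)"
  proof -
    have "(\<lambda>i \<in> verts I. k i \<odot>\<^bsub>PSh\<^esub> h i) = (\<lambda>i \<in> verts I. Ident PSh (on_verts E i))"
      using fg unfolding k(1) h(1) by (simp add: cartesian_slice_def del: functor_category_simps)
    from fun_cong[OF this, of i] show ?thesis using i by (simp del: functor_category_simps)
  qed
  have hi: "h i \<in> hom_set PSh (on_verts E i) (Dom PSh (proj \<sigma> i))"
    using nat_trans_hom[OF h(2) i] unfolding family_simps(3)[OF \<sigma> i] .
  have ki: "k i \<in> hom_set PSh (Dom PSh (proj \<sigma> i)) (on_verts E i)"
    using nat_trans_hom[OF k(2) i] unfolding family_simps(3)[OF \<sigma> i] .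
  have x': "x \<in> on_verts (on_verts E i) X" "x' \<in> on_verts (on_verts E i) X"
    using x by (auto simp: set_at_def)
  have "component (h i) X x = component (h i) X x'"
  proof (rule pullback_element_unique[OF pullback_square[OF \<sigma> i] kappa_hom[OF i] \<sigma>_hom[OF \<sigma>]
        proj_hom[OF \<sigma> i] leg_hom[OF \<sigma> i] X])
    show "component (h i) X x \<in> on_verts (Dom PSh (proj \<sigma> i)) X"
      "component (h i) X x' \<in> on_verts (Dom PSh (proj \<sigma> i)) X"
      using component_closed[OF hi X] x' by auto
    have ph: "proj \<sigma> i \<odot>\<^bsub>PSh\<^esub> h i = \<tau> i" using \<tau>h[OF i] unfolding family_simps(2)[OF \<sigma> i] .
    show "component (proj \<sigma> i) X (component (h i) X x) = component (proj \<sigma> i) X (component (h i) X x')"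
      using component_Comp[OF hi proj_hom[OF \<sigma> i] X x'(1)]
        component_Comp[OF hi proj_hom[OF \<sigma> i] X x'(2)] ph eq by simp
    have "((i, component (h i) X x), (i, component (h i) X x')) \<in> linked ?P X"
    proof (rule linked_map[OF l, of "\<lambda>i. component (h i) X" ?P X])
      fix d y assume d: "d \<in> arcs I" "y \<in> set_at E (tail I d) X"
      show "component (h (tail I d)) X y \<in> set_at ?P (tail I d) X"
        using nat_trans_component(1)[OF h(2) _ X d(2)] d(1) by auto
      show "component (h (head I d)) X (map_at E d X y) = map_at ?P d X (component (h (tail I d)) X y)"
        by (rule nat_trans_component(2)[OF h(2) dE family_diagram[OF \<sigma>] d(1) X d(2)])
    qed
    from cocone_linked[OF leg_cocone[OF \<sigma>] X this]
    show "component (leg \<sigma> i) X (component (h i) X x) = component (leg \<sigma> i) X (component (h i) X x')"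
      using i by simp
  qed
  then show ?thesis
    using component_Comp[OF hi ki X x'(1)] component_Comp[OF hi ki X x'(2)] kh
      component_Ident[OF X x'(1)] component_Ident[OF X x'(2)] by simp
qed

text \<open>
  Transport of the chain \<open>0\<close> along the two paths produces their chains over the same element, and
  these are equal since the twisted covering has no monodromy.
\<close>

lemma van_kampen_path_chain:
  assumes vk: "van_kampen_cocone I PSh pb D S \<kappa>"
    and disjoint: "\<And>i j. i \<in> verts I \<Longrightarrow> j \<in> verts I \<Longrightarrow> i \<noteq> j \<Longrightarrow> set_at D i X \<inter> set_at D j X = {}"
    and X: "X \<in> Obj B"
    and p: "mapping_path I D X z p z'" and q: "mapping_path I D X z q z'"
  shows "path_chain p = path_chain q"
proof -
  obtain E \<tau> c where E: "Arrow E \<tau> D \<in> Obj (cartesian_slice I PSh D)"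
    and c: "\<And>i. i \<in> verts I \<Longrightarrow> bij_betw (c i X) (set_at D i X \<times> chains D X) (set_at E i X)"
    and \<tau>: "\<And>i y a. i \<in> verts I \<Longrightarrow> y \<in> set_at D i X \<Longrightarrow> a \<in> chains D X \<Longrightarrow>
      component (\<tau> i) X (c i X (y, a)) = y"
    and arc: "\<And>d y a. d \<in> arcs I \<Longrightarrow> y \<in> set_at D (tail I d) X \<Longrightarrow> a \<in> chains D X \<Longrightarrow>
      map_at E d X (c (tail I d) X (y, a)) = c (head I d) X (map_at D d X y, a + frag_of (d, y))"
    using twisted_covering_exists[OF diagram small_arcs] X by metis
  have cE: "c i X (y, a) \<in> set_at E i X" if "i \<in> verts I" "y \<in> set_at D i X" "a \<in> chains D X" for i y a
    using bij_betw_apply[OF c[OF that(1)]] that(2,3) by blast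
  obtain i j where i: "i \<in> verts I" "z \<in> set_at D i X" and j: "j \<in> verts I" "z' \<in> set_at D j X"
    using I.mapping_path_ends[OF p] by blast
  have path: "path_chain p \<in> chains D X \<and>
      ((i, c i X (z, 0)), (j, c j X (z', path_chain p))) \<in> linked E X"
    if "mapping_path I D X z p z'" for p
    using twisted_covering_path[where c = "\<lambda>i. c i X", OF diagram disjoint X cE arc that i j chains_0]
    by simp
  note pc = conjunct1[OF path[OF p]] conjunct1[OF path[OF q]]
  have "((j, c j X (z', path_chain p)), (j, c j X (z', path_chain q))) \<in> linked E X"
    by (rule linked_trans[OF linked_sym[OF conjunct2[OF path[OF p]]] conjunct2[OF path[OF q]]])
  then have "c j X (z', path_chain p) = c j X (z', path_chain q)"
    by (rule van_kampen_trivial_monodromy[OF vk E X j(1) cE[OF j pc(1)] cE[OF j pc(2)]])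
      (simp add: \<tau>[OF j pc(1)] \<tau>[OF j pc(2)])
  then have "(z', path_chain p) = (z', path_chain q)"
    by (rule inj_onD[OF bij_betw_imp_inj_on[OF c[OF j(1)]]]) (use pc j(2) in auto)
  then show ?thesis by simp
qed

text \<open>
  By stability of colimits only essential surjectivity depends on the shape of \<open>D\<close>. A cartesian
  transformation from \<open>E\<close> to \<open>D\<close> is the pullback of the arrow to \<open>S\<close> that it induces on the colimit
  of \<open>E\<close>.
\<close>

lemma forest_imp_van_kampen:
  assumes forest: "\<And>X z p. X \<in> Obj B \<Longrightarrow> mapping_path I D X z p z \<Longrightarrow> proper_path p \<Longrightarrow> p = []"
  shows "van_kampen_cocone I PSh pb D S \<kappa>"
  unfolding van_kampen_cocone_iff_equivalence
proof (rule equivalence_functorI[OF category_slice[OF category] category_cartesian_slice[OF category wf]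
      pullback_is_functor pullback_fully_faithful])
  fix \<sigma> assume \<sigma>: "\<sigma> \<in> Arr PSh" "Cod PSh \<sigma> = S"
  have "nat_trans I PSh (src (family \<sigma>)) D (val (family \<sigma>))"
    using family_Obj[OF \<sigma>] by (auto simp: Obj_cartesian_slice)
  then show "colimiting_cocone I PSh (src (family \<sigma>)) (Dom PSh \<sigma>) (\<lambda>i \<in> verts I. leg \<sigma> i)"
  proof (rule elementwise_imp_colimiting[OF elementwise_colimit_stable[OF elementwise \<sigma>_hom[OF \<sigma>] _ leg_cocone[OF \<sigma>]]])
    fix i assume i: "i \<in> verts I"
    then show "is_pullback PSh (\<kappa> i) \<sigma> (val (family \<sigma>) i) ((\<lambda>i \<in> verts I. leg \<sigma> i) i)"
      using pullback_square[OF \<sigma> i] family_simps(2)[OF \<sigma> i] by simp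
  qed
next
  fix A assume A: "A \<in> Obj (cartesian_slice I PSh D)"
  then obtain E \<tau> where E: "A = Arrow E \<tau> D" and dE: "diagram I PSh E" and \<tau>: "nat_trans I PSh E D \<tau>"
    by (auto simp: Obj_cartesian_slice)
  obtain K \<rho> where K: "elementwise_colimit E K \<rho>" using elementwise_colimit_exists[OF dE] by blast
  obtain \<sigma> where \<sigma>1: "\<sigma> \<in> hom_set PSh K S"
    and \<sigma>2: "\<And>i. i \<in> verts I \<Longrightarrow> \<sigma> \<odot>\<^bsub>PSh\<^esub> \<rho> i = (\<lambda>i \<in> verts I. \<kappa> i \<odot>\<^bsub>PSh\<^esub> \<tau> i) i"
    using colimiting_factor[OF elementwise_imp_colimiting[OF K] cocone_nat_trans[OF category wf dE \<tau> cocone]]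
    by blast
  have \<sigma>: "\<sigma> \<in> hom_set PSh K S" "\<And>i. i \<in> verts I \<Longrightarrow> \<sigma> \<odot>\<^bsub>PSh\<^esub> \<rho> i = \<kappa> i \<odot>\<^bsub>PSh\<^esub> \<tau> i"
    using \<sigma>1 \<sigma>2 by simp_all
  then have s: "\<sigma> \<in> Arr PSh" "Cod PSh \<sigma> = S" "Dom PSh \<sigma> = K" by (auto simp: hom_set_iff)
  have "isomorphic_in (cartesian_slice I PSh D) (on_verts pullback \<sigma>) A"
    unfolding E
    by (rule isomorphic_pullback_family[OF s(1,2) A[unfolded E] elementwise_cocone[OF K, folded s(3)]
          cartesian_over_forest[OF elementwise A[unfolded E] K \<sigma> forest]])
  then show "\<exists>\<sigma> \<in> Obj (slice PSh S). isomorphic_in (cartesian_slice I PSh D) (on_verts pullback \<sigma>) A"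
    using s(1,2) by (intro bexI[of _ \<sigma>]) (simp_all del: functor_category_simps)
qed

end

theorem theorem3p5:
  fixes U :: "'u set set"
    and B :: "('o, 'a) category"
    and I :: "('v, 'e) pre_digraph"
    and D :: "('v, 'e, 'o, 'a, 'u) presheaf_diagram"
    and S :: "('o, 'a, 'u) presheaf"
    and \<kappa> :: "'v \<Rightarrow> ('o, 'a, 'u) presheaf_arrow"
    and pb :: "('o, 'a, 'u) presheaf_arrow \<Rightarrow> ('o, 'a, 'u) presheaf_arrow \<Rightarrow>
      ('o, 'a, 'u) presheaf_arrow \<times> ('o, 'a, 'u) presheaf_arrow"
  assumes "set_universe U"
    and "category B" and "small U (Obj B)" and "small U (Arr B)"
    and "wf_digraph I" and "small U (verts I)" and "small U (arcs I)"
    and "diagram I (presheaves U B) D"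
    and "\<And>X i j. X \<in> Obj B \<Longrightarrow> i \<in> verts I \<Longrightarrow> j \<in> verts I \<Longrightarrow> i \<noteq> j \<Longrightarrow>
           set_at D i X \<inter> set_at D j X = {}"
    and "chosen_pullbacks (presheaves U B) pb"
    and "colimiting_cocone I (presheaves U B) D S \<kappa>"
  shows "van_kampen_cocone I (presheaves U B) pb D S \<kappa> \<longleftrightarrow>
    (\<forall>X \<in> Obj B. \<forall>i \<in> verts I. \<forall>j \<in> verts I. \<forall>z \<in> set_at D i X. \<forall>z' \<in> set_at D j X.
       \<not> (\<exists>p q. mapping_path I D X z p z' \<and> proper_path p \<and>
                mapping_path I D X z q z' \<and> proper_path q \<and> p \<noteq> q))"
    (is "?vk \<longleftrightarrow> ?unique")
proof -
  interpret B: category B by fact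
  interpret I: wf_digraph I by fact
  interpret colimiting_presheaf_cocone U B I pb D S \<kappa>
    by unfold_locales (use assms in auto)
  show ?thesis
  proof
    assume vk: ?vk
    show ?unique
    proof (intro ballI notI, elim exE conjE)
      fix X i j z z' p q assume X: "X \<in> Obj B"
        and p: "mapping_path I D X z p z'" "proper_path p"
        and q: "mapping_path I D X z q z'" "proper_path q" and "p \<noteq> q"
      have "p = q"
        by (rule I.proper_path_unique[OF van_kampen_path_chain[OF vk assms(9) X] p q]) (use X in auto)
      with \<open>p \<noteq> q\<close> show False by contradiction
    qed
  next
    assume u: ?unique
    show ?vk
    proof (rule forest_imp_van_kampen)
      fix X z p assume X: "X \<in> Obj B" and p: "mapping_path I D X z p z" "proper_path p"
      obtain i where i: "i \<in> verts I" "z \<in> set_at D i X" using I.mapping_path_ends(1)[OF p(1)] by blast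
      have "mapping_path I D X z [] z" "proper_path []"
        using i by (auto intro: mapping_path.empty simp: proper_path_def)
      then show "p = []" using u X i p by blast
    qed
  qed
qed

end
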